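(* Let $\kappa$ be a positive definite kernel on $X$, $\mathbf A=(A_i)_{i\in I}$ an $(I^+,I^-)$-condenser, and $\mathbf f$, $\mathbf a$, $\mathbf g$ as in the context. Given $\lambda\in\mathcal G_{\mathbf f}(\mathbf A,\mathbf a,\mathbf g)$, we have $$\bigl\langle W_\lambda^i,\lambda^i\bigr\rangle=\text{"}\!\inf_{x\in A_i}\!\text{"}\ \frac{a_i\,W_\lambda^i(x)}{g_i(x)}\quad\text{for all }i\in I$$ and, hence, $$G_{\mathbf f}(\lambda)=\sum_{i\in I}\ \text{"}\!\inf_{x\in A_i}\!\text{"}\ \frac{a_i\,W_\lambda^i(x)}{g_i(x)}+\langle\mathbf f,\lambda\rangle.$$
   Context: Let $X$ be a locally compact Hausdorff space and $\mathfrak M$ the space of real-valued (signed) Radon measures on $X$. For a locally compact space $Y$, $\Phi(Y)$ is the set of lower semicontinuous $\psi:Y\to(-\infty,\infty]$, with $\psi\ge0$ required unless $Y$ is compact. Write $\langle u,\nu\rangle:=\int u\,d\nu$. A kernel is an element $\kappa\in\Phi(X\times X)$; $\kappa(\nu,\nu_1):=\int\kappa\,d(\nu\otimes\nu_1)$ and $\kappa(x,\nu):=\int\kappa(x,y)\,d\nu(y)$ whenever well defined. $\kappa$ is positive definite if it is symmetric and $\kappa(\nu,\nu)\ge0$ for every $\nu\in\mathfrak M$ for which it is defined. Then $\mathcal E:=\{\nu\in\mathfrak M:-\infty<\kappa(\nu,\nu)<\infty\}$ is a pre-Hilbert space with scalar product $\kappa(\nu,\nu_1)$ and seminorm $\|\nu\|:=\sqrt{\kappa(\nu,\nu)}$.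 $\mathfrak M^+(E)$ is the set of nonnegative measures supported by the closed set $E$; $\mathcal E^+:=\mathfrak M^+(X)\cap\mathcal E$. The interior capacity of $E\subset X$ is $C(E):=[\inf\|\nu\|^2]^{-1}$, the infimum over $\nu\in\mathcal E^+$ with $\nu(X)=1$ and compact support contained in $E$ ($\inf\varnothing=\infty$, $1/\infty=0$, $1/0=\infty$). A property holds nearly everywhere (n.e.) in $E$ if the set of $x\in E$ where it fails has interior capacity zero. For $E$ of nonzero interior capacity and a universally measurable $\psi$ bounded from below n.e. in $E$, $\text{"}\inf_{x\in E}\text{"}\,\psi(x):=\sup\{q:\psi(x)\ge q\text{ n.e. in }E\}$. $I^+$, $I^-$ are disjoint countable (finite or infinite) sets of indices in $\mathbb N$, $I^-$ possibly empty, $I=I^+\cup I^-$; $\alpha_i=+1$ for $i\in I^+$ and $\alpha_i=-1$ for $i\in I^-$. An $(I^+,I^-)$-condenser is a family $\mathbf A=(A_i)_{i\in I}$ of nonempty closed sets in $X$ such that every compact set meets at most finitely many $A_i$ and $A_i\cap A_j=\varnothing$ for $i\in I^+$, $j\in I^-$. $\mathfrak M(\mathbf A):=\prod_{i\in I}\mathfrak M^+(A_i)$ consists of vector measures $\mu=(\mu^i)_{i\in I}$. Put $\kappa(\mu,\mu_1):=\sum_{i,j\in I}\alpha_i\alpha_j\kappa(\mu^i,\mu_1^j)$ and $\kappa_\mu=(\kappa^i_\mu)_{i\in I}$ with $\kappa_\mu^i(x):=\sum_{j\in I}\alpha_i\alpha_j\kappa(x,\mu^j)$. $\mathcal E(\mathbf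 A)$ is the set of $\mu\in\mathfrak M(\mathbf A)$ with $\kappa(\mu,\mu)$ finite (absolute convergence). External field: $\mathbf f=(f_i)_{i\in I}$, where for each $i$ there are $f_{i1},f_{i2}\in\Phi(X)$ with $f_{i2}\ne\infty$ n.e. in $X$ and $f_i=f_{i1}-f_{i2}$ (defined exactly where the right side is). $\mathbf g=(g_i)_{i\in I}$ with $g_i:A_i\to(0,\infty)$ continuous; $\mathbf a=(a_i)_{i\in I}$ with $a_i>0$. $\langle\mathbf f,\mu\rangle:=\sum_{i\in I}\langle f_i,\mu^i\rangle$ (finite iff the series converges absolutely). $\mathbf W_\mu=(W^i_\mu)_{i\in I}:=\kappa_\mu+\mathbf f$ (for $\mu\in\mathcal E(\mathbf A)$ it is defined and $\ne-\infty$ n.e. in $X$) and $G_{\mathbf f}(\mu):=\kappa(\mu,\mu)+2\langle\mathbf f,\mu\rangle$. $\mathcal E_{\mathbf f}(\mathbf A,\mathbf a,\mathbf g)$ is the set of $\mu\in\mathcal E(\mathbf A)$ with $\langle g_i,\mu^i\rangle=a_i$ for all $i\in I$ and $\langle\mathbf f,\mu\rangle$ finite. $G_{\mathbf f}(\mathbf A,\mathbf a,\mathbf g):=\inf_{\mu\in\mathcal E_{\mathbf f}(\mathbf A,\mathbf a,\mathbf g)}G_{\mathbf f}(\mu)$ ($\inf\varnothing=+\infty$). $\mathcal G_{\mathbf f}(\mathbf A,\mathbf a,\mathbf g)$ is the set of $\lambda\in\mathcal E_{\mathbf f}(\mathbf A,\mathbf a,\mathbf g)$ with $G_{\mathbf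 f}(\lambda)=G_{\mathbf f}(\mathbf A,\mathbf a,\mathbf g)$ (equilibrium measures). *)

theory Defs
  imports "HOL-Analysis.Analysis"
begin

section \<open>Partially defined extended real quantities\<close>

text \<open>
  Many quantities below are defined only "whenever the expression makes sense".  They are modelled
  by the type \<^typ>\<open>ereal option\<close>, where \<^const>\<open>None\<close> means "undefined"; so an
  equation of the form \<open>t = Some v\<close> includes the claim that \<open>t\<close> is well defined.
  (The total addition of \<^typ>\<open>ereal\<close> would silently give \<open>\<infinity> - \<infinity> = \<infinity>\<close>.)
\<close>

definition ext_add :: "ereal \<Rightarrow> ereal \<Rightarrow> ereal option" where
  "ext_add u v =
     (if (u = \<infinity> \<and> v = - \<infinity>) \<or> (u = - \<infinity> \<and> v = \<infinity>) then None else Some (u + v))"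

definition opt_add :: "ereal option \<Rightarrow> ereal option \<Rightarrow> ereal option" where
  "opt_add p q = Option.bind p (\<lambda>u. Option.bind q (\<lambda>v. ext_add u v))"

text \<open>
  The integral of a partial function \<open>u\<close>: it must be defined almost everywhere and measurable, and the
  integrals of its positive and negative parts must not both be infinite.  The value is finite iff
  both parts have finite integral.  For \<open>M = count_space I\<close> this is the sum of a series: all terms
  must be defined, and the sum is finite iff the series converges absolutely.
\<close>

definition pintegral :: "'b measure \<Rightarrow> ('b \<Rightarrow> ereal option) \<Rightarrow> ereal option" where
  "pintegral M u =
     (let w = (\<lambda>x. case u x of Some v \<Rightarrow> v | None \<Rightarrow> 0) in
      if (AE x in M. u x \<noteq> None) \<and> w \<in> borel_measurable M
      then ext_add (enn2ereal (\<integral>\<^sup>+x. e2ennreal (w x) \<partial>M)) (- enn2ereal (\<integral>\<^sup>+x. e2ennreal (- w x) \<partial>M))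
      else None)"

abbreviation psum :: "'i set \<Rightarrow> ('i \<Rightarrow> ereal option) \<Rightarrow> ereal option" where
  "psum J t \<equiv> pintegral (count_space J) t"

definition is_finite :: "ereal option \<Rightarrow> bool" where
  "is_finite p \<longleftrightarrow> (\<exists>r::real. p = Some (ereal r))"


section \<open>Lower semicontinuous functions and Radon measures\<close>

definition lsc :: "('b::topological_space \<Rightarrow> ereal) \<Rightarrow> bool" where
  "lsc \<psi> \<longleftrightarrow> (\<forall>c. open {y. c < \<psi> y})"

definition Phi :: "('b::topological_space \<Rightarrow> ereal) set" where
  "Phi = {\<psi>. lsc \<psi> \<and> (\<forall>y. \<psi> y \<noteq> - \<infinity>) \<and> (compact (UNIV :: 'b set) \<or> (\<forall>y. 0 \<le> \<psi> y))}"

definition Cc :: "('b::topological_space \<Rightarrow> real) set" where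
  "Cc = {\<phi>. continuous_on UNIV \<phi> \<and> compact (closure {y. \<phi> y \<noteq> 0})}"

text \<open>
  Nonnegative Radon measures, as Borel measures.  With these regularity conditions they
  correspond bijectively to the positive linear functionals on \<^const>\<open>Cc\<close> (if the space is locally
  compact Hausdorff).
\<close>

definition radon :: "'b::topological_space measure \<Rightarrow> bool" where
  "radon \<nu> \<longleftrightarrow> sets \<nu> = sets borel
     \<and> (\<forall>K. compact K \<longrightarrow> emeasure \<nu> K < \<infinity>)
     \<and> (\<forall>B\<in>sets borel. emeasure \<nu> B = (INF U\<in>{U. open U \<and> B \<subseteq> U}. emeasure \<nu> U))
     \<and> (\<forall>U. open U \<longrightarrow> emeasure \<nu> U = (SUP K\<in>{K. compact K \<and> K \<subseteq> U}. emeasure \<nu> K))"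

definition msupport :: "'b::topological_space measure \<Rightarrow> 'b set" where
  "msupport \<nu> = - \<Union>{U. open U \<and> emeasure \<nu> U = 0}"

definition Mplus :: "'b::topological_space set \<Rightarrow> 'b measure set" where
  "Mplus E = {\<nu>. radon \<nu> \<and> msupport \<nu> \<subseteq> E}"

text \<open>
  A signed Radon measure need not be a set function on all Borel sets, since both parts of its Jordan
  decomposition may be infinite.  It is represented by that decomposition \<open>(\<nu>\<^sup>+, \<nu>\<^sup>-)\<close>, a pair
  of nonnegative Radon measures that are mutually singular on each compact set.
\<close>

definition signed_radon :: "('b::topological_space measure \<times> 'b measure) set" where
  "signed_radon = {(\<nu>p, \<nu>n). radon \<nu>p \<and> radon \<nu>n \<and>
     (\<forall>K. compact K \<longrightarrow> (\<exists>B\<in>sets borel. B \<subseteq> K \<and> emeasure \<nu>p B = 0 \<and> emeasure \<nu>n (K - B) = 0))}"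


section \<open>Kernels, energy and capacity\<close>

text \<open>
  \<open>\<integral> \<kappa> d(\<nu> \<otimes> \<nu>\<^sub>1)\<close> for nonnegative \<open>\<nu>, \<nu>\<^sub>1\<close>.  The product of two Radon measures is the Radon measure
  on \<open>X \<times> X\<close> whose functional on \<^const>\<open>Cc\<close> is the iterated integral, and the integral of
  \<open>\<kappa> \<in> \<Phi>(X \<times> X)\<close> with respect to a Radon measure is the supremum of the integrals of its minorants in
  \<^const>\<open>Cc\<close>.  The product \<sigma>-algebra of \<^const>\<open>pair_measure\<close> is too small here: if \<open>X\<close> has no
  countable base, a lower semicontinuous function on \<open>X \<times> X\<close> need not be measurable for it.
\<close>

definition energy :: "('a::topological_space \<times> 'a \<Rightarrow> ereal) \<Rightarrow> 'a measure \<Rightarrow> 'a measure \<Rightarrow> ereal" where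
  "energy \<kappa> \<nu> \<nu>1 = (SUP \<phi>\<in>{\<phi>\<in>Cc. \<forall>z. ereal (\<phi> z) \<le> \<kappa> z}. ereal (\<integral>x. (\<integral>y. \<phi> (x, y) \<partial>\<nu>1) \<partial>\<nu>))"

text \<open>For signed measures the positive part of \<open>\<nu> \<otimes> \<nu>\<^sub>1\<close> is
  \<open>\<nu>\<^sup>+ \<otimes> \<nu>\<^sub>1\<^sup>+ + \<nu>\<^sup>- \<otimes> \<nu>\<^sub>1\<^sup>-\<close>, and the negative part is \<open>\<nu>\<^sup>+ \<otimes> \<nu>\<^sub>1\<^sup>- + \<nu>\<^sup>- \<otimes> \<nu>\<^sub>1\<^sup>+\<close>.\<close>

fun signed_energy :: "('a::topological_space \<times> 'a \<Rightarrow> ereal) \<Rightarrow> 'a measure \<times> 'a measure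
    \<Rightarrow> 'a measure \<times> 'a measure \<Rightarrow> ereal option" where
  "signed_energy \<kappa> (\<nu>p, \<nu>n) (\<omega>p, \<omega>n) =
     ext_add (energy \<kappa> \<nu>p \<omega>p + energy \<kappa> \<nu>n \<omega>n) (- (energy \<kappa> \<nu>p \<omega>n + energy \<kappa> \<nu>n \<omega>p))"

definition potential :: "('a::topological_space \<times> 'a \<Rightarrow> ereal) \<Rightarrow> 'a measure \<Rightarrow> 'a \<Rightarrow> ereal option" where
  "potential \<kappa> \<nu> x = pintegral \<nu> (\<lambda>y. Some (\<kappa> (x, y)))"

definition positive_definite_kernel :: "('a::topological_space \<times> 'a \<Rightarrow> ereal) \<Rightarrow> bool" where
  "positive_definite_kernel \<kappa> \<longleftrightarrow> \<kappa> \<in> Phi \<and> (\<forall>x y. \<kappa> (x, y) = \<kappa> (y, x))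
     \<and> (\<forall>\<nu>\<in>signed_radon. \<forall>e. signed_energy \<kappa> \<nu> \<nu> = Some e \<longrightarrow> 0 \<le> e)"

definition Eplus :: "('a::topological_space \<times> 'a \<Rightarrow> ereal) \<Rightarrow> 'a measure set" where
  "Eplus \<kappa> = {\<nu>\<in>Mplus UNIV. - \<infinity> < energy \<kappa> \<nu> \<nu> \<and> energy \<kappa> \<nu> \<nu> < \<infinity>}"

text \<open>The conventions \<open>inf \<emptyset> = \<infinity>\<close>, \<open>1/\<infinity> = 0\<close> and \<open>1/0 = \<infinity>\<close> are those of \<^typ>\<open>ereal\<close>.\<close>

definition int_capacity :: "('a::topological_space \<times> 'a \<Rightarrow> ereal) \<Rightarrow> 'a set \<Rightarrow> ereal" where
  "int_capacity \<kappa> E =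
     1 / (INF \<nu>\<in>{\<nu>\<in>Eplus \<kappa>. emeasure \<nu> UNIV = 1 \<and> compact (msupport \<nu>) \<and> msupport \<nu> \<subseteq> E}. energy \<kappa> \<nu> \<nu>)"

definition nearly_everywhere ::
    "('a::topological_space \<times> 'a \<Rightarrow> ereal) \<Rightarrow> 'a set \<Rightarrow> ('a \<Rightarrow> bool) \<Rightarrow> bool" where
  "nearly_everywhere \<kappa> E P \<longleftrightarrow> int_capacity \<kappa> {x\<in>E. \<not> P x} = 0"

text \<open>
  The inequality \<open>\<psi>(x) \<ge> q\<close> counts as false where \<open>\<psi>\<close> is undefined.  Outside the intended domain the
  value is infinite: \<open>\<infinity>\<close> if \<open>E\<close> has interior capacity zero, and \<open>-\<infinity>\<close> if \<open>\<psi>\<close> is not bounded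
  from below nearly everywhere in \<open>E\<close>.
\<close>

definition ne_Inf :: "('a::topological_space \<times> 'a \<Rightarrow> ereal) \<Rightarrow> 'a set \<Rightarrow> ('a \<Rightarrow> ereal option) \<Rightarrow> ereal" where
  "ne_Inf \<kappa> E \<psi> =
     Sup {ereal q | q::real. nearly_everywhere \<kappa> E (\<lambda>x. \<exists>v. \<psi> x = Some v \<and> ereal q \<le> v)}"


section \<open>Condensers and vector measures\<close>

definition condenser :: "nat set \<Rightarrow> nat set \<Rightarrow> (nat \<Rightarrow> 'a::topological_space set) \<Rightarrow> bool" where
  "condenser Ipos Ineg A \<longleftrightarrow> Ipos \<inter> Ineg = {}
     \<and> (\<forall>i\<in>Ipos \<union> Ineg. closed (A i) \<and> A i \<noteq> {})
     \<and> (\<forall>K. compact K \<longrightarrow> finite {i\<in>Ipos \<union> Ineg. A i \<inter> K \<noteq> {}})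
     \<and> (\<forall>i\<in>Ipos. \<forall>j\<in>Ineg. A i \<inter> A j = {})"

definition isign :: "nat set \<Rightarrow> nat \<Rightarrow> real" where
  "isign Ipos i = (if i \<in> Ipos then 1 else - 1)"

definition vmeasures :: "nat set \<Rightarrow> nat set \<Rightarrow> (nat \<Rightarrow> 'a::topological_space set) \<Rightarrow> (nat \<Rightarrow> 'a measure) set" where
  "vmeasures Ipos Ineg A = (\<Pi> i\<in>Ipos \<union> Ineg. Mplus (A i))"

definition venergy :: "('a::topological_space \<times> 'a \<Rightarrow> ereal) \<Rightarrow> nat set \<Rightarrow> nat set
    \<Rightarrow> (nat \<Rightarrow> 'a measure) \<Rightarrow> (nat \<Rightarrow> 'a measure) \<Rightarrow> ereal option" where
  "venergy \<kappa> Ipos Ineg \<mu> \<mu>1 = psum ((Ipos \<union> Ineg) \<times> (Ipos \<union> Ineg))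
     (\<lambda>(i, j). Some (ereal (isign Ipos i * isign Ipos j) * energy \<kappa> (\<mu> i) (\<mu>1 j)))"

definition vpotential :: "('a::topological_space \<times> 'a \<Rightarrow> ereal) \<Rightarrow> nat set \<Rightarrow> nat set
    \<Rightarrow> (nat \<Rightarrow> 'a measure) \<Rightarrow> nat \<Rightarrow> 'a \<Rightarrow> ereal option" where
  "vpotential \<kappa> Ipos Ineg \<mu> i x = psum (Ipos \<union> Ineg)
     (\<lambda>j. map_option (\<lambda>v. ereal (isign Ipos i * isign Ipos j) * v) (potential \<kappa> (\<mu> j) x))"

definition venergy_finite :: "('a::topological_space \<times> 'a \<Rightarrow> ereal) \<Rightarrow> nat set \<Rightarrow> nat set
    \<Rightarrow> (nat \<Rightarrow> 'a set) \<Rightarrow> (nat \<Rightarrow> 'a measure) set" where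
  "venergy_finite \<kappa> Ipos Ineg A = {\<mu>\<in>vmeasures Ipos Ineg A. is_finite (venergy \<kappa> Ipos Ineg \<mu> \<mu>)}"


section \<open>The Gauss variational problem with an external field\<close>

definition external_field :: "('a::topological_space \<times> 'a \<Rightarrow> ereal) \<Rightarrow> nat set
    \<Rightarrow> (nat \<Rightarrow> 'a \<Rightarrow> ereal option) \<Rightarrow> bool" where
  "external_field \<kappa> I f \<longleftrightarrow> (\<forall>i\<in>I. \<exists>f1\<in>Phi. \<exists>f2\<in>Phi.
     nearly_everywhere \<kappa> UNIV (\<lambda>x. f2 x \<noteq> \<infinity>) \<and> (\<forall>x. f i x = ext_add (f1 x) (- f2 x)))"

definition field_pairing :: "nat set \<Rightarrow> (nat \<Rightarrow> 'a \<Rightarrow> ereal option) \<Rightarrow> (nat \<Rightarrow> 'a measure) \<Rightarrow> ereal option" where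
  "field_pairing I f \<mu> = psum I (\<lambda>i. pintegral (\<mu> i) (f i))"

definition W :: "('a::topological_space \<times> 'a \<Rightarrow> ereal) \<Rightarrow> nat set \<Rightarrow> nat set
    \<Rightarrow> (nat \<Rightarrow> 'a \<Rightarrow> ereal option) \<Rightarrow> (nat \<Rightarrow> 'a measure) \<Rightarrow> nat \<Rightarrow> 'a \<Rightarrow> ereal option" where
  "W \<kappa> Ipos Ineg f \<mu> i x = opt_add (vpotential \<kappa> Ipos Ineg \<mu> i x) (f i x)"

definition G :: "('a::topological_space \<times> 'a \<Rightarrow> ereal) \<Rightarrow> nat set \<Rightarrow> nat set
    \<Rightarrow> (nat \<Rightarrow> 'a \<Rightarrow> ereal option) \<Rightarrow> (nat \<Rightarrow> 'a measure) \<Rightarrow> ereal option" where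
  "G \<kappa> Ipos Ineg f \<mu> =
     opt_add (venergy \<kappa> Ipos Ineg \<mu> \<mu>) (map_option (\<lambda>v. 2 * v) (field_pairing (Ipos \<union> Ineg) f \<mu>))"

text \<open>\<open>g\<^sub>i\<close> is regarded as undefined off \<open>A\<^sub>i\<close>, a null set for measures in \<open>\<MM>\<^sup>+(A\<^sub>i)\<close>.\<close>

definition admissible :: "('a::topological_space \<times> 'a \<Rightarrow> ereal) \<Rightarrow> nat set \<Rightarrow> nat set
    \<Rightarrow> (nat \<Rightarrow> 'a \<Rightarrow> ereal option) \<Rightarrow> (nat \<Rightarrow> 'a set) \<Rightarrow> (nat \<Rightarrow> real) \<Rightarrow> (nat \<Rightarrow> 'a \<Rightarrow> real)
    \<Rightarrow> (nat \<Rightarrow> 'a measure) set" where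
  "admissible \<kappa> Ipos Ineg f A a g = {\<mu>\<in>venergy_finite \<kappa> Ipos Ineg A.
     (\<forall>i\<in>Ipos \<union> Ineg. pintegral (\<mu> i) (\<lambda>x. if x \<in> A i then Some (ereal (g i x)) else None) = Some (ereal (a i)))
     \<and> is_finite (field_pairing (Ipos \<union> Ineg) f \<mu>)}"

definition G_inf :: "('a::topological_space \<times> 'a \<Rightarrow> ereal) \<Rightarrow> nat set \<Rightarrow> nat set
    \<Rightarrow> (nat \<Rightarrow> 'a \<Rightarrow> ereal option) \<Rightarrow> (nat \<Rightarrow> 'a set) \<Rightarrow> (nat \<Rightarrow> real) \<Rightarrow> (nat \<Rightarrow> 'a \<Rightarrow> real) \<Rightarrow> ereal" where
  "G_inf \<kappa> Ipos Ineg f A a g = Inf {v. \<exists>\<mu>\<in>admissible \<kappa> Ipos Ineg f A a g. G \<kappa> Ipos Ineg f \<mu> = Some v}"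

definition equilibrium_measures :: "('a::topological_space \<times> 'a \<Rightarrow> ereal) \<Rightarrow> nat set \<Rightarrow> nat set
    \<Rightarrow> (nat \<Rightarrow> 'a \<Rightarrow> ereal option) \<Rightarrow> (nat \<Rightarrow> 'a set) \<Rightarrow> (nat \<Rightarrow> real) \<Rightarrow> (nat \<Rightarrow> 'a \<Rightarrow> real)
    \<Rightarrow> (nat \<Rightarrow> 'a measure) set" where
  "equilibrium_measures \<kappa> Ipos Ineg f A a g =
     {\<mu>\<in>admissible \<kappa> Ipos Ineg f A a g. G \<kappa> Ipos Ineg f \<mu> = Some (G_inf \<kappa> Ipos Ineg f A a g)}"

definition weighted_W_inf :: "('a::topological_space \<times> 'a \<Rightarrow> ereal) \<Rightarrow> nat set \<Rightarrow> nat set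
    \<Rightarrow> (nat \<Rightarrow> 'a \<Rightarrow> ereal option) \<Rightarrow> (nat \<Rightarrow> 'a set) \<Rightarrow> (nat \<Rightarrow> real) \<Rightarrow> (nat \<Rightarrow> 'a \<Rightarrow> real)
    \<Rightarrow> (nat \<Rightarrow> 'a measure) \<Rightarrow> nat \<Rightarrow> ereal" where
  "weighted_W_inf \<kappa> Ipos Ineg f A a g \<mu> i =
     ne_Inf \<kappa> (A i) (\<lambda>x. map_option (\<lambda>w. ereal (a i) * w / ereal (g i x)) (W \<kappa> Ipos Ineg f \<mu> i x))"

end

theory Submission
  imports Defs
begin

text \<open>
  Put \<open>\<eta>\<^sub>i = \<langle>W\<^sup>i, \<lambda>\<^sup>i\<rangle>\<close> for the equilibrium measure \<open>\<lambda>\<close>. If the single component \<open>\<lambda>\<^sup>i\<close> is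
  replaced by \<open>(1 - t) \<lambda>\<^sup>i + t \<sigma>\<close>, where \<open>\<sigma>\<close> is a finite measure on \<open>A\<^sub>i\<close> with finite energy, with
  finite \<open>\<langle>f\<^sub>i, \<sigma>\<rangle>\<close> and with \<open>\<langle>g\<^sub>i, \<sigma>\<rangle> = a\<^sub>i\<close>, the result is admissible again. Since the energy is a
  quadratic form, the change alters the Gauss functional by \<open>2 t (\<langle>W\<^sup>i, \<sigma>\<rangle> - \<eta>\<^sub>i) + O(t\<^sup>2)\<close>, and
  minimality gives \<open>\<langle>W\<^sup>i, \<sigma>\<rangle> \<ge> \<eta>\<^sub>i\<close> (\<open>variation\<close>). Both bounds on the essential infimum follow.

  \<^item> If \<open>a\<^sub>i W\<^sup>i / g\<^sub>i < \<eta>\<^sub>i\<close> on a set of nonzero capacity, then that set carries a measure of finite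
    energy; restricted to a part where the field is bounded, and rescaled to satisfy the constraint,
    it becomes a \<open>\<sigma>\<close> with \<open>\<langle>W\<^sup>i, \<sigma>\<rangle> < \<eta>\<^sub>i\<close>, which is impossible (\<open>ne_lower_bound\<close>).

  \<^item> The measure \<open>\<lambda>\<^sup>i\<close> has finite energy and so does not charge sets of capacity zero
    (\<open>capacity_zero_null\<close>). Hence a lower bound \<open>a\<^sub>i W\<^sup>i / g\<^sub>i \<ge> r\<close> that holds nearly everywhere in
    \<open>A\<^sub>i\<close> may be integrated against \<open>g\<^sub>i \<lambda>\<^sup>i / a\<^sub>i\<close>, which gives \<open>r \<le> \<eta>\<^sub>i\<close> (\<open>ne_upper_bound\<close>).

  Summing \<open>\<eta>\<^sub>i = \<Sum>\<^sub>j \<alpha>\<^sub>i \<alpha>\<^sub>j \<kappa>(\<lambda>\<^sup>i, \<lambda>\<^sup>j) + \<langle>f\<^sub>i, \<lambda>\<^sup>i\<rangle>\<close> over \<open>i\<close> gives the formula for the minimum.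

  Most of the work lies in the meaning of these expressions. The space has no countable base in
  general, and the mutual energy is a supremum over continuous minorants on the product space. It is
  identified with the iterated integral of the kernel (\<open>energy_eq\<close>) and shown to be symmetric
  (\<open>J_sym\<close>); the key is that integrals against a Radon measure commute with arbitrary directed
  suprema of lower semicontinuous functions (\<open>nn_integral_SUP_directed_lsc\<close>). That \<open>W\<^sup>i\<close> is defined
  nearly everywhere, and that \<open>\<langle>W\<^sup>i, \<sigma>\<rangle>\<close> is the sum of its terms, rests on the inequality
  \<open>2 \<kappa>(\<nu>, \<rho>) \<le> \<kappa>(\<nu>, \<nu>) + \<kappa>(\<rho>, \<rho>)\<close> (\<open>mutual_energy_le\<close>), the form in which positive definiteness
  enters. If the space is compact the kernel may be negative; a constant \<open>c\<close> is then added to it, and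
  otherwise \<open>c = 0\<close>, so that nonnegative kernels can be used throughout.
\<close>

section \<open>Integrals of partially defined functions\<close>

text \<open>
  The default \<open>0\<close> outside the domain is the one of \<^const>\<open>pintegral\<close>: that definition integrates
  the function \<open>\<lambda>x. val (u x)\<close>.
\<close>

definition val :: "ereal option \<Rightarrow> ereal" where
  "val u = (case u of Some v \<Rightarrow> v | None \<Rightarrow> 0)"

lemma val_simps [simp]: "val (Some v) = v" "val None = 0"
  by (simp_all add: val_def)

abbreviation rval :: "ereal option \<Rightarrow> real" where
  "rval u \<equiv> real_of_ereal (val u)"

lemma ext_add_eq_Some_real:
  assumes "u \<ge> 0" "v \<ge> 0" "ext_add u (- v) = Some (ereal r)"
  obtains x y where "u = ereal x" "v = ereal y" "r = x - y" "0 \<le> x" "0 \<le> y"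
  using assms by (cases u; cases v) (auto simp: ext_add_def split: if_splits)

text \<open>
  If the value is finite, both parts of \<open>u\<close> have finite integral, so \<open>u\<close> is finite almost everywhere.
  From here on finite values of \<^const>\<open>pintegral\<close> are handled by the linear theory of integrable
  real functions.
\<close>

lemma pintegral_eq_real_iff:
  "pintegral M u = Some (ereal r) \<longleftrightarrow>
     (\<lambda>x. val (u x)) \<in> borel_measurable M \<and> (AE x in M. u x = Some (ereal (rval (u x))))
     \<and> integrable M (\<lambda>x. rval (u x)) \<and> r = (\<integral>x. rval (u x) \<partial>M)"
    (is "?L \<longleftrightarrow> ?R")
proof
  assume L: ?L
  let ?w = "\<lambda>x. val (u x)"
  let ?P = "\<integral>\<^sup>+x. e2ennreal (?w x) \<partial>M" and ?N = "\<integral>\<^sup>+x. e2ennreal (- ?w x) \<partial>M"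
  have w_eq: "(\<lambda>x. case u x of None \<Rightarrow> 0 | Some v \<Rightarrow> v) = ?w" by (simp add: val_def)
  from L have d: "AE x in M. u x \<noteq> None" and m [measurable]: "?w \<in> borel_measurable M"
    and e: "ext_add (enn2ereal ?P) (- enn2ereal ?N) = Some (ereal r)"
    unfolding pintegral_def Let_def w_eq by (simp_all only: split: if_split_asm) simp_all
  obtain x y where x: "enn2ereal ?P = ereal x" and y: "enn2ereal ?N = ereal y"
    and r: "r = x - y" and xy: "0 \<le> x" "0 \<le> y"
    by (rule ext_add_eq_Some_real[OF _ _ e]) simp_all
  have P: "?P = ennreal x" and N: "?N = ennreal y"
    using arg_cong[OF x, of e2ennreal] arg_cong[OF y, of e2ennreal] by simp_all
  have mP: "(\<lambda>x. e2ennreal (?w x)) \<in> borel_measurable M"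
    and mN: "(\<lambda>x. e2ennreal (- ?w x)) \<in> borel_measurable M"
    by measurable
  have fP: "?P \<noteq> \<infinity>" and fN: "?N \<noteq> \<infinity>"
    by (simp_all add: P N)
  have aeP: "AE x in M. e2ennreal (?w x) \<noteq> \<infinity>"
    by (rule nn_integral_noteq_infinite[OF mP fP])
  have aeN: "AE x in M. e2ennreal (- ?w x) \<noteq> \<infinity>"
    by (rule nn_integral_noteq_infinite[OF mN fN])
  have real: "\<bar>v\<bar> \<noteq> \<infinity>" if "e2ennreal v \<noteq> \<infinity>" "e2ennreal (- v) \<noteq> \<infinity>" for v
    using that by (cases v) (simp_all add: infinity_ennreal_def)
  have fin: "AE x in M. \<bar>?w x\<bar> \<noteq> \<infinity>"
    using aeP aeN by eventually_elim (rule real)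
  have P': "?P = (\<integral>\<^sup>+x. ennreal (rval (u x)) \<partial>M)"
  proof (rule nn_integral_cong_AE, use fin in eventually_elim)
    case (elim x)
    then show ?case by (cases "?w x") simp_all
  qed
  have N': "?N = (\<integral>\<^sup>+x. ennreal (- rval (u x)) \<partial>M)"
  proof (rule nn_integral_cong_AE, use fin in eventually_elim)
    case (elim x)
    then show ?case by (cases "?w x") simp_all
  qed
  have int: "integrable M (\<lambda>x. rval (u x))"
    unfolding real_integrable_def P'[symmetric] N'[symmetric] using fP fN m by simp
  have value_eq: "(\<integral>x. rval (u x) \<partial>M) = x - y"
    unfolding real_lebesgue_integral_def[OF int] using P N P' N' xy by (metis enn2real_ennreal)
  have some: "o' = Some (ereal (rval o'))" if "o' \<noteq> None" "\<bar>val o'\<bar> \<noteq> \<infinity>" for o'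
    using that by (cases o') (simp_all add: ereal_real)
  have ae: "AE x in M. u x = Some (ereal (rval (u x)))"
    using d fin by eventually_elim (rule some)
  show ?R
    unfolding r value_eq by (intro conjI m ae int refl)
next
  assume R: ?R
  let ?w = "\<lambda>x. val (u x)"
  have w_eq: "(\<lambda>x. case u x of None \<Rightarrow> 0 | Some v \<Rightarrow> v) = ?w" by (simp add: val_def)
  have ae: "AE x in M. u x = Some (ereal (rval (u x)))" using R by blast
  have fin: "AE x in M. ?w x = ereal (rval (u x))"
    using ae by eventually_elim (metis val_simps(1))
  have int: "integrable M (\<lambda>x. rval (u x))" using R by simp
  have eP: "e2ennreal v = ennreal y" and eN: "e2ennreal (- v) = ennreal (- y)" if "v = ereal y" for v y
    using that by simp_all
  have P': "(\<integral>\<^sup>+x. e2ennreal (?w x) \<partial>M) = (\<integral>\<^sup>+x. ennreal (rval (u x)) \<partial>M)"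
    using fin by (intro nn_integral_cong_AE, eventually_elim) (rule eP)
  have N': "(\<integral>\<^sup>+x. e2ennreal (- ?w x) \<partial>M) = (\<integral>\<^sup>+x. ennreal (- rval (u x)) \<partial>M)"
    using fin by (intro nn_integral_cong_AE, eventually_elim) (rule eN)
  have f: "(\<integral>\<^sup>+x. ennreal (rval (u x)) \<partial>M) \<noteq> \<infinity>" "(\<integral>\<^sup>+x. ennreal (- rval (u x)) \<partial>M) \<noteq> \<infinity>"
    using int unfolding real_integrable_def by (simp_all only: simp_thms)
  then obtain p n where pn: "0 \<le> p" "(\<integral>\<^sup>+x. ennreal (rval (u x)) \<partial>M) = ennreal p"
      "0 \<le> n" "(\<integral>\<^sup>+x. ennreal (- rval (u x)) \<partial>M) = ennreal n"
    by (metis ennreal_cases infinity_ennreal_def)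
  have r: "r = p - n"
    using R pn real_lebesgue_integral_def[OF int] by (metis enn2real_ennreal)
  have e: "ext_add (enn2ereal (\<integral>\<^sup>+x. e2ennreal (?w x) \<partial>M)) (- enn2ereal (\<integral>\<^sup>+x. e2ennreal (- ?w x) \<partial>M)) = Some (ereal r)"
    unfolding P' N' pn r using pn(1,3) by (simp add: ext_add_def)
  have ne: "AE x in M. u x \<noteq> None" using ae by eventually_elim (metis option.distinct(1))
  have m: "?w \<in> borel_measurable M" using R by blast
  show ?L unfolding pintegral_def Let_def w_eq using ne m e by (simp only: simp_thms if_True)
qed

lemma pintegral_realI:
  assumes "(\<lambda>x. val (u x)) \<in> borel_measurable M" "integrable M h" "AE x in M. u x = Some (ereal (h x))"
  shows "pintegral M u = Some (ereal (\<integral>x. h x \<partial>M))"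
proof -
  have ae: "AE x in M. h x = rval (u x)"
    using assms(3) by eventually_elim simp
  have m: "(\<lambda>x. rval (u x)) \<in> borel_measurable M" using assms(1) by measurable
  have i: "integrable M (\<lambda>x. rval (u x))"
    by (rule integrable_cong_AE_imp[OF assms(2) m]) (use ae in eventually_elim, simp)
  have e: "(\<integral>x. h x \<partial>M) = (\<integral>x. rval (u x) \<partial>M)"
    by (rule integral_cong_AE[OF borel_measurable_integrable[OF assms(2)] m ae])
  have ae': "AE x in M. u x = Some (ereal (rval (u x)))"
    using assms(3) by eventually_elim simp
  show ?thesis unfolding pintegral_eq_real_iff
    using assms(1) ae' i e by blast
qed

text \<open>
  For real series unconditional and absolute convergence coincide.
\<close>

lemma has_sum_real_iff_integral:
  fixes f :: "'b \<Rightarrow> real"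
  shows "(f has_sum s) A \<longleftrightarrow> integrable (count_space A) f \<and> s = (\<integral>x. f x \<partial>count_space A)"
proof -
  have "f summable_on A \<longleftrightarrow> integrable (count_space A) f"
    using summable_on_iff_abs_summable_on_real[of f A] abs_summable_equivalent[of f A]
    unfolding abs_summable_on_def by simp
  moreover have "infsum f A = (\<integral>x. f x \<partial>count_space A)" if "integrable (count_space A) f"
    using infsetsum_infsum[of f A] that by (simp add: abs_summable_on_def infsetsum_def)
  ultimately show ?thesis
    by (metis has_sum_infsum infsumI has_sum_imp_summable)
qed

lemma psum_eq_real_iff:
  "psum J u = Some (ereal r) \<longleftrightarrow> (\<exists>h. (\<forall>j\<in>J. u j = Some (ereal (h j))) \<and> (h has_sum r) J)"
    (is "?L \<longleftrightarrow> ?R")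
proof
  assume ?L
  then have "\<forall>j\<in>J. u j = Some (ereal (rval (u j)))" "((\<lambda>j. rval (u j)) has_sum r) J"
    unfolding pintegral_eq_real_iff has_sum_real_iff_integral AE_count_space by blast+
  then show ?R by (intro exI[of _ "\<lambda>j. rval (u j)"] conjI)
next
  assume ?R
  then obtain h where "\<forall>j\<in>J. u j = Some (ereal (h j))" "(h has_sum r) J" by auto
  then show ?L unfolding has_sum_real_iff_integral
    by (auto intro!: pintegral_realI simp: AE_count_space)
qed

lemma has_sum_superset:
  assumes "(h has_sum s) S" "S \<subseteq> T" "\<And>x. x \<in> T - S \<Longrightarrow> h x = 0"
  shows "(h has_sum s) T"
  using assms has_sum_cong_neutral[of T S h h s] by blast

text \<open>
  Measurability of a partial function includes that of its domain; otherwise sums of partial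
  functions would not be measurable.
\<close>

definition pmeas :: "'b measure \<Rightarrow> ('b \<Rightarrow> ereal option) \<Rightarrow> bool" where
  "pmeas M u \<longleftrightarrow> (\<lambda>x. val (u x)) \<in> borel_measurable M \<and> {x\<in>space M. u x = None} \<in> sets M"

lemma pmeas_cong_sets: "sets M = sets N \<Longrightarrow> pmeas M u \<longleftrightarrow> pmeas N u"
  using sets_eq_imp_space_eq[of M N] by (simp add: pmeas_def cong: measurable_cong_sets)

lemma pmeas_ext_add:
  assumes [measurable]: "u \<in> borel_measurable M" "v \<in> borel_measurable M"
  shows "pmeas M (\<lambda>x. ext_add (u x) (v x))"
proof -
  have "(\<lambda>x. val (ext_add (u x) (v x))) =
      (\<lambda>x. if (u x = \<infinity> \<and> v x = - \<infinity>) \<or> (u x = - \<infinity> \<and> v x = \<infinity>) then 0 else u x + v x)"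
    by (auto simp: ext_add_def)
  moreover have "{x\<in>space M. ext_add (u x) (v x) = None} =
      {x\<in>space M. (u x = \<infinity> \<and> v x = - \<infinity>) \<or> (u x = - \<infinity> \<and> v x = \<infinity>)}"
    by (auto simp: ext_add_def)
  ultimately show ?thesis unfolding pmeas_def by simp
qed

lemma pmeas_opt_add:
  assumes "pmeas M u" "pmeas M v"
  shows "pmeas M (\<lambda>x. opt_add (u x) (v x))"
proof -
  have [measurable]: "(\<lambda>x. val (u x)) \<in> borel_measurable M" "(\<lambda>x. val (v x)) \<in> borel_measurable M"
    "Measurable.pred M (\<lambda>x. u x = None)" "Measurable.pred M (\<lambda>x. v x = None)"
    using assms by (auto simp: pmeas_def pred_def)
  let ?e = "\<lambda>x. ext_add (val (u x)) (val (v x))"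
  have e: "pmeas M ?e" by (rule pmeas_ext_add) auto
  then have [measurable]: "(\<lambda>x. val (?e x)) \<in> borel_measurable M"
    "Measurable.pred M (\<lambda>x. ?e x = None)" by (auto simp: pmeas_def pred_def)
  have 1: "(\<lambda>x. val (opt_add (u x) (v x))) = (\<lambda>x. if u x = None \<or> v x = None then 0 else val (?e x))"
    by (auto simp: opt_add_def fun_eq_iff split: Option.bind_splits)
  have 2: "(opt_add (u x) (v x) = None) = (u x = None \<or> v x = None \<or> ?e x = None)" for x
    by (auto simp: opt_add_def split: Option.bind_splits)
  show ?thesis unfolding pmeas_def 1 2 by simp
qed

section \<open>Regularity of Radon measures\<close>

lemma radon_sets: "radon \<mu> \<Longrightarrow> sets \<mu> = sets borel"
  by (simp add: radon_def)

lemma radon_space: "radon \<mu> \<Longrightarrow> space \<mu> = UNIV"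
  using sets_eq_imp_space_eq[of \<mu> borel] by (simp add: radon_def)

lemma radon_compact_finite: "radon \<mu> \<Longrightarrow> compact K \<Longrightarrow> emeasure \<mu> K < \<infinity>"
  by (simp add: radon_def)

text \<open>
  Outer regularity is trivial on sets of infinite measure, which leaves an approximation argument on
  sets of finite measure.
\<close>

lemma radonI:
  assumes "sets \<mu> = sets borel" "\<And>K. compact K \<Longrightarrow> emeasure \<mu> K < \<infinity>"
    and outer: "\<And>B e. B \<in> sets borel \<Longrightarrow> emeasure \<mu> B < \<infinity> \<Longrightarrow> 0 < (e::real) \<Longrightarrow>
       \<exists>U. open U \<and> B \<subseteq> U \<and> emeasure \<mu> U \<le> emeasure \<mu> B + ennreal e"
    and inner: "\<And>U. open U \<Longrightarrow> emeasure \<mu> U \<le> (SUP K\<in>{K. compact K \<and> K \<subseteq> U}. emeasure \<mu> K)"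
  shows "radon \<mu>"
  unfolding radon_def
proof (intro conjI allI ballI impI)
  fix B :: "'a set" assume B: "B \<in> sets borel"
  show "emeasure \<mu> B = (INF U\<in>{U. open U \<and> B \<subseteq> U}. emeasure \<mu> U)"
  proof (cases "emeasure \<mu> B < \<infinity>")
    case True
    show ?thesis
    proof (rule ennreal_approx_INF)
      show "emeasure \<mu> B \<le> emeasure \<mu> U" if "U \<in> {U. open U \<and> B \<subseteq> U}" for U
        using that assms(1) by (intro emeasure_mono) auto
    qed (use outer[OF B True] in auto)
  next
    case False
    have "emeasure \<mu> B \<le> emeasure \<mu> U" if "U \<in> {U. open U \<and> B \<subseteq> U}" for U
      using that assms(1) by (intro emeasure_mono) auto
    then have "emeasure \<mu> B \<le> (INF U\<in>{U. open U \<and> B \<subseteq> U}. emeasure \<mu> U)"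
      by (rule INF_greatest)
    with False show ?thesis by (simp add: top_unique less_top[symmetric])
  qed
next
  fix U :: "'a set" assume U: "open U"
  show "emeasure \<mu> U = (SUP K\<in>{K. compact K \<and> K \<subseteq> U}. emeasure \<mu> K)"
  proof (rule antisym[OF inner[OF U] SUP_least])
    show "emeasure \<mu> K \<le> emeasure \<mu> U" if "K \<in> {K. compact K \<and> K \<subseteq> U}" for K
      using that U assms(1) by (intro emeasure_mono) auto
  qed
qed (use assms in auto)

lemma radon_outerD:
  assumes "radon \<mu>" "B \<in> sets borel" "emeasure \<mu> B < \<infinity>" "0 < (e::real)"
  obtains U where "open U" "B \<subseteq> U" "emeasure \<mu> U < emeasure \<mu> B + ennreal e"
proof -
  have eq: "emeasure \<mu> B = (INF U\<in>{U. open U \<and> B \<subseteq> U}. emeasure \<mu> U)"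
    using assms unfolding radon_def by blast
  have fin: "emeasure \<mu> B \<noteq> \<infinity>" using assms(3) by (simp add: less_top[symmetric])
  from INF_approx_ennreal[OF assms(4) eq fin]
  obtain U where "U \<in> {U. open U \<and> B \<subseteq> U}" "emeasure \<mu> U < emeasure \<mu> B + ennreal e" ..
  then show ?thesis by (intro that) simp_all
qed

lemma radon_innerD:
  assumes "radon \<mu>" "open U" "emeasure \<mu> U < \<infinity>" "0 < (e::real)"
  obtains K where "compact K" "K \<subseteq> U" "emeasure \<mu> U < emeasure \<mu> K + ennreal e"
proof -
  have eq: "emeasure \<mu> U = (SUP K\<in>{K. compact K \<and> K \<subseteq> U}. emeasure \<mu> K)"
    using assms unfolding radon_def by blast
  have fin: "emeasure \<mu> U \<noteq> \<infinity>" using assms(3) by (simp add: less_top[symmetric])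
  have "{} \<in> {K. compact K \<and> K \<subseteq> U}" by simp
  then have ne: "{K. compact K \<and> K \<subseteq> U} \<noteq> {}" by blast
  from SUP_approx_ennreal[OF assms(4) ne eq fin]
  obtain K where "K \<in> {K. compact K \<and> K \<subseteq> U}" "emeasure \<mu> U < emeasure \<mu> K + ennreal e" ..
  then show ?thesis by (intro that) simp_all
qed

lemma emeasure_Diff_less:
  assumes "A \<in> sets M" "B \<in> sets M" "B \<subseteq> A" "emeasure M B < \<infinity>" "emeasure M A < emeasure M B + e"
  shows "emeasure M (A - B) < e"
proof -
  have "emeasure M A = emeasure M B + emeasure M (A - B)"
    using assms by (simp add: plus_emeasure Un_absorb1)
  then show ?thesis
    using assms(4,5) by (simp add: ennreal_add_left_cancel_less)
qed

text \<open>
  By definition Radon measures are inner regular on open sets only. For a Borel set \<open>S\<close> of finite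
  measure choose an open \<open>O' \<supseteq> S\<close> of finite measure, a compact \<open>K \<subseteq> O'\<close> that nearly exhausts \<open>O'\<close>, and
  an open \<open>V\<close> that covers \<open>O' - S\<close> with little excess. Then \<open>K - V\<close> is compact and nearly exhausts \<open>S\<close>.
\<close>

lemma radon_compact_inner_approx:
  fixes \<mu> :: "'a::t2_space measure"
  assumes \<mu>: "radon \<mu>" and S: "S \<in> sets borel" "emeasure \<mu> S < \<infinity>" and e: "0 < (e::real)"
  obtains C where "compact C" "C \<subseteq> S" "emeasure \<mu> (S - C) < ennreal e"
proof -
  have [simp]: "sets \<mu> = sets borel" using \<mu> by (rule radon_sets)
  have e2: "0 < e/2" using e by simp
  obtain O' where O': "open O'" "S \<subseteq> O'" "emeasure \<mu> O' < emeasure \<mu> S + ennreal 1"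
    by (rule radon_outerD[OF \<mu> S zero_less_one])
  have fin: "emeasure \<mu> O' < \<infinity>"
    using S(2) by (intro less_trans[OF O'(3)]) (simp add: less_top[symmetric])
  obtain K where K: "compact K" "K \<subseteq> O'" "emeasure \<mu> O' < emeasure \<mu> K + ennreal (e/2)"
    by (rule radon_innerD[OF \<mu> O'(1) fin e2])
  have B: "O' - S \<in> sets borel" using O'(1) S(1) by auto
  have finB: "emeasure \<mu> (O' - S) < \<infinity>"
    using fin by (rule le_less_trans[rotated]) (intro emeasure_mono; use O'(1) in auto)
  obtain V where V: "open V" "O' - S \<subseteq> V" "emeasure \<mu> V < emeasure \<mu> (O' - S) + ennreal (e/2)"
    by (rule radon_outerD[OF \<mu> B finB e2])
  have K': "closed K" using K(1) by (rule compact_imp_closed)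
  have 1: "emeasure \<mu> (O' - K) < ennreal (e/2)"
    using K K' O'(1) radon_compact_finite[OF \<mu> K(1)]
    by (intro emeasure_Diff_less) auto
  have 2: "emeasure \<mu> (V - (O' - S)) < ennreal (e/2)"
    by (rule emeasure_Diff_less[OF _ _ V(2) finB V(3)]) (simp_all add: V(1) B)
  have "emeasure \<mu> (S - (K - V)) \<le> emeasure \<mu> ((O' - K) \<union> (V - (O' - S)))"
    using O' K' V S by (intro emeasure_mono) auto
  also have "\<dots> \<le> emeasure \<mu> (O' - K) + emeasure \<mu> (V - (O' - S))"
    using O' K' V B by (intro emeasure_subadditive) auto
  also have "\<dots> < ennreal (e/2) + ennreal (e/2)"
    using 1 2 by (intro add_strict_mono) auto
  also have "\<dots> = ennreal e" using e by (simp flip: ennreal_plus)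
  finally have "emeasure \<mu> (S - (K - V)) < ennreal e" .
  moreover have "compact (K - V)" using K(1) V(1) by (rule compact_diff)
  moreover have "K - V \<subseteq> S" using K(2) V(2) by auto
  ultimately show ?thesis using that by blast
qed

text \<open>
  Inner regularity passes from \<open>\<mu>\<close> on \<open>S\<close> to \<open>\<sigma>\<close>, and outer regularity of \<open>\<sigma>\<close> follows by taking
  complements, because \<open>\<sigma>\<close> is finite. With a general set \<open>S\<close> the lemma yields restrictions of infinite
  measures, and with \<open>S = UNIV\<close> it yields the parts of a finite measure.
\<close>

lemma radon_dominated:
  fixes \<mu> \<sigma> :: "'a::t2_space measure" and c :: real
  assumes \<mu>: "radon \<mu>" and S: "S \<in> sets borel" "emeasure \<mu> S < \<infinity>" and \<sigma>: "sets \<sigma> = sets borel"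
    and c: "0 < c" and le: "\<And>B. B \<in> sets borel \<Longrightarrow> emeasure \<sigma> B \<le> ennreal c * emeasure \<mu> (B \<inter> S)"
  shows "radon \<sigma>"
proof -
  have [simp]: "sets \<mu> = sets borel" "sets \<sigma> = sets borel" using \<mu> \<sigma> by (auto simp: radon_sets)
  have fin: "emeasure \<sigma> B < \<infinity>" if B: "B \<in> sets borel" for B
  proof -
    have "emeasure \<mu> (B \<inter> S) \<le> emeasure \<mu> S" using S by (intro emeasure_mono) auto
    then have "ennreal c * emeasure \<mu> (B \<inter> S) < \<infinity>"
      using S(2) by (auto simp: ennreal_mult_less_top)
    with le[OF B] show ?thesis by (rule le_less_trans)
  qed
  have core: "\<exists>C. compact C \<and> C \<subseteq> T \<inter> S \<and> emeasure \<sigma> (T - C) \<le> ennreal e"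
    if T: "T \<in> sets borel" and e: "0 < (e::real)" for T e
  proof -
    have "emeasure \<mu> (T \<inter> S) \<le> emeasure \<mu> S" using S by (intro emeasure_mono) auto
    then have fTS: "emeasure \<mu> (T \<inter> S) < \<infinity>" using S(2) by (rule le_less_trans)
    have mTS: "T \<inter> S \<in> sets borel" using S(1) T by simp
    have ec: "0 < e / c" using c e by simp
    obtain C where C: "compact C" "C \<subseteq> T \<inter> S" "emeasure \<mu> (T \<inter> S - C) < ennreal (e/c)"
      by (rule radon_compact_inner_approx[OF \<mu> mTS fTS ec])
    have "closed C" using C(1) by (rule compact_imp_closed)
    then have "emeasure \<sigma> (T - C) \<le> ennreal c * emeasure \<mu> ((T - C) \<inter> S)"
      using T by (intro le) auto
    also have "\<dots> \<le> ennreal c * ennreal (e/c)"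
      using C(3) by (intro mult_left_mono) (auto simp: Int_Diff Diff_Int_distrib2 Int_commute Int_left_commute)
    also have "\<dots> = ennreal e" using c e by (simp flip: ennreal_mult)
    finally show ?thesis using C by blast
  qed
  show ?thesis
  proof (rule radonI[OF \<sigma>])
    show "emeasure \<sigma> K < \<infinity>" if "compact K" for K
      using that by (intro fin) (auto dest: compact_imp_closed)
  next
    fix B :: "'a set" and e :: real assume B: "B \<in> sets borel" "0 < e"
    obtain C where C: "compact C" "C \<subseteq> - B" "emeasure \<sigma> (- B - C) \<le> ennreal e"
      using core[of "- B" e] B borel_comp[OF B(1)] by blast
    have cl: "closed C" using C(1) by (rule compact_imp_closed)
    have "- C = B \<union> (- B - C)" using C(2) by auto
    then have "emeasure \<sigma> (- C) \<le> emeasure \<sigma> B + emeasure \<sigma> (- B - C)"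
      using B cl by (metis emeasure_subadditive \<sigma> borel_comp borel_closed sets.Diff)
    also have "\<dots> \<le> emeasure \<sigma> B + ennreal e" using C(3) by (intro add_left_mono)
    finally show "\<exists>U. open U \<and> B \<subseteq> U \<and> emeasure \<sigma> U \<le> emeasure \<sigma> B + ennreal e"
      using cl C(2) by (intro exI[of _ "- C"]) (simp add: open_Compl subset_Compl_self_eq compl_le_swap1)
  next
    fix U :: "'a set" assume U: "open U"
    show "emeasure \<sigma> U \<le> (SUP K\<in>{K. compact K \<and> K \<subseteq> U}. emeasure \<sigma> K)"
    proof (rule ennreal_le_epsilon)
      fix e :: real assume e: "0 < e"
      obtain C where C: "compact C" "C \<subseteq> U" "emeasure \<sigma> (U - C) \<le> ennreal e"
        using core[of U e] U e by auto
      have cl: "closed C" using C(1) by (rule compact_imp_closed)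
      have "U = C \<union> (U - C)" using C(2) by auto
      then have "emeasure \<sigma> U \<le> emeasure \<sigma> C + emeasure \<sigma> (U - C)"
        using U cl by (metis emeasure_subadditive \<sigma> borel_open borel_closed sets.Diff)
      also have "\<dots> \<le> (SUP K\<in>{K. compact K \<and> K \<subseteq> U}. emeasure \<sigma> K) + ennreal e"
        using C by (intro add_mono SUP_upper) auto
      finally show "emeasure \<sigma> U \<le> (SUP K\<in>{K. compact K \<and> K \<subseteq> U}. emeasure \<sigma> K) + ennreal e" .
    qed
  qed
qed

text \<open>
  The complement of the support is a union of null open sets, possibly uncountably many. Each of its
  compact subsets is covered by finitely many of them, and inner regularity does the rest.
\<close>

lemma radon_null_Compl_msupport:
  assumes \<nu>: "radon \<nu>"
  shows "emeasure \<nu> (- msupport \<nu>) = 0"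
proof -
  let ?N = "{U. open U \<and> emeasure \<nu> U = 0}"
  have U: "- msupport \<nu> = \<Union>?N" by (simp add: msupport_def)
  have o: "open (- msupport \<nu>)" unfolding U by auto
  have "emeasure \<nu> K = 0" if K: "compact K" "K \<subseteq> - msupport \<nu>" for K
  proof -
    obtain C where C: "C \<subseteq> ?N" "finite C" "K \<subseteq> \<Union>C"
      using compactE[OF K(1), of ?N] K(2) U by (metis (no_types, lifting) mem_Collect_eq)
    have "emeasure \<nu> K \<le> emeasure \<nu> (\<Union>C)"
      using C radon_sets[OF \<nu>] by (intro emeasure_mono) (auto intro!: sets.finite_Union)
    also have "\<dots> = 0"
    proof (rule null_setsD1, rule null_sets.finite_Union[OF C(2)])
      show "C \<subseteq> null_sets \<nu>"
        using C(1) radon_sets[OF \<nu>] by (auto simp: null_sets_def)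
    qed
    finally show ?thesis by simp
  qed
  then have "(SUP K\<in>{K. compact K \<and> K \<subseteq> - msupport \<nu>}. emeasure \<nu> K) = 0"
    by (auto intro!: antisym SUP_least)
  then show ?thesis using \<nu> o unfolding radon_def by metis
qed

lemma msupport_closed: "closed (msupport \<nu>)"
  unfolding msupport_def by (intro closed_Compl open_Union) auto

lemma msupport_subset_iff:
  assumes "radon \<nu>" "closed A"
  shows "msupport \<nu> \<subseteq> A \<longleftrightarrow> emeasure \<nu> (- A) = 0"
proof
  assume "msupport \<nu> \<subseteq> A"
  then have "emeasure \<nu> (- A) \<le> emeasure \<nu> (- msupport \<nu>)"
    using msupport_closed[of \<nu>] radon_sets[OF assms(1)] by (intro emeasure_mono) auto
  then show "emeasure \<nu> (- A) = 0" using radon_null_Compl_msupport[OF assms(1)] by simp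
next
  assume "emeasure \<nu> (- A) = 0"
  then show "msupport \<nu> \<subseteq> A" using assms(2) unfolding msupport_def by auto
qed

section \<open>Nonnegative combinations of Radon measures\<close>

text \<open>
  The measure \<open>s \<mu> + \<nu>\<close>. This single operation provides sums (\<open>s = 1\<close>) and multiples (\<open>\<nu> = 0\<close>).
\<close>

definition comb_measure :: "real \<Rightarrow> 'b measure \<Rightarrow> 'b measure \<Rightarrow> 'b measure" where
  "comb_measure s \<mu> \<nu> =
     measure_of (space \<mu>) (sets \<mu>) (\<lambda>B. ennreal s * emeasure \<mu> B + emeasure \<nu> B)"

lemma sets_comb_measure [simp, measurable_cong]: "sets (comb_measure s \<mu> \<nu>) = sets \<mu>"
  by (simp add: comb_measure_def)

lemma space_comb_measure [simp]: "space (comb_measure s \<mu> \<nu>) = space \<mu>"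
  by (simp add: comb_measure_def)

lemma emeasure_comb_measure:
  assumes "sets \<nu> = sets \<mu>" "B \<in> sets \<mu>"
  shows "emeasure (comb_measure s \<mu> \<nu>) B = ennreal s * emeasure \<mu> B + emeasure \<nu> B"
  unfolding comb_measure_def
proof (rule emeasure_measure_of_sigma)
  show "sigma_algebra (space \<mu>) (sets \<mu>)" ..
  show "positive (sets \<mu>) (\<lambda>B. ennreal s * emeasure \<mu> B + emeasure \<nu> B)"
    by (simp add: positive_def)
  show "countably_additive (sets \<mu>) (\<lambda>B. ennreal s * emeasure \<mu> B + emeasure \<nu> B)"
  proof (rule countably_additiveI)
    fix A :: "nat \<Rightarrow> _" assume A: "range A \<subseteq> sets \<mu>" "disjoint_family A"
    have "(\<Sum>i. ennreal s * emeasure \<mu> (A i) + emeasure \<nu> (A i)) =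
        ennreal s * (\<Sum>i. emeasure \<mu> (A i)) + (\<Sum>i. emeasure \<nu> (A i))"
      by (simp add: suminf_add[symmetric])
    then show "(\<Sum>i. ennreal s * emeasure \<mu> (A i) + emeasure \<nu> (A i)) =
        ennreal s * emeasure \<mu> (\<Union>i. A i) + emeasure \<nu> (\<Union>i. A i)"
      using A assms(1) by (simp add: suminf_emeasure)
  qed
qed fact

lemma nn_integral_comb_measure:
  assumes s: "sets \<nu> = sets \<mu>" and f: "f \<in> borel_measurable \<mu>"
  shows "(\<integral>\<^sup>+x. f x \<partial>comb_measure s \<mu> \<nu>) = ennreal s * (\<integral>\<^sup>+x. f x \<partial>\<mu>) + (\<integral>\<^sup>+x. f x \<partial>\<nu>)"
  using f
proof (induction rule: borel_measurable_induct)
  case (cong f g)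
  have sp: "space \<nu> = space \<mu>" using s by (rule sets_eq_imp_space_eq)
  have "integral\<^sup>N M f = integral\<^sup>N M g" if "space M = space \<mu>" for M :: "'a measure"
    using cong(3) that by (intro nn_integral_cong) simp
  with cong(4) show ?case by (simp add: sp)
next
  case (set A)
  then show ?case using s by (simp add: emeasure_comb_measure)
next
  case (mult u c)
  have [measurable]: "u \<in> borel_measurable \<nu>" "u \<in> borel_measurable (comb_measure s \<mu> \<nu>)"
    using mult(2) s by (simp_all cong: measurable_cong_sets)
  show ?case using mult by (simp add: nn_integral_cmult distrib_left mult.left_commute)
next
  case (add u v)
  have [measurable]: "u \<in> borel_measurable \<nu>" "u \<in> borel_measurable (comb_measure s \<mu> \<nu>)"
    "v \<in> borel_measurable \<nu>" "v \<in> borel_measurable (comb_measure s \<mu> \<nu>)"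
    using add(1,3) s by (simp_all cong: measurable_cong_sets)
  show ?case using add by (simp add: nn_integral_add distrib_left ac_simps)
next
  case (seq U)
  have [measurable]: "U i \<in> borel_measurable \<nu>" "U i \<in> borel_measurable (comb_measure s \<mu> \<nu>)" for i
    using seq(1)[of i] s by (simp_all cong: measurable_cong_sets)
  have inc: "incseq (\<lambda>i. \<integral>\<^sup>+x. U i x \<partial>M)" for M :: "'a measure"
    using seq(3) by (auto intro!: incseq_SucI nn_integral_mono simp: incseq_Suc_iff le_fun_def)
  have "(\<integral>\<^sup>+x. (SUP i. U i x) \<partial>comb_measure s \<mu> \<nu>) = (SUP i. \<integral>\<^sup>+x. U i x \<partial>comb_measure s \<mu> \<nu>)"
    using seq by (intro nn_integral_monotone_convergence_SUP) auto
  also have "\<dots> = (SUP i. ennreal s * (\<integral>\<^sup>+x. U i x \<partial>\<mu>) + (\<integral>\<^sup>+x. U i x \<partial>\<nu>))"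
    by (intro SUP_cong refl) (rule seq)
  also have "\<dots> = (SUP i. ennreal s * (\<integral>\<^sup>+x. U i x \<partial>\<mu>)) + (SUP i. \<integral>\<^sup>+x. U i x \<partial>\<nu>)"
    using inc[of \<mu>] inc[of \<nu>]
    by (intro ennreal_SUP_add) (auto simp: incseq_def intro!: mult_left_mono)
  also have "\<dots> = ennreal s * (\<integral>\<^sup>+x. (SUP i. U i x) \<partial>\<mu>) + (\<integral>\<^sup>+x. (SUP i. U i x) \<partial>\<nu>)"
    using seq by (simp add: SUP_mult_left_ennreal[symmetric] nn_integral_monotone_convergence_SUP)
  finally show ?case by (simp add: image_comp SUP_apply)
qed

lemma integral_comb_measure:
  fixes h :: "'b \<Rightarrow> real"
  assumes s: "sets \<nu> = sets \<mu>" "0 \<le> s" and h: "integrable \<mu> h" "integrable \<nu> h"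
  shows "integrable (comb_measure s \<mu> \<nu>) h"
    and "(\<integral>x. h x \<partial>comb_measure s \<mu> \<nu>) = s * (\<integral>x. h x \<partial>\<mu>) + (\<integral>x. h x \<partial>\<nu>)"
proof -
  let ?C = "comb_measure s \<mu> \<nu>"
  have m: "h \<in> borel_measurable \<mu>" "h \<in> borel_measurable ?C"
    using h(1) by (auto simp: measurable_cong_sets[OF sets_comb_measure refl])
  have nn: "(\<integral>\<^sup>+x. ennreal (k x) \<partial>?C) =
      ennreal (s * (\<integral>x. k x \<partial>\<mu>) + (\<integral>x. k x \<partial>\<nu>))"
    if "integrable \<mu> k" "integrable \<nu> k" "\<And>x. 0 \<le> k x" for k
    using that s by (subst nn_integral_comb_measure)
      (auto simp: nn_integral_eq_integral ennreal_mult[symmetric] ennreal_plus[symmetric] simp del: ennreal_plus)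
  have part: "integrable ?C k" "(\<integral>x. k x \<partial>?C) = s * (\<integral>x. k x \<partial>\<mu>) + (\<integral>x. k x \<partial>\<nu>)"
    if k: "integrable \<mu> k" "integrable \<nu> k" "\<And>x. 0 \<le> k x" for k
  proof -
    have mk: "k \<in> borel_measurable ?C"
      using k(1) by (auto simp: measurable_cong_sets[OF sets_comb_measure refl])
    have v: "0 \<le> s * (\<integral>x. k x \<partial>\<mu>) + (\<integral>x. k x \<partial>\<nu>)"
      using k s(2) by (intro add_nonneg_nonneg mult_nonneg_nonneg integral_nonneg_AE) auto
    show "integrable ?C k"
      by (rule integrableI_nn_integral_finite[OF mk _ nn[OF k]]) (use k(3) in auto)
    show "(\<integral>x. k x \<partial>?C) = s * (\<integral>x. k x \<partial>\<mu>) + (\<integral>x. k x \<partial>\<nu>)"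
      using integral_eq_nn_integral[OF mk] nn[OF k] v k(3) by simp
  qed
  have i: "integrable \<mu> (\<lambda>x. max 0 (h x))" "integrable \<nu> (\<lambda>x. max 0 (h x))"
     "integrable \<mu> (\<lambda>x. max 0 (- h x))" "integrable \<nu> (\<lambda>x. max 0 (- h x))"
    using h by (auto intro: integrable_max)
  have eq: "h x = max 0 (h x) - max 0 (- h x)" for x by simp
  have P: "integrable ?C (\<lambda>x. max 0 (h x))" "(\<integral>x. max 0 (h x) \<partial>?C) = s * (\<integral>x. max 0 (h x) \<partial>\<mu>) + (\<integral>x. max 0 (h x) \<partial>\<nu>)"
    by (rule part[OF i(1,2)], simp)+
  have N: "integrable ?C (\<lambda>x. max 0 (- h x))" "(\<integral>x. max 0 (- h x) \<partial>?C) = s * (\<integral>x. max 0 (- h x) \<partial>\<mu>) + (\<integral>x. max 0 (- h x) \<partial>\<nu>)"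
    by (rule part[OF i(3,4)], simp)+
  show "integrable ?C h"
    using Bochner_Integration.integrable_diff[OF P(1) N(1)] by (simp flip: eq)
  have d: "(\<integral>x. h x \<partial>M) = (\<integral>x. max 0 (h x) \<partial>M) - (\<integral>x. max 0 (- h x) \<partial>M)"
    if "integrable M (\<lambda>x. max 0 (h x))" "integrable M (\<lambda>x. max 0 (- h x))" for M :: "'b measure"
    using Bochner_Integration.integral_diff[OF that] by (simp flip: eq)
  show "(\<integral>x. h x \<partial>?C) = s * (\<integral>x. h x \<partial>\<mu>) + (\<integral>x. h x \<partial>\<nu>)"
    unfolding d[OF P(1) N(1)] d[OF i(1) i(3)] d[OF i(2) i(4)] P(2) N(2) by (simp add: algebra_simps)
qed

lemma AE_comb_measure:
  assumes s: "sets \<nu> = sets \<mu>" and ae: "AE x in \<mu>. P x" "AE x in \<nu>. P x"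
  shows "AE x in comb_measure s \<mu> \<nu>. P x"
proof -
  have sp: "space \<nu> = space \<mu>" using s by (rule sets_eq_imp_space_eq)
  obtain M where M: "{x\<in>space \<mu>. \<not> P x} \<subseteq> M" "M \<in> sets \<mu>" "emeasure \<mu> M = 0"
    using ae(1) by (auto elim!: AE_E)
  obtain N where N: "{x\<in>space \<mu>. \<not> P x} \<subseteq> N" "N \<in> sets \<mu>" "emeasure \<nu> N = 0"
    using ae(2) s sp by (auto elim!: AE_E)
  have "emeasure \<mu> (M \<inter> N) = 0" "emeasure \<nu> (M \<inter> N) = 0"
    using M N s emeasure_eq_0[of M \<mu> "M \<inter> N"] emeasure_eq_0[of N \<nu> "M \<inter> N"] by auto
  then have "emeasure (comb_measure s \<mu> \<nu>) (M \<inter> N) = 0"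
    using M N s by (subst emeasure_comb_measure) auto
  then show ?thesis using M N by (intro AE_I[of _ _ "M \<inter> N"]) auto
qed

lemma radon_emeasure_open:
  "radon \<mu> \<Longrightarrow> open U \<Longrightarrow> emeasure \<mu> U = (SUP K\<in>{K. compact K \<and> K \<subseteq> U}. emeasure \<mu> K)"
  unfolding radon_def by blast

text \<open>
  On open sets the suprema over compact subsets for the two measures can be taken jointly, since the
  union of two compact subsets is again one.
\<close>

lemma radon_comb_measure:
  fixes \<mu> \<nu> :: "'a::t2_space measure"
  assumes \<mu>: "radon \<mu>" and \<nu>: "radon \<nu>" and s: "0 < s"
  shows "radon (comb_measure s \<mu> \<nu>)"
proof -
  have sets: "sets \<mu> = sets borel" "sets \<nu> = sets \<mu>" using \<mu> \<nu> by (simp_all add: radon_sets)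
  have em: "emeasure (comb_measure s \<mu> \<nu>) B = ennreal s * emeasure \<mu> B + emeasure \<nu> B"
    if "B \<in> sets borel" for B
    using emeasure_comb_measure[of \<nu> \<mu> B s] sets that by simp
  show ?thesis
  proof (rule radonI)
    fix K :: "'a set" assume K: "compact K"
    then have "K \<in> sets borel" by (auto dest: compact_imp_closed)
    then show "emeasure (comb_measure s \<mu> \<nu>) K < \<infinity>"
      using radon_compact_finite[OF \<mu> K] radon_compact_finite[OF \<nu> K]
      by (simp add: em ennreal_mult_less_top)
  next
    fix B :: "'a set" and e :: real
    assume B: "B \<in> sets borel" and fin: "emeasure (comb_measure s \<mu> \<nu>) B < \<infinity>" and e: "0 < e"
    have f: "emeasure \<mu> B < \<infinity>" "emeasure \<nu> B < \<infinity>"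
      using fin s by (auto simp: em[OF B] ennreal_mult_less_top)
    have e1: "0 < e / (2 * s)" and e2: "0 < e / 2" using e s by auto
    obtain U where U: "open U" "B \<subseteq> U" "emeasure \<mu> U < emeasure \<mu> B + ennreal (e / (2 * s))"
      by (rule radon_outerD[OF \<mu> B f(1) e1])
    obtain V where V: "open V" "B \<subseteq> V" "emeasure \<nu> V < emeasure \<nu> B + ennreal (e / 2)"
      by (rule radon_outerD[OF \<nu> B f(2) e2])
    have "emeasure (comb_measure s \<mu> \<nu>) (U \<inter> V) \<le> ennreal s * emeasure \<mu> U + emeasure \<nu> V"
      using U V sets by (subst em) (auto intro!: add_mono mult_left_mono emeasure_mono)
    also have "\<dots> \<le> ennreal s * (emeasure \<mu> B + ennreal (e / (2 * s))) + (emeasure \<nu> B + ennreal (e / 2))"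
      using U V by (intro add_mono mult_left_mono) auto
    also have "\<dots> = emeasure (comb_measure s \<mu> \<nu>) B + (ennreal s * ennreal (e / (2 * s)) + ennreal (e / 2))"
      by (simp add: em[OF B] distrib_left ac_simps)
    also have "ennreal s * ennreal (e / (2 * s)) + ennreal (e / 2) = ennreal e"
      using s e by (simp add: ennreal_mult[symmetric] ennreal_plus[symmetric] del: ennreal_plus)
    finally show "\<exists>U. open U \<and> B \<subseteq> U \<and> emeasure (comb_measure s \<mu> \<nu>) U \<le> emeasure (comb_measure s \<mu> \<nu>) B + ennreal e"
      using U V by (intro exI[of _ "U \<inter> V"]) auto
  next
    fix U :: "'a set" assume U: "open U"
    let ?K = "{K. compact K \<and> K \<subseteq> U}"
    have mK: "K \<in> sets borel" if "K \<in> ?K" for K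
      using that by (auto dest: compact_imp_closed)
    have "emeasure (comb_measure s \<mu> \<nu>) U = ennreal s * (SUP K\<in>?K. emeasure \<mu> K) + (SUP K\<in>?K. emeasure \<nu> K)"
      unfolding em[OF borel_open[OF U]]
      by (intro arg_cong2[where f = "(+)"] arg_cong2[where f = "(*)"] refl radon_emeasure_open \<mu> \<nu> U)
    also have "\<dots> = (SUP K\<in>?K. ennreal s * emeasure \<mu> K + emeasure \<nu> K)"
      unfolding SUP_mult_left_ennreal
    proof (rule SUP_add_directed_ennreal[symmetric])
      fix K L assume KL: "K \<in> ?K" "L \<in> ?K"
      then have "K \<union> L \<in> ?K" by (auto simp: compact_Un)
      moreover have "ennreal s * emeasure \<mu> K + emeasure \<nu> L \<le>
          ennreal s * emeasure \<mu> (K \<union> L) + emeasure \<nu> (K \<union> L)"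
        using mK[OF KL(1)] mK[OF KL(2)] sets
        by (intro add_mono mult_left_mono emeasure_mono) auto
      ultimately show "\<exists>k\<in>?K. ennreal s * emeasure \<mu> K + emeasure \<nu> L \<le> ennreal s * emeasure \<mu> k + emeasure \<nu> k"
        by blast
    qed
    also have "\<dots> = (SUP K\<in>?K. emeasure (comb_measure s \<mu> \<nu>) K)"
      using em mK by (intro SUP_cong) auto
    finally show "emeasure (comb_measure s \<mu> \<nu>) U \<le> (SUP K\<in>?K. emeasure (comb_measure s \<mu> \<nu>) K)"
      by simp
  qed (use sets in simp)
qed

section \<open>Directed suprema of lower semicontinuous functions\<close>

text \<open>
  Compactness replaces countability: a compact subset of the union of a directed family of open sets
  lies in a single member.
\<close>

lemma radon_emeasure_UN_directed:
  assumes \<mu>: "radon \<mu>" and D: "D \<noteq> {}" and op: "\<And>i. i \<in> D \<Longrightarrow> open (U i)"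
    and dir: "\<And>i j. i \<in> D \<Longrightarrow> j \<in> D \<Longrightarrow> \<exists>k\<in>D. U i \<subseteq> U k \<and> U j \<subseteq> U k"
  shows "emeasure \<mu> (\<Union>i\<in>D. U i) = (SUP i\<in>D. emeasure \<mu> (U i))"
proof (rule antisym)
  have [simp]: "sets \<mu> = sets borel" using \<mu> by (rule radon_sets)
  have o: "open (\<Union>i\<in>D. U i)" using op by auto
  show "emeasure \<mu> (\<Union>i\<in>D. U i) \<le> (SUP i\<in>D. emeasure \<mu> (U i))"
    unfolding radon_emeasure_open[OF \<mu> o]
  proof (rule SUP_least)
    fix K assume "K \<in> {K. compact K \<and> K \<subseteq> (\<Union>i\<in>D. U i)}"
    then have K: "compact K" "K \<subseteq> (\<Union>i\<in>D. U i)" by auto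
    obtain C where C: "C \<subseteq> D" "finite C" "K \<subseteq> (\<Union>i\<in>C. U i)"
      using compactE_image[OF K(1) op K(2)] by metis
    have "\<exists>k\<in>D. (\<Union>i\<in>C. U i) \<subseteq> U k"
      using C(2,1)
    proof (induction C)
      case empty
      then show ?case using D by auto
    next
      case (insert i C)
      then obtain k l where "k \<in> D" "(\<Union>i\<in>C. U i) \<subseteq> U k" "l \<in> D" "U i \<subseteq> U l" "U k \<subseteq> U l"
        using dir[of i] by (metis insert_subset)
      then show ?case by (intro bexI[of _ l]) auto
    qed
    then obtain k where k: "k \<in> D" "K \<subseteq> U k" using C(3) by blast
    then have "emeasure \<mu> K \<le> emeasure \<mu> (U k)" using op by (intro emeasure_mono) auto
    also have "\<dots> \<le> (SUP i\<in>D. emeasure \<mu> (U i))" using k(1) by (rule SUP_upper)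
    finally show "emeasure \<mu> K \<le> (SUP i\<in>D. emeasure \<mu> (U i))" .
  qed
  show "(SUP i\<in>D. emeasure \<mu> (U i)) \<le> emeasure \<mu> (\<Union>i\<in>D. U i)"
    using o by (intro SUP_least emeasure_mono UN_upper) simp_all
qed

lemma SUP_sum_directed_ennreal:
  fixes f :: "'k \<Rightarrow> 'i \<Rightarrow> ennreal"
  assumes "finite F"
    and dir: "\<And>i j. i \<in> D \<Longrightarrow> j \<in> D \<Longrightarrow> \<exists>l\<in>D. \<forall>k. f k i \<le> f k l \<and> f k j \<le> f k l" and D: "D \<noteq> {}"
  shows "(SUP i\<in>D. \<Sum>k\<in>F. f k i) = (\<Sum>k\<in>F. SUP i\<in>D. f k i)"
  using assms(1)
proof induction
  case (insert k F)
  have "(SUP i\<in>D. f k i + (\<Sum>k\<in>F. f k i)) = (SUP i\<in>D. f k i) + (SUP i\<in>D. \<Sum>k\<in>F. f k i)"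
  proof (rule SUP_add_directed_ennreal)
    fix i j assume "i \<in> D" "j \<in> D"
    then obtain l where "l \<in> D" "\<forall>k. f k i \<le> f k l \<and> f k j \<le> f k l" using dir by blast
    then show "\<exists>l\<in>D. f k i + (\<Sum>k\<in>F. f k j) \<le> f k l + (\<Sum>k\<in>F. f k l)"
      by (intro bexI[of _ l] add_mono sum_mono) auto
  qed
  then show ?case using insert by simp
qed (use D in simp)

text \<open>
  Up to the factor \<open>1 / (n + 1)\<close> this counts the levels \<open>k / (n + 1)\<close>, \<open>1 \<le> k \<le> (n + 1)\<^sup>2\<close>, that lie
  strictly below \<open>v\<close>. Composed with a lower semicontinuous function it is a combination of indicators
  of open sets, so that its integral can be computed from the measures of open sets.
\<close>

definition lower_step :: "nat \<Rightarrow> ennreal \<Rightarrow> ennreal" where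
  "lower_step n v = (\<Sum>k\<in>{1..(n+1)\<^sup>2}. ennreal (1 / real (n+1)) * indicator {ennreal (real k / real (n+1))<..} v)"

lemma lower_step_eq_card:
  "lower_step n v = ennreal (real (card {k\<in>{1..(n+1)\<^sup>2}. ennreal (real k / real (n+1)) < v}) / real (n+1))"
proof -
  let ?F = "{k\<in>{1..(n+1)\<^sup>2}. ennreal (real k / real (n+1)) < v}"
  have "lower_step n v = (\<Sum>k\<in>?F. ennreal (1 / real (n+1)))"
    unfolding lower_step_def by (rule sum.mono_neutral_cong_right) (auto simp: indicator_def)
  also have "\<dots> = ennreal (\<Sum>k\<in>?F. 1 / real (n+1))" by (rule sum_ennreal) simp
  finally show ?thesis by (simp add: sum_divide_distrib[symmetric])
qed

lemma lower_step_le: "lower_step n v \<le> v"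
proof (cases v)
  case (real r)
  let ?F = "{k\<in>{1..(n+1)\<^sup>2}. ennreal (real k / real (n+1)) < v}"
  let ?m = "nat \<lfloor>r * real (n+1)\<rfloor>"
  have "?F \<subseteq> {1..?m}"
  proof
    fix k assume "k \<in> ?F"
    then have "1 \<le> k" "real k / real (n+1) < r" using real by (auto simp: ennreal_less_iff)
    then have "real k < r * real (n+1)" by (simp add: divide_less_eq)
    then show "k \<in> {1..?m}" using \<open>1 \<le> k\<close> by (simp add: le_nat_floor)
  qed
  then have "card ?F \<le> ?m" using card_mono[of "{1..?m}" ?F] by simp
  moreover have "0 \<le> r * real (n+1)" using real by simp
  then have "real ?m \<le> r * real (n+1)" by linarith
  ultimately have "real (card ?F) \<le> r * real (n+1)" by (meson of_nat_le_iff order_trans)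
  then have "real (card ?F) / real (n+1) \<le> r" by (simp add: divide_le_eq)
  then show ?thesis unfolding lower_step_eq_card real(2) by (rule ennreal_leI)
qed simp

text \<open>
  The steps are not monotone in \<open>n\<close>; a bound for the limes inferior suffices for Fatou's lemma.
\<close>

lemma le_liminf_lower_step: "v \<le> liminf (\<lambda>n. lower_step n v)"
  unfolding le_Liminf_iff
proof (intro allI impI)
  fix y assume y: "y < v"
  then obtain z where z: "y < z" "z < v" using dense by blast
  obtain y' where y': "0 \<le> y'" "y = ennreal y'" using y by (cases y) auto
  obtain r where r: "0 \<le> r" "z = ennreal r" using z(2) by (cases z) auto
  have yr: "y' < r" using z(1) y' r by (simp add: ennreal_less_iff)
  obtain N1 :: nat where N1: "r < real N1" using reals_Archimedean2 by blast
  obtain N2 :: nat where N2: "1 / (r - y') < real N2" using reals_Archimedean2 by blast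
  show "\<forall>\<^sub>F n in sequentially. y < lower_step n v"
  proof (rule eventually_sequentiallyI)
    fix n assume n: "max N1 N2 \<le> n"
    let ?F = "{k\<in>{1..(n+1)\<^sup>2}. ennreal (real k / real (n+1)) < v}"
    let ?m = "nat \<lfloor>r * real (n+1)\<rfloor>"
    have n0: "0 < real (n+1)" by simp
    have rn: "r \<le> real (n+1)" using N1 n by linarith
    have m1: "real ?m \<le> r * real (n+1)" and m2: "r * real (n+1) < real ?m + 1"
      using r(1) n0 mult_nonneg_nonneg[of r "real (n+1)"] by linarith+
    have "{1..?m} \<subseteq> ?F"
    proof
      fix k assume k: "k \<in> {1..?m}"
      then have kr: "real k \<le> r * real (n+1)" using m1 by (simp add: order_trans[OF _ m1])
      then have "real k / real (n+1) \<le> r" by (simp add: divide_le_eq)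
      then have "ennreal (real k / real (n+1)) < v" using z(2) unfolding r(2) by (meson ennreal_leI le_less_trans)
      moreover have "r * real (n+1) \<le> real (n+1) * real (n+1)" using rn by (intro mult_right_mono) auto
      then have "real k \<le> real ((n+1)\<^sup>2)" using kr by (simp only: power2_eq_square of_nat_mult)
      then have "k \<le> (n+1)\<^sup>2" by (simp only: of_nat_le_iff)
      ultimately show "k \<in> ?F" using k by simp
    qed
    then have "?m \<le> card ?F" using card_mono[of ?F "{1..?m}"] by simp
    then have "r * real (n+1) - 1 < real (card ?F)" using m2 by linarith
    moreover have "1 < (r - y') * real (n+1)"
    proof -
      have "1 / (r - y') < real (n+1)" using N2 n by linarith
      then show ?thesis using yr by (simp add: divide_less_eq mult.commute)
    qed
    ultimately have "y' * real (n+1) < real (card ?F)" by (simp add: algebra_simps)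
    then have "y' < real (card ?F) / real (n+1)" by (simp add: less_divide_eq)
    then show "y < lower_step n v"
      unfolding lower_step_eq_card y'(2) using y'(1) by (simp only: ennreal_less_iff)
  qed
qed

lemma borel_measurable_lsc:
  fixes h :: "'a::topological_space \<Rightarrow> ennreal"
  assumes "\<And>c. open {x. c < h x}"
  shows "h \<in> borel_measurable borel"
  using assms by (intro borel_measurableI_greater) auto

text \<open>
  Monotone convergence for families of arbitrary cardinality. The levels \<open>{x. t < SUP i\<in>D. h i x}\<close> are
  directed unions of open sets, so the claim holds for the integrals of the step functions
  \<open>lower_step n\<close>, which are finite sums; Fatou's lemma passes to the limit.
\<close>

lemma nn_integral_SUP_directed_lsc:
  fixes h :: "'i \<Rightarrow> 'a::topological_space \<Rightarrow> ennreal"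
  assumes \<mu>: "radon \<mu>" and D: "D \<noteq> {}"
    and lsc: "\<And>i c. i \<in> D \<Longrightarrow> open {x. c < h i x}"
    and dir: "\<And>i j. i \<in> D \<Longrightarrow> j \<in> D \<Longrightarrow> \<exists>k\<in>D. \<forall>x. h i x \<le> h k x \<and> h j x \<le> h k x"
  shows "(\<integral>\<^sup>+x. (SUP i\<in>D. h i x) \<partial>\<mu>) = (SUP i\<in>D. \<integral>\<^sup>+x. h i x \<partial>\<mu>)"
proof (rule antisym)
  let ?H = "\<lambda>x. SUP i\<in>D. h i x"
  have [simp, measurable_cong]: "sets \<mu> = sets borel" using \<mu> by (rule radon_sets)
  have lev: "{x. c < ?H x} = (\<Union>i\<in>D. {x. c < h i x})" for c by (auto simp: less_SUP_iff)
  have mH [measurable]: "?H \<in> borel_measurable borel"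
    using lsc by (intro borel_measurable_lsc) (auto simp: lev)
  have mh: "h i \<in> borel_measurable borel" if "i \<in> D" for i
    using lsc[OF that] by (rule borel_measurable_lsc)
  have int_step: "(\<integral>\<^sup>+x. lower_step n (f x) \<partial>\<mu>) =
      (\<Sum>k\<in>{1..(n+1)\<^sup>2}. ennreal (1 / real (n+1)) * emeasure \<mu> {x. ennreal (real k / real (n+1)) < f x})"
    if [measurable]: "f \<in> borel_measurable borel" for f :: "'a \<Rightarrow> ennreal" and n
  proof -
    have 1: "indicator {c<..} (f x) = indicator {x. c < f x} x" for c x
      by (simp add: indicator_def)
    have [measurable]: "{x. c < f x} \<in> sets borel" for c by measurable
    show ?thesis unfolding lower_step_def 1
      by (subst nn_integral_sum) (auto simp: nn_integral_cmult)
  qed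
  have step: "(\<integral>\<^sup>+x. lower_step n (?H x) \<partial>\<mu>) \<le> (SUP i\<in>D. \<integral>\<^sup>+x. h i x \<partial>\<mu>)" for n
  proof -
    let ?f = "\<lambda>k i. ennreal (1 / real (n+1)) * emeasure \<mu> {x. ennreal (real k / real (n+1)) < h i x}"
    have up: "\<exists>l\<in>D. \<forall>c. {x. c < h i x} \<subseteq> {x. c < h l x} \<and> {x. c < h j x} \<subseteq> {x. c < h l x}"
      if ij: "i \<in> D" "j \<in> D" for i j
    proof -
      obtain l where "l \<in> D" "\<forall>x. h i x \<le> h l x \<and> h j x \<le> h l x" using dir[OF ij] by blast
      then show ?thesis by (intro bexI[of _ l]) (auto intro: less_le_trans)
    qed
    have "(\<integral>\<^sup>+x. lower_step n (?H x) \<partial>\<mu>) = (\<Sum>k\<in>{1..(n+1)\<^sup>2}. SUP i\<in>D. ?f k i)"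
      unfolding int_step[OF mH]
    proof (intro sum.cong refl)
      fix k :: nat
      let ?c = "ennreal (real k / real (n+1))"
      have "emeasure \<mu> (\<Union>i\<in>D. {x. ?c < h i x}) = (SUP i\<in>D. emeasure \<mu> {x. ?c < h i x})"
      proof (rule radon_emeasure_UN_directed[OF \<mu> D lsc])
        fix i j assume "i \<in> D" "j \<in> D"
        from up[OF this] obtain l where "l \<in> D" "\<forall>c. {x. c < h i x} \<subseteq> {x. c < h l x} \<and> {x. c < h j x} \<subseteq> {x. c < h l x}" ..
        then show "\<exists>l\<in>D. {x. ?c < h i x} \<subseteq> {x. ?c < h l x} \<and> {x. ?c < h j x} \<subseteq> {x. ?c < h l x}"
          by (intro bexI[of _ l]) (drule spec, assumption+)
      qed
      then show "ennreal (1 / real (n+1)) * emeasure \<mu> {x. ?c < ?H x} = (SUP i\<in>D. ?f k i)"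
        unfolding lev by (simp only: SUP_mult_left_ennreal)
    qed
    also have "\<dots> = (SUP i\<in>D. \<Sum>k\<in>{1..(n+1)\<^sup>2}. ?f k i)"
    proof (rule SUP_sum_directed_ennreal[symmetric])
      fix i j assume "i \<in> D" "j \<in> D"
      then obtain l where l: "l \<in> D" "\<And>c. {x. c < h i x} \<subseteq> {x. c < h l x} \<and> {x. c < h j x} \<subseteq> {x. c < h l x}"
        using up by blast
      show "\<exists>l\<in>D. \<forall>k. ?f k i \<le> ?f k l \<and> ?f k j \<le> ?f k l"
        using l lsc[OF l(1)] by (intro bexI[of _ l] allI conjI mult_left_mono emeasure_mono) auto
    qed (use D in simp_all)
    also have "\<dots> = (SUP i\<in>D. \<integral>\<^sup>+x. lower_step n (h i x) \<partial>\<mu>)"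
      using int_step[OF mh] by (intro SUP_cong refl) simp
    also have "\<dots> \<le> (SUP i\<in>D. \<integral>\<^sup>+x. h i x \<partial>\<mu>)"
      by (intro SUP_mono) (auto intro!: nn_integral_mono lower_step_le)
    finally show ?thesis .
  qed
  have "(\<integral>\<^sup>+x. ?H x \<partial>\<mu>) \<le> (\<integral>\<^sup>+x. liminf (\<lambda>n. lower_step n (?H x)) \<partial>\<mu>)"
    by (intro nn_integral_mono le_liminf_lower_step)
  also have "\<dots> \<le> liminf (\<lambda>n. \<integral>\<^sup>+x. lower_step n (?H x) \<partial>\<mu>)"
    by (intro nn_integral_liminf) (simp add: lower_step_def)
  also have "\<dots> \<le> liminf (\<lambda>n. SUP i\<in>D. \<integral>\<^sup>+x. h i x \<partial>\<mu>)"
    by (intro Liminf_mono always_eventually allI step)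
  finally show "(\<integral>\<^sup>+x. ?H x \<partial>\<mu>) \<le> (SUP i\<in>D. \<integral>\<^sup>+x. h i x \<partial>\<mu>)"
    by (simp only: Liminf_const[OF trivial_limit_sequentially])
  show "(SUP i\<in>D. \<integral>\<^sup>+x. h i x \<partial>\<mu>) \<le> (\<integral>\<^sup>+x. ?H x \<partial>\<mu>)"
    by (intro SUP_least nn_integral_mono SUP_upper)
qed

text \<open>
  For a neighbourhood \<open>N\<close> of \<open>x0\<close> let \<open>h N\<close> be the lower semicontinuous regularisation of
  \<open>\<lambda>y. INF x\<in>N. k (x, y)\<close>. As \<open>N\<close> shrinks to \<open>x0\<close> these functions increase to \<open>\<lambda>y. k (x0, y)\<close>, because
  \<open>k\<close> is lower semicontinuous in both variables jointly. So their integrals increase to the integral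
  at \<open>x0\<close>, and each of them is a lower bound for the integrals at all points of \<open>N\<close>.
\<close>

lemma lsc_integral_section:
  fixes k :: "'a::topological_space \<times> 'b::topological_space \<Rightarrow> ennreal"
  assumes \<nu>: "radon \<nu>" and k: "\<And>c. open {z. c < k z}"
  shows "open {x. c < (\<integral>\<^sup>+y. k (x, y) \<partial>\<nu>)}"
proof (subst open_subopen, intro ballI)
  fix x0 assume x0: "x0 \<in> {x. c < (\<integral>\<^sup>+y. k (x, y) \<partial>\<nu>)}"
  let ?D = "{N. open N \<and> x0 \<in> N}"
  define h where "h N y = (SUP V\<in>{V. open V \<and> y \<in> V}. INF z\<in>N \<times> V. k z)" for N y
  have lev: "{y. c < h N y} = \<Union>{V. open V \<and> c < (INF z\<in>N \<times> V. k z)}" for N c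
    by (auto simp: h_def less_SUP_iff)
  have lsch: "open {y. c < h N y}" for N c unfolding lev by auto
  have le: "h N y \<le> k (x, y)" if "x \<in> N" for N x y
    unfolding h_def using that by (intro SUP_least INF_lower) auto
  have sup: "(SUP N\<in>?D. h N y) = k (x0, y)" for y
  proof (rule antisym)
    show "(SUP N\<in>?D. h N y) \<le> k (x0, y)" by (intro SUP_least le) auto
    show "k (x0, y) \<le> (SUP N\<in>?D. h N y)"
    proof (rule dense_le)
      fix d assume "d < k (x0, y)"
      then have "(x0, y) \<in> {z. d < k z}" by simp
      then obtain N V where NV: "open N" "open V" "(x0, y) \<in> N \<times> V" "N \<times> V \<subseteq> {z. d < k z}"
        using open_prod_elim[OF k] by metis
      have "d \<le> (INF z\<in>N \<times> V. k z)" using NV(4) by (intro INF_greatest) (auto simp: less_imp_le)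
      also have "\<dots> \<le> h N y" unfolding h_def using NV by (intro SUP_upper) auto
      also have "\<dots> \<le> (SUP N\<in>?D. h N y)" using NV by (intro SUP_upper) auto
      finally show "d \<le> (SUP N\<in>?D. h N y)" .
    qed
  qed
  have "(\<integral>\<^sup>+y. (SUP N\<in>?D. h N y) \<partial>\<nu>) = (SUP N\<in>?D. \<integral>\<^sup>+y. h N y \<partial>\<nu>)"
  proof (rule nn_integral_SUP_directed_lsc[OF \<nu> _ lsch])
    show "?D \<noteq> {}" by (auto intro!: exI[of _ UNIV])
    fix N M assume NM: "N \<in> ?D" "M \<in> ?D"
    have "h N y \<le> h (N \<inter> M) y" "h M y \<le> h (N \<inter> M) y" for y
      unfolding h_def by (auto intro!: SUP_mono INF_superset_mono)
    then show "\<exists>L\<in>?D. \<forall>y. h N y \<le> h L y \<and> h M y \<le> h L y"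
      using NM by (intro bexI[of _ "N \<inter> M"]) auto
  qed
  with x0 obtain N where N: "N \<in> ?D" "c < (\<integral>\<^sup>+y. h N y \<partial>\<nu>)"
    by (auto simp: sup less_SUP_iff)
  have "N \<subseteq> {x. c < (\<integral>\<^sup>+y. k (x, y) \<partial>\<nu>)}"
  proof
    fix x assume "x \<in> N"
    then have "(\<integral>\<^sup>+y. h N y \<partial>\<nu>) \<le> (\<integral>\<^sup>+y. k (x, y) \<partial>\<nu>)" by (intro nn_integral_mono le)
    with N(2) show "x \<in> {x. c < (\<integral>\<^sup>+y. k (x, y) \<partial>\<nu>)}" by (simp add: less_le_trans)
  qed
  then show "\<exists>T. open T \<and> x0 \<in> T \<and> T \<subseteq> {x. c < (\<integral>\<^sup>+y. k (x, y) \<partial>\<nu>)}" using N(1) by auto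
qed

section \<open>Continuous functions with compact support\<close>

lemma CcI:
  assumes "continuous_on UNIV \<phi>" "compact K" "\<And>y. \<phi> y \<noteq> 0 \<Longrightarrow> y \<in> K"
  shows "(\<phi> :: 'b::t2_space \<Rightarrow> real) \<in> Cc"
proof -
  have cl: "closed K" using assms(2) by (rule compact_imp_closed)
  have "closure {y. \<phi> y \<noteq> 0} \<subseteq> K"
    using assms(3) cl by (intro closure_minimal) auto
  then have "closure {y. \<phi> y \<noteq> 0} = K \<inter> closure {y. \<phi> y \<noteq> 0}" by blast
  then have "compact (closure {y. \<phi> y \<noteq> 0})"
    using compact_Int_closed[OF assms(2) closed_closure] by metis
  with assms(1) show ?thesis by (simp add: Cc_def)
qed

lemma CcD:
  assumes "\<phi> \<in> Cc"
  obtains K where "continuous_on UNIV \<phi>" "compact K" "\<And>y. \<phi> y \<noteq> 0 \<Longrightarrow> y \<in> K"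
  using assms closure_subset[of "{y. \<phi> y \<noteq> 0}"] unfolding Cc_def by blast

text \<open>
  The common pattern of the pointwise operations on \<^const>\<open>Cc\<close>.
\<close>

lemma Cc_combine:
  fixes h :: "real \<Rightarrow> real \<Rightarrow> real"
  assumes "\<phi> \<in> Cc" "\<psi> \<in> Cc" "continuous_on UNIV (\<lambda>z. h (\<phi> z) (\<psi> z))" "h 0 0 = 0"
  shows "(\<lambda>z :: 'b::t2_space. h (\<phi> z) (\<psi> z)) \<in> Cc"
proof -
  obtain K where K: "compact K" "\<And>y. \<phi> y \<noteq> 0 \<Longrightarrow> y \<in> K" by (rule CcD[OF assms(1)]) (blast intro: that)
  obtain L where L: "compact L" "\<And>y. \<psi> y \<noteq> 0 \<Longrightarrow> y \<in> L" by (rule CcD[OF assms(2)]) (blast intro: that)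
  show ?thesis
  proof (rule CcI[OF assms(3) compact_Un[OF K(1) L(1)]])
    fix y assume "h (\<phi> y) (\<psi> y) \<noteq> 0"
    then have "\<phi> y \<noteq> 0 \<or> \<psi> y \<noteq> 0" using assms(4) by metis
    then show "y \<in> K \<union> L" using K(2) L(2) by blast
  qed
qed

lemma Cc_continuous: "\<phi> \<in> Cc \<Longrightarrow> continuous_on UNIV \<phi>"
  by (simp add: Cc_def)

lemma Cc_add: "\<phi> \<in> Cc \<Longrightarrow> \<psi> \<in> Cc \<Longrightarrow> (\<lambda>z :: 'b::t2_space. \<phi> z + \<psi> z) \<in> Cc"
  by (rule Cc_combine[where h = "(+)"]) (auto intro!: continuous_on_add dest: Cc_continuous)

lemma Cc_diff: "\<phi> \<in> Cc \<Longrightarrow> \<psi> \<in> Cc \<Longrightarrow> (\<lambda>z :: 'b::t2_space. \<phi> z - \<psi> z) \<in> Cc"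
  by (rule Cc_combine[where h = "(-)"]) (auto intro!: continuous_on_diff dest: Cc_continuous)

lemma Cc_max: "\<phi> \<in> Cc \<Longrightarrow> \<psi> \<in> Cc \<Longrightarrow> (\<lambda>z :: 'b::t2_space. max (\<phi> z) (\<psi> z)) \<in> Cc"
  by (rule Cc_combine[where h = "max"]) (auto intro!: continuous_on_max dest: Cc_continuous)

text \<open>
  Constants are admitted exactly in the two cases in which the kernel is shifted: by \<open>0\<close>, or on a compact space.
\<close>

lemma Cc_const:
  assumes "c = 0 \<or> compact (UNIV :: 'b set)"
  shows "(\<lambda>z :: 'b::t2_space. c :: real) \<in> Cc"
proof (cases "c = 0")
  case True
  then show ?thesis by (intro CcI[of _ "{}"]) auto
next
  case False
  then show ?thesis using assms by (intro CcI[of _ UNIV]) auto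
qed

text \<open>
  Urysohn's lemma, available because locally compact Hausdorff spaces are completely regular.
\<close>

lemma Cc_bump:
  fixes V :: "'b::t2_space set"
  assumes lc: "locally_compact_space (euclidean :: 'b topology)" and V: "open V" "x \<in> V"
  obtains \<phi> where "\<phi> \<in> Cc" "\<phi> x = 1" "\<And>y. 0 \<le> \<phi> y" "\<And>y. \<phi> y \<le> 1" "\<And>y. y \<notin> V \<Longrightarrow> \<phi> y = 0"
proof -
  obtain U K where U: "open U" "x \<in> U" and K: "compact K" "U \<subseteq> K"
    using lc unfolding locally_compact_space_def by (metis UNIV_I compactin_euclidean_iff open_openin topspace_euclidean)
  have "Hausdorff_space (euclidean :: 'b topology)"
    unfolding Hausdorff_space_def disjnt_def by (simp, metis hausdorff)
  then have "completely_regular_space (euclidean :: 'b topology)"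
    using lc by (intro locally_compact_regular_imp_completely_regular_space disjI1) simp_all
  moreover have "closedin euclidean (- (U \<inter> V))" "x \<in> topspace euclidean - (- (U \<inter> V))"
    using U V by (auto simp: closed_Compl open_Int)
  ultimately obtain f :: "'b \<Rightarrow> real" where f: "continuous_map euclidean (top_of_set {0..1}) f"
      "f x = 0" "f ` (- (U \<inter> V)) \<subseteq> {1}"
    unfolding completely_regular_space_def by blast
  have cf: "continuous_on UNIV f" and f01: "f y \<in> {0..1}" for y
    using f(1) by (auto simp: continuous_map_in_subtopology)
  have f1: "f y = 1" if "y \<notin> U \<or> y \<notin> V" for y using f(3) that by auto
  have "(\<lambda>y. 1 - f y) \<in> Cc"
  proof (rule CcI[OF _ K(1)])
    show "continuous_on UNIV (\<lambda>y. 1 - f y)" by (intro continuous_intros cf)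
    show "y \<in> K" if "1 - f y \<noteq> 0" for y using f1[of y] that K(2) by auto
  qed
  then show ?thesis
    by (rule that) (use f(2) f01 f1 in auto)
qed

lemma locally_compact_space_Times:
  assumes lc: "locally_compact_space (euclidean :: 'a::topological_space topology)"
  shows "locally_compact_space (euclidean :: ('a \<times> 'a) topology)"
  unfolding locally_compact_space_def
proof
  fix z :: "'a \<times> 'a"
  have *: "\<exists>U K. open U \<and> compact K \<and> x \<in> U \<and> U \<subseteq> K" for x :: 'a
    using lc unfolding locally_compact_space_def by (auto simp: compactin_euclidean_iff)
  obtain U K where U: "open U" "compact K" "fst z \<in> U" "U \<subseteq> K" using * by blast
  obtain V L where V: "open V" "compact L" "snd z \<in> V" "V \<subseteq> L" using * by blast
  have "open (U \<times> V)" "compact (K \<times> L)" "z \<in> U \<times> V" "U \<times> V \<subseteq> K \<times> L"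
    using U V by (auto intro: open_Times compact_Times simp: mem_Times_iff)
  then show "\<exists>U K. openin euclidean U \<and> compactin euclidean K \<and> z \<in> U \<and> U \<subseteq> K"
    by (intro exI[of _ "U \<times> V"] exI[of _ "K \<times> L"]) (simp add: compactin_euclidean_iff)
qed

text \<open>
  If \<open>d < k z\<close>, then \<open>d\<close> times a bump function at \<open>z\<close> supported in the open set \<open>{y. d < k y}\<close> is a
  minorant.
\<close>

lemma lsc_eq_SUP_Cc:
  fixes k :: "'b::t2_space \<Rightarrow> ennreal"
  assumes lc: "locally_compact_space (euclidean :: 'b topology)" and k: "\<And>c. open {z. c < k z}"
  shows "k z = (SUP \<phi>\<in>{\<phi>\<in>Cc. \<forall>z. 0 \<le> \<phi> z \<and> ennreal (\<phi> z) \<le> k z}. ennreal (\<phi> z))"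
proof (rule antisym)
  let ?D = "{\<phi>\<in>Cc. \<forall>z. 0 \<le> \<phi> z \<and> ennreal (\<phi> z) \<le> k z}"
  show "k z \<le> (SUP \<phi>\<in>?D. ennreal (\<phi> z))"
  proof (rule dense_le)
    fix d assume d: "d < k z"
    then obtain r where r: "0 \<le> r" "d = ennreal r" by (cases d) auto
    obtain \<phi> where \<phi>: "\<phi> \<in> Cc" "\<phi> z = 1" "\<And>y. 0 \<le> \<phi> y" "\<And>y. \<phi> y \<le> 1" "\<And>y. y \<notin> {z. d < k z} \<Longrightarrow> \<phi> y = 0"
      by (rule Cc_bump[OF lc k[of d], of z]) (use d in \<open>blast intro: that\<close>)+
    let ?\<psi> = "\<lambda>y. r * \<phi> y"
    have "?\<psi> \<in> Cc"
      using Cc_combine[OF \<phi>(1) \<phi>(1), of "\<lambda>u v. r * u"] Cc_continuous[OF \<phi>(1)]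
      by (simp add: continuous_on_mult_left)
    moreover have "0 \<le> ?\<psi> y \<and> ennreal (?\<psi> y) \<le> k y" for y
    proof (cases "d < k y")
      case True
      have "ennreal (r * \<phi> y) \<le> ennreal r" using \<phi>(3,4)[of y] r(1) by (intro ennreal_leI mult_left_le)
      also have "\<dots> \<le> k y" using True r(2) by (simp add: less_imp_le)
      finally show ?thesis using \<phi>(3) r(1) by simp
    next
      case False
      then show ?thesis using \<phi>(5)[of y] by simp
    qed
    ultimately have "?\<psi> \<in> ?D" by blast
    then have "ennreal (?\<psi> z) \<le> (SUP \<phi>\<in>?D. ennreal (\<phi> z))" by (rule SUP_upper)
    then show "d \<le> (SUP \<phi>\<in>?D. ennreal (\<phi> z))" using \<phi>(2) r(2) by simp
  qed
  show "(SUP \<phi>\<in>?D. ennreal (\<phi> z)) \<le> k z" by (rule SUP_least) auto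
qed

lemma Cc_bounded:
  assumes \<phi>: "\<phi> \<in> Cc"
  obtains B where "0 \<le> B" "\<And>z. \<bar>\<phi> z\<bar> \<le> B"
proof -
  obtain K where K: "continuous_on UNIV \<phi>" "compact K" "\<And>z. \<phi> z \<noteq> 0 \<Longrightarrow> z \<in> K"
    by (rule CcD[OF \<phi>]) (blast intro: that)
  have "continuous_on K \<phi>" using K(1) by (rule continuous_on_subset) simp
  then have "bounded (\<phi> ` K)" using K(2) by (intro compact_imp_bounded compact_continuous_image)
  then obtain B where B: "\<forall>v\<in>\<phi> ` K. norm v \<le> B" unfolding bounded_iff ..
  have "\<bar>\<phi> z\<bar> \<le> max B 0" for z
  proof (cases "\<phi> z = 0")
    case False
    then have "\<phi> z \<in> \<phi> ` K" using K(3) by blast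
    then show ?thesis using B by fastforce
  qed simp
  then show ?thesis by (rule that[rotated]) simp
qed

lemma Cc_section_integrable:
  fixes \<phi> :: "'a::t2_space \<times> 'b::t2_space \<Rightarrow> real"
  assumes \<nu>: "radon \<nu>" and \<phi>: "\<phi> \<in> Cc"
  shows "integrable \<nu> (\<lambda>y. \<phi> (x, y))"
proof -
  obtain K where K: "continuous_on UNIV \<phi>" "compact K" "\<And>z. \<phi> z \<noteq> 0 \<Longrightarrow> z \<in> K" by (rule CcD[OF \<phi>]) (blast intro: that)
  have [simp, measurable_cong]: "sets \<nu> = sets borel" using \<nu> by (rule radon_sets)
  have cs: "compact (snd ` K)" by (intro compact_continuous_image continuous_intros K(2))
  have cl: "closed (snd ` K)" using cs by (rule compact_imp_closed)
  obtain B where B: "0 \<le> B" "\<And>z. \<bar>\<phi> z\<bar> \<le> B" by (rule Cc_bounded[OF \<phi>]) (blast intro: that)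
  have cont: "continuous_on UNIV (\<lambda>y. \<phi> (x, y))"
    by (rule continuous_on_compose2[OF K(1)]) (auto intro!: continuous_intros)
  show ?thesis
  proof (rule integrableI_bounded_set[where A = "snd ` K" and B = B])
    show "(\<lambda>y. \<phi> (x, y)) \<in> borel_measurable \<nu>"
      using borel_measurable_continuous_onI[OF cont] by simp
    show "AE y in \<nu>. y \<in> snd ` K \<longrightarrow> norm (\<phi> (x, y)) \<le> B"
      using B(2) by (intro AE_I2) simp
    show "AE y in \<nu>. y \<notin> snd ` K \<longrightarrow> \<phi> (x, y) = 0"
      using K(3) by (intro AE_I2) force
  qed (use cl radon_compact_finite[OF \<nu> cs] in simp_all)
qed

lemma nonneg_continuous_lsc:
  assumes "continuous_on UNIV (\<phi> :: 'b::topological_space \<Rightarrow> real)"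
  shows "open {z. c < ennreal (\<phi> z)}"
proof -
  have "open ((\<lambda>z. ennreal (\<phi> z)) -` {c<..})"
    by (intro open_vimage continuous_on_ennreal assms) auto
  then show ?thesis by (simp add: vimage_def)
qed

text \<open>
  The function \<open>\<lambda>x. \<integral>y. \<phi> (x, y) \<partial>\<nu>\<close> is measurable because it is lower semicontinuous. It is bounded
  and vanishes outside the compact projection of the support of \<open>\<phi>\<close>.
\<close>

lemma Cc_integral_integrable_nonneg:
  fixes \<phi> :: "'a::t2_space \<times> 'b::t2_space \<Rightarrow> real"
  assumes \<mu>: "radon \<mu>" and \<nu>: "radon \<nu>" and \<phi>: "\<phi> \<in> Cc" and nn: "\<And>z. 0 \<le> \<phi> z"
  shows "integrable \<mu> (\<lambda>x. \<integral>y. \<phi> (x, y) \<partial>\<nu>)"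
    and "enn2ereal (\<integral>\<^sup>+x. \<integral>\<^sup>+y. ennreal (\<phi> (x, y)) \<partial>\<nu> \<partial>\<mu>) = ereal (\<integral>x. (\<integral>y. \<phi> (x, y) \<partial>\<nu>) \<partial>\<mu>)"
proof -
  obtain K where K: "continuous_on UNIV \<phi>" "compact K" "\<And>z. \<phi> z \<noteq> 0 \<Longrightarrow> z \<in> K" by (rule CcD[OF \<phi>]) (blast intro: that)
  have [simp, measurable_cong]: "sets \<nu> = sets borel" "sets \<mu> = sets borel" using \<mu> \<nu> by (simp_all add: radon_sets)
  have eq: "(\<integral>\<^sup>+y. ennreal (\<phi> (x, y)) \<partial>\<nu>) = ennreal (\<integral>y. \<phi> (x, y) \<partial>\<nu>)" for x
    using Cc_section_integrable[OF \<nu> \<phi>] nn by (intro nn_integral_eq_integral) auto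
  have "(\<lambda>x. \<integral>\<^sup>+y. ennreal (\<phi> (x, y)) \<partial>\<nu>) \<in> borel_measurable borel"
    by (intro borel_measurable_lsc lsc_integral_section[OF \<nu>] nonneg_continuous_lsc K(1))
  then have "(\<lambda>x. enn2real (\<integral>\<^sup>+y. ennreal (\<phi> (x, y)) \<partial>\<nu>)) \<in> borel_measurable borel"
    by measurable
  moreover have i0: "0 \<le> (\<integral>y. \<phi> (x, y) \<partial>\<nu>)" for x using nn by simp
  ultimately have m: "(\<lambda>x. \<integral>y. \<phi> (x, y) \<partial>\<nu>) \<in> borel_measurable \<mu>"
    unfolding eq by simp
  have cf: "compact (fst ` K)" and cs: "compact (snd ` K)" by (intro compact_continuous_image continuous_intros K(2))+
  have clf: "closed (fst ` K)" and cls: "closed (snd ` K)" using cf cs by (auto intro: compact_imp_closed)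
  obtain B where B0: "0 \<le> B" "\<And>z. \<bar>\<phi> z\<bar> \<le> B" by (rule Cc_bounded[OF \<phi>]) (blast intro: that)
  have B: "\<phi> z \<le> B * indicator (snd ` K) (snd z)" for z
    using B0(2)[of z] K(3)[of z] by (cases "z \<in> K") (auto simp: indicator_def)
  have intB: "integrable \<nu> (\<lambda>y. B * indicator (snd ` K) y)"
    using radon_compact_finite[OF \<nu> cs] cls by (intro integrable_mult_right) auto
  have le: "(\<integral>y. \<phi> (x, y) \<partial>\<nu>) \<le> (\<integral>y. B * indicator (snd ` K) y \<partial>\<nu>)" for x
    using B[of "(x, _)"] by (intro integral_mono Cc_section_integrable[OF \<nu> \<phi>] intB) auto
  show int: "integrable \<mu> (\<lambda>x. \<integral>y. \<phi> (x, y) \<partial>\<nu>)"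
  proof (rule integrableI_bounded_set[OF _ m, where A = "fst ` K"])
    show "AE x in \<mu>. x \<in> fst ` K \<longrightarrow> norm (\<integral>y. \<phi> (x, y) \<partial>\<nu>) \<le> (\<integral>y. B * indicator (snd ` K) y \<partial>\<nu>)"
      using le i0 by (intro AE_I2) simp
    show "AE x in \<mu>. x \<notin> fst ` K \<longrightarrow> (\<integral>y. \<phi> (x, y) \<partial>\<nu>) = 0"
    proof (intro AE_I2 impI)
      fix x assume "x \<notin> fst ` K"
      then have "\<phi> (x, y) = 0" for y using K(3)[of "(x, y)"] by force
      then show "(\<integral>y. \<phi> (x, y) \<partial>\<nu>) = 0" by simp
    qed
  qed (use clf radon_compact_finite[OF \<mu> cf] in simp_all)
  have "0 \<le> (\<integral>x. (\<integral>y. \<phi> (x, y) \<partial>\<nu>) \<partial>\<mu>)" using i0 by simp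
  moreover have "(\<integral>\<^sup>+x. ennreal (\<integral>y. \<phi> (x, y) \<partial>\<nu>) \<partial>\<mu>) = ennreal (\<integral>x. (\<integral>y. \<phi> (x, y) \<partial>\<nu>) \<partial>\<mu>)"
    using int i0 by (intro nn_integral_eq_integral) auto
  ultimately show "enn2ereal (\<integral>\<^sup>+x. \<integral>\<^sup>+y. ennreal (\<phi> (x, y)) \<partial>\<nu> \<partial>\<mu>) = ereal (\<integral>x. (\<integral>y. \<phi> (x, y) \<partial>\<nu>) \<partial>\<mu>)"
    unfolding eq by (simp add: enn2ereal_ennreal)
qed

lemma Cc_integral_integrable:
  fixes \<phi> :: "'a::t2_space \<times> 'b::t2_space \<Rightarrow> real"
  assumes \<mu>: "radon \<mu>" and \<nu>: "radon \<nu>" and \<phi>: "\<phi> \<in> Cc"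
  shows "integrable \<mu> (\<lambda>x. \<integral>y. \<phi> (x, y) \<partial>\<nu>)"
proof -
  have z: "(\<lambda>z :: 'a \<times> 'b. 0) \<in> Cc" by (rule Cc_const) simp
  have p: "(\<lambda>z. max (\<phi> z) 0) \<in> Cc" and n: "(\<lambda>z. max (0 - \<phi> z) 0) \<in> Cc"
    by (intro Cc_max Cc_diff z \<phi>)+
  have eq: "\<phi> z = max (\<phi> z) 0 - max (0 - \<phi> z) 0" for z by simp
  have "(\<integral>y. \<phi> (x, y) \<partial>\<nu>) = (\<integral>y. max (\<phi> (x, y)) 0 \<partial>\<nu>) - (\<integral>y. max (0 - \<phi> (x, y)) 0 \<partial>\<nu>)" for x
  proof -
    have "(\<integral>y. \<phi> (x, y) \<partial>\<nu>) = (\<integral>y. max (\<phi> (x, y)) 0 - max (0 - \<phi> (x, y)) 0 \<partial>\<nu>)"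
      by (rule Bochner_Integration.integral_cong[OF refl eq])
    then show ?thesis
      using Bochner_Integration.integral_diff[OF Cc_section_integrable[OF \<nu> p] Cc_section_integrable[OF \<nu> n]] by simp
  qed
  moreover have "integrable \<mu> (\<lambda>x. (\<integral>y. max (\<phi> (x, y)) 0 \<partial>\<nu>) - (\<integral>y. max (0 - \<phi> (x, y)) 0 \<partial>\<nu>))"
    by (intro Bochner_Integration.integrable_diff Cc_integral_integrable_nonneg(1)[OF \<mu> \<nu> p]
        Cc_integral_integrable_nonneg(1)[OF \<mu> \<nu> n]) auto
  ultimately show ?thesis by simp
qed

lemma Cc_iterated_integral_diff:
  fixes \<phi> \<psi> :: "'a::t2_space \<times> 'b::t2_space \<Rightarrow> real"
  assumes \<mu>: "radon \<mu>" and \<nu>: "radon \<nu>" and \<phi>: "\<phi> \<in> Cc" and \<psi>: "\<psi> \<in> Cc"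
  shows "(\<integral>x. (\<integral>y. \<phi> (x, y) - \<psi> (x, y) \<partial>\<nu>) \<partial>\<mu>) =
    (\<integral>x. (\<integral>y. \<phi> (x, y) \<partial>\<nu>) \<partial>\<mu>) - (\<integral>x. (\<integral>y. \<psi> (x, y) \<partial>\<nu>) \<partial>\<mu>)"
  using Cc_section_integrable[OF \<nu> \<phi>] Cc_section_integrable[OF \<nu> \<psi>]
    Cc_integral_integrable[OF \<mu> \<nu> \<phi>] Cc_integral_integrable[OF \<mu> \<nu> \<psi>]
  by (simp add: Bochner_Integration.integral_diff)

lemma Cc_iterated_integral_mono:
  fixes \<phi> \<psi> :: "'a::t2_space \<times> 'b::t2_space \<Rightarrow> real"
  assumes \<mu>: "radon \<mu>" and \<nu>: "radon \<nu>" and \<phi>: "\<phi> \<in> Cc" and \<psi>: "\<psi> \<in> Cc" and le: "\<And>z. \<phi> z \<le> \<psi> z"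
  shows "(\<integral>x. (\<integral>y. \<phi> (x, y) \<partial>\<nu>) \<partial>\<mu>) \<le> (\<integral>x. (\<integral>y. \<psi> (x, y) \<partial>\<nu>) \<partial>\<mu>)"
  by (intro integral_mono Cc_section_integrable[OF \<nu> \<phi>] Cc_section_integrable[OF \<nu> \<psi>]
    Cc_integral_integrable[OF \<mu> \<nu> \<phi>] Cc_integral_integrable[OF \<mu> \<nu> \<psi>] le)

text \<open>
  The inner integrals are lower semicontinuous again, so the theorem on directed suprema applies
  twice.
\<close>

lemma nn_integral_iterated_SUP_directed:
  fixes h :: "'i \<Rightarrow> 'a::topological_space \<times> 'b::topological_space \<Rightarrow> ennreal"
  assumes \<mu>: "radon \<mu>" and \<nu>: "radon \<nu>" and D: "D \<noteq> {}"
    and lsc: "\<And>i c. i \<in> D \<Longrightarrow> open {z. c < h i z}"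
    and dir: "\<And>i j. i \<in> D \<Longrightarrow> j \<in> D \<Longrightarrow> \<exists>k\<in>D. \<forall>z. h i z \<le> h k z \<and> h j z \<le> h k z"
  shows "(\<integral>\<^sup>+x. \<integral>\<^sup>+y. (SUP i\<in>D. h i (x, y)) \<partial>\<nu> \<partial>\<mu>) = (SUP i\<in>D. \<integral>\<^sup>+x. \<integral>\<^sup>+y. h i (x, y) \<partial>\<nu> \<partial>\<mu>)"
proof -
  have sec: "open {y. c < h i (x, y)}" if "i \<in> D" for i c x
  proof -
    have "open ((\<lambda>y. (x, y)) -` {z. c < h i z})"
      by (intro open_vimage lsc that continuous_intros)
    then show ?thesis by (simp add: vimage_def)
  qed
  have "(\<integral>\<^sup>+y. (SUP i\<in>D. h i (x, y)) \<partial>\<nu>) = (SUP i\<in>D. \<integral>\<^sup>+y. h i (x, y) \<partial>\<nu>)" for x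
  proof (rule nn_integral_SUP_directed_lsc[OF \<nu> D sec])
    fix i j assume "i \<in> D" "j \<in> D"
    from dir[OF this] show "\<exists>k\<in>D. \<forall>y. h i (x, y) \<le> h k (x, y) \<and> h j (x, y) \<le> h k (x, y)" by blast
  qed
  then have "(\<integral>\<^sup>+x. \<integral>\<^sup>+y. (SUP i\<in>D. h i (x, y)) \<partial>\<nu> \<partial>\<mu>) = (\<integral>\<^sup>+x. (SUP i\<in>D. \<integral>\<^sup>+y. h i (x, y) \<partial>\<nu>) \<partial>\<mu>)"
    by simp
  also have "\<dots> = (SUP i\<in>D. \<integral>\<^sup>+x. \<integral>\<^sup>+y. h i (x, y) \<partial>\<nu> \<partial>\<mu>)"
  proof (rule nn_integral_SUP_directed_lsc[OF \<mu> D])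
    show "open {x. c < (\<integral>\<^sup>+y. h i (x, y) \<partial>\<nu>)}" if "i \<in> D" for i c
      by (intro lsc_integral_section[OF \<nu>] lsc that)
    fix i j assume "i \<in> D" "j \<in> D"
    from dir[OF this] obtain k where "k \<in> D" "\<forall>z. h i z \<le> h k z \<and> h j z \<le> h k z" ..
    then show "\<exists>k\<in>D. \<forall>x. (\<integral>\<^sup>+y. h i (x, y) \<partial>\<nu>) \<le> (\<integral>\<^sup>+y. h k (x, y) \<partial>\<nu>) \<and> (\<integral>\<^sup>+y. h j (x, y) \<partial>\<nu>) \<le> (\<integral>\<^sup>+y. h k (x, y) \<partial>\<nu>)"
      by (intro bexI[of _ k] allI conjI nn_integral_mono) auto
  qed
  finally show ?thesis .
qed

text \<open>
  The product of the Borel sigma-algebras may be smaller than the Borel sigma-algebra of the product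
  space. It contains the level sets of \<open>\<phi>\<close> nevertheless: \<open>{z. c \<le> \<phi> z}\<close> is compact for \<open>c > 0\<close>, so there
  is a finite union of open boxes between it and \<open>{z. c - 1 / (n + 1) < \<phi> z}\<close>, and it is the
  intersection of these unions over all \<open>n\<close>.
\<close>

lemma Cc_product_measurable:
  fixes \<phi> :: "'a::t2_space \<times> 'b::t2_space \<Rightarrow> real"
  assumes \<phi>: "\<phi> \<in> Cc" and nn: "\<And>z. 0 \<le> \<phi> z"
  shows "\<phi> \<in> borel_measurable (borel \<Otimes>\<^sub>M borel)"
proof (rule borel_measurableI_ge)
  obtain K where K: "continuous_on UNIV \<phi>" "compact K" "\<And>z. \<phi> z \<noteq> 0 \<Longrightarrow> z \<in> K" by (rule CcD[OF \<phi>]) (blast intro: that)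
  let ?P = "borel \<Otimes>\<^sub>M borel :: ('a \<times> 'b) measure"
  fix c :: real
  show "{z \<in> space ?P. c \<le> \<phi> z} \<in> sets ?P"
  proof (cases "c \<le> 0")
    case True
    then have "{z \<in> space ?P. c \<le> \<phi> z} = space ?P" using nn by (auto intro: order_trans)
    then show ?thesis by (simp only: sets.top)
  next
    case False
    let ?C = "{z. c \<le> \<phi> z}"
    have "closed ?C" by (intro closed_Collect_le continuous_intros K(1))
    then have "compact (K \<inter> ?C)" by (rule compact_Int_closed[OF K(2)])
    moreover have "K \<inter> ?C = ?C" using K(3) False by fastforce
    ultimately have C: "compact ?C" by simp
    have "\<exists>B\<in>sets ?P. ?C \<subseteq> B \<and> B \<subseteq> {z. c - 1 / real (Suc n) < \<phi> z}" for n
    proof -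
      let ?B = "{(U, V). open U \<and> open V \<and> U \<times> V \<subseteq> {z. c - 1 / real (Suc n) < \<phi> z}}"
      have o: "open {z. c - 1 / real (Suc n) < \<phi> z}" by (intro open_Collect_less continuous_intros K(1))
      have cover: "?C \<subseteq> (\<Union>(U, V)\<in>?B. U \<times> V)"
      proof
        fix z assume "z \<in> ?C"
        then have "z \<in> {z. c - 1 / real (Suc n) < \<phi> z}" by (auto intro: less_le_trans[of _ c])
        then obtain U V where "open U" "open V" "z \<in> U \<times> V" "U \<times> V \<subseteq> {z. c - 1 / real (Suc n) < \<phi> z}"
          using open_prod_elim[OF o] by metis
        then show "z \<in> (\<Union>(U, V)\<in>?B. U \<times> V)" by (intro UN_I[of "(U, V)"]) simp_all
      qed
      have op: "open (case p of (U, V) \<Rightarrow> U \<times> V)" if "p \<in> ?B" for p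
        using that by (auto intro: open_Times)
      obtain F where F: "F \<subseteq> ?B" "finite F" "?C \<subseteq> (\<Union>(U, V)\<in>F. U \<times> V)"
        by (rule compactE_image[OF C op cover])
      have "(\<Union>(U, V)\<in>F. U \<times> V) \<in> sets ?P"
        using F(1) by (intro sets.finite_UN F(2)) auto
      then show ?thesis using F(1,3) by (intro bexI[of _ "\<Union>(U, V)\<in>F. U \<times> V"]) auto
    qed
    then obtain B where B: "\<And>n. B n \<in> sets ?P" "\<And>n. ?C \<subseteq> B n" "\<And>n. B n \<subseteq> {z. c - 1 / real (Suc n) < \<phi> z}"
      by metis
    have "(\<Inter>n. B n) \<subseteq> ?C"
    proof
      fix z assume z: "z \<in> (\<Inter>n. B n)"
      have "c \<le> \<phi> z + e" if e: "0 < e" for e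
      proof -
        obtain n where "1 / real (Suc n) < e" using nat_approx_posE[OF e] .
        moreover have "c - 1 / real (Suc n) < \<phi> z" using z B(3)[of n] by auto
        ultimately show ?thesis by simp
      qed
      then show "z \<in> ?C" by (simp add: field_le_epsilon)
    qed
    then have "?C = (\<Inter>n. B n)" using B(2) by blast
    moreover have "(\<Inter>n. B n) \<in> sets ?P" using B(1) by auto
    ultimately show ?thesis by (simp add: space_pair_measure)
  qed
qed

section \<open>Potentials and energies of nonnegative measures\<close>

lemma lsc_ereal_borel_measurable: "lsc \<psi> \<Longrightarrow> \<psi> \<in> borel_measurable borel"
  unfolding lsc_def by (intro borel_measurableI_greater) simp

lemma Phi_measurable: "\<psi> \<in> Phi \<Longrightarrow> \<psi> \<in> borel_measurable borel"
  by (rule lsc_ereal_borel_measurable) (simp add: Phi_def)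

lemma Phi_not_minf: "\<psi> \<in> Phi \<Longrightarrow> \<psi> x \<noteq> - \<infinity>"
  by (simp add: Phi_def)

text \<open>
  A kernel on a noncompact space is nonnegative and \<open>c\<close> is \<open>0\<close>. On a compact space all Radon measures are
  finite, and the shift by \<open>c\<close> changes the mutual energy by \<open>c \<mu>(X) \<nu>(X)\<close>. The two cases obey the same
  formulas: if \<open>c = 0\<close> then a term such as \<open>c * measure \<mu> UNIV\<close> vanishes also when \<open>\<mu>\<close> is infinite.
\<close>

locale shifted_kernel =
  fixes \<kappa> :: "'a::t2_space \<times> 'a \<Rightarrow> ereal" and c :: real
  assumes lc: "locally_compact_space (euclidean :: 'a topology)"
    and kernel_lsc: "lsc \<kappa>"
    and kernel_sym: "\<And>x y. \<kappa> (x, y) = \<kappa> (y, x)"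
    and c_nonneg: "0 \<le> c"
    and shift_nonneg: "\<And>z. 0 \<le> \<kappa> z + ereal c"
    and c_alt: "c = 0 \<or> compact (UNIV :: 'a set)"
begin

text \<open>
  The shifted kernel, its potentials and its mutual energies have values in \<^typ>\<open>ennreal\<close>, where
  every integral is defined.
\<close>

definition k :: "'a \<times> 'a \<Rightarrow> ennreal" where
  "k z = e2ennreal (\<kappa> z + ereal c)"

definition U :: "'a measure \<Rightarrow> 'a \<Rightarrow> ennreal" where
  "U \<nu> x = (\<integral>\<^sup>+y. k (x, y) \<partial>\<nu>)"

definition J :: "'a measure \<Rightarrow> 'a measure \<Rightarrow> ennreal" where
  "J \<mu> \<nu> = (\<integral>\<^sup>+x. U \<nu> x \<partial>\<mu>)"

lemma enn2ereal_k: "enn2ereal (k z) = \<kappa> z + ereal c"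
  unfolding k_def by (rule enn2ereal_e2ennreal[OF shift_nonneg])

lemma k_sym: "k (x, y) = k (y, x)"
  by (simp add: k_def kernel_sym[of x y])

lemma k_lsc: "open {z. d < k z}"
proof -
  have "d < k z \<longleftrightarrow> enn2ereal d - ereal c < \<kappa> z" for z
  proof -
    have "d < k z \<longleftrightarrow> enn2ereal d < \<kappa> z + ereal c"
      by (simp add: less_ennreal.rep_eq enn2ereal_k)
    also have "\<dots> \<longleftrightarrow> enn2ereal d - ereal c < \<kappa> z"
      by (cases "\<kappa> z"; cases "enn2ereal d") auto
    finally show ?thesis .
  qed
  then show ?thesis using kernel_lsc by (simp add: lsc_def)
qed

lemma k_section_measurable [measurable]: "(\<lambda>y. k (x, y)) \<in> borel_measurable borel"
proof (rule borel_measurable_lsc)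
  fix d
  have "open ((\<lambda>y. (x, y)) -` {z. d < k z})"
    by (intro open_vimage k_lsc continuous_intros)
  then show "open {y. d < k (x, y)}" by (simp add: vimage_def)
qed

lemma U_measurable:
  assumes "radon \<nu>" shows "U \<nu> \<in> borel_measurable borel"
  unfolding U_def[abs_def]
  by (intro borel_measurable_lsc lsc_integral_section[OF assms] k_lsc)

lemma radon_finite: "radon (\<mu> :: 'a measure) \<Longrightarrow> c \<noteq> 0 \<Longrightarrow> emeasure \<mu> UNIV < \<infinity>"
  using c_alt by (intro radon_compact_finite) simp_all

abbreviation mass :: "'a measure \<Rightarrow> real" where
  "mass \<mu> \<equiv> measure \<mu> UNIV"

lemma c_mass: "radon \<mu> \<Longrightarrow> ennreal c * emeasure \<mu> UNIV = ennreal (c * mass \<mu>)"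
proof (cases "c = 0")
  case False
  assume "radon \<mu>"
  then have "emeasure \<mu> UNIV \<noteq> top"
    using radon_finite[of \<mu>] False by (simp add: less_top[symmetric])
  then have "emeasure \<mu> UNIV = ennreal (mass \<mu>)"
    by (rule emeasure_eq_ennreal_measure)
  then show ?thesis using c_nonneg by (simp add: ennreal_mult)
qed simp

text \<open>
  In particular the potential of a Radon measure is defined everywhere: the negative part of the kernel
  has finite integral.
\<close>

lemma potential_eq:
  assumes \<nu>: "radon \<nu>"
  shows "potential \<kappa> \<nu> x = Some (enn2ereal (U \<nu> x) - ereal (c * mass \<nu>))"
proof -
  have [simp, measurable_cong]: "sets \<nu> = sets borel" using \<nu> by (rule radon_sets)
  have k_eq: "\<kappa> z = enn2ereal (k z) - ereal c" for z
    unfolding enn2ereal_k by (cases "\<kappa> z") auto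
  have m [measurable]: "(\<lambda>y. \<kappa> (x, y)) \<in> borel_measurable borel"
  proof -
    have "(\<lambda>y. \<kappa> (x, y)) = (\<lambda>y. enn2ereal (k (x, y)) - ereal c)" by (intro ext k_eq)
    moreover have "(\<lambda>y. enn2ereal (k (x, y)) - ereal c) \<in> borel_measurable borel" by measurable
    ultimately show ?thesis by (simp only:)
  qed
  let ?P = "\<integral>\<^sup>+y. e2ennreal (\<kappa> (x, y)) \<partial>\<nu>" and ?N = "\<integral>\<^sup>+y. e2ennreal (- \<kappa> (x, y)) \<partial>\<nu>"
  have N_le: "?N \<le> ennreal (c * mass \<nu>)"
  proof -
    have "e2ennreal (- \<kappa> z) \<le> ennreal c" for z
      using shift_nonneg[of z] c_nonneg by (cases "\<kappa> z") (auto intro!: ennreal_leI simp: e2ennreal_neg)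
    then have "?N \<le> (\<integral>\<^sup>+y. ennreal c \<partial>\<nu>)" by (intro nn_integral_mono)
    also have "\<dots> = ennreal (c * mass \<nu>)"
      using c_mass[OF \<nu>] radon_space[OF \<nu>] by simp
    finally show ?thesis .
  qed
  then obtain n where n: "0 \<le> n" "?N = ennreal n" by (cases ?N) (auto simp: top_unique)
  have "e2ennreal (\<kappa> z) + ennreal c = k z + e2ennreal (- \<kappa> z)" for z
  proof (cases "\<kappa> z")
    case (real r)
    then have "k z = ennreal (r + c)" by (simp add: k_def)
    then show ?thesis using real shift_nonneg[of z] c_nonneg
      by (cases "0 \<le> r") (simp_all add: ennreal_plus[symmetric] ennreal_neg del: ennreal_plus)
  qed (use shift_nonneg[of z] in \<open>auto simp: e2ennreal_neg k_def\<close>)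
  then have "(\<integral>\<^sup>+y. e2ennreal (\<kappa> (x, y)) + ennreal c \<partial>\<nu>) = (\<integral>\<^sup>+y. k (x, y) + e2ennreal (- \<kappa> (x, y)) \<partial>\<nu>)"
    by simp
  then have eq: "?P + ennreal (c * mass \<nu>) = U \<nu> x + ennreal n"
    using c_mass[OF \<nu>] radon_space[OF \<nu>] n(2) by (simp add: nn_integral_add U_def)
  have "ext_add (enn2ereal ?P) (- enn2ereal ?N) = Some (enn2ereal ?P - ereal n)"
    using n by (simp add: ext_add_def enn2ereal_ennreal minus_ereal_def)
  also have "enn2ereal ?P - ereal n = enn2ereal (U \<nu> x) - ereal (c * mass \<nu>)"
  proof -
    have cm: "0 \<le> c * mass \<nu>" using c_nonneg by simp
    show ?thesis
    proof (cases ?P)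
      case (real p)
      then have "U \<nu> x < top" using eq by (metis ennreal_add_eq_top ennreal_neq_top top.not_eq_extremum)
      then obtain u where u: "0 \<le> u" "U \<nu> x = ennreal u" by (cases "U \<nu> x") auto
      have "ennreal (p + c * mass \<nu>) = ennreal (u + n)"
        using eq real u n cm by (simp add: ennreal_plus)
      then have "p + c * mass \<nu> = u + n" using real u n cm by (subst (asm) ennreal_inj) auto
      then show ?thesis using real u by (simp add: enn2ereal_ennreal)
    next
      case top
      then have "U \<nu> x = top" using eq n(2) by (metis ennreal_add_eq_top ennreal_neq_top)
      then show ?thesis using top by simp
    qed
  qed
  finally show ?thesis
    unfolding potential_def pintegral_def Let_def by simp
qed

abbreviation minorants :: "('a \<times> 'a \<Rightarrow> real) set" where
  "minorants \<equiv> {\<phi>\<in>Cc. \<forall>z. 0 \<le> \<phi> z \<and> ennreal (\<phi> z) \<le> k z}"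

text \<open>
  Both orders of integration are written as suprema over the same continuous minorants of the kernel.
\<close>

lemma J_eq_SUP:
  assumes \<mu>: "radon \<mu>" and \<nu>: "radon \<nu>"
  shows "J \<mu> \<nu> = (SUP \<phi>\<in>minorants. \<integral>\<^sup>+x. \<integral>\<^sup>+y. ennreal (\<phi> (x, y)) \<partial>\<nu> \<partial>\<mu>)" (is ?t1)
    and "(\<integral>\<^sup>+y. \<integral>\<^sup>+x. k (x, y) \<partial>\<mu> \<partial>\<nu>) = (SUP \<phi>\<in>minorants. \<integral>\<^sup>+y. \<integral>\<^sup>+x. ennreal (\<phi> (x, y)) \<partial>\<mu> \<partial>\<nu>)" (is ?t2)
proof -
  define D where "D = minorants"
  have sup: "k z = (SUP \<phi>\<in>D. ennreal (\<phi> z))" for z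
    unfolding D_def by (rule lsc_eq_SUP_Cc[OF locally_compact_space_Times[OF lc] k_lsc])
  have "(\<lambda>z :: 'a \<times> 'a. 0) \<in> Cc" by (rule Cc_const) simp
  then have "(\<lambda>z. 0) \<in> D" by (simp add: D_def)
  then have ne: "D \<noteq> {}" by blast
  have dir: "\<exists>\<xi>\<in>D. \<forall>z. ennreal (\<phi> z) \<le> ennreal (\<xi> z) \<and> ennreal (\<psi> z) \<le> ennreal (\<xi> z)"
    if "\<phi> \<in> D" "\<psi> \<in> D" for \<phi> \<psi>
  proof (rule bexI[of _ "\<lambda>z. max (\<phi> z) (\<psi> z)"])
    have "(\<lambda>z. max (\<phi> z) (\<psi> z)) \<in> Cc" by (intro Cc_max) (use that in \<open>auto simp: D_def\<close>)
    moreover have "0 \<le> max (\<phi> z) (\<psi> z) \<and> ennreal (max (\<phi> z) (\<psi> z)) \<le> k z" for z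
    proof -
      have "0 \<le> \<phi> z \<and> ennreal (\<phi> z) \<le> k z" "0 \<le> \<psi> z \<and> ennreal (\<psi> z) \<le> k z"
        using that unfolding D_def by blast+
      then show ?thesis by (simp add: max_def)
    qed
    ultimately show "(\<lambda>z. max (\<phi> z) (\<psi> z)) \<in> D" unfolding D_def by blast
  qed (auto intro!: ennreal_leI)
  have "J \<mu> \<nu> = (SUP \<phi>\<in>D. \<integral>\<^sup>+x. \<integral>\<^sup>+y. ennreal (\<phi> (x, y)) \<partial>\<nu> \<partial>\<mu>)"
    unfolding J_def U_def sup
    by (rule nn_integral_iterated_SUP_directed[OF \<mu> \<nu> ne _ dir])
      (auto intro: nonneg_continuous_lsc Cc_continuous simp: D_def)
  then show ?t1 by (simp only: D_def)
  have swap: "open {z. d < ennreal (\<phi> (snd z, fst z))}" if "\<phi> \<in> D" for \<phi> d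
  proof (rule nonneg_continuous_lsc)
    show "continuous_on UNIV (\<lambda>z. \<phi> (snd z, fst z))"
      by (rule continuous_on_compose2[OF Cc_continuous[of \<phi>]]) (use that in \<open>auto simp: D_def intro!: continuous_intros\<close>)
  qed
  have "(\<integral>\<^sup>+y. \<integral>\<^sup>+x. (SUP \<phi>\<in>D. ennreal (\<phi> (snd (y, x), fst (y, x)))) \<partial>\<mu> \<partial>\<nu>) =
      (SUP \<phi>\<in>D. \<integral>\<^sup>+y. \<integral>\<^sup>+x. ennreal (\<phi> (snd (y, x), fst (y, x))) \<partial>\<mu> \<partial>\<nu>)"
  proof (rule nn_integral_iterated_SUP_directed[OF \<nu> \<mu> ne swap])
    fix \<phi> \<psi> assume "\<phi> \<in> D" "\<psi> \<in> D"
    from dir[OF this] show "\<exists>\<xi>\<in>D. \<forall>z. ennreal (\<phi> (snd z, fst z)) \<le> ennreal (\<xi> (snd z, fst z))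
        \<and> ennreal (\<psi> (snd z, fst z)) \<le> ennreal (\<xi> (snd z, fst z))" by blast
  qed
  then have "(\<integral>\<^sup>+y. \<integral>\<^sup>+x. k (x, y) \<partial>\<mu> \<partial>\<nu>) = (SUP \<phi>\<in>D. \<integral>\<^sup>+y. \<integral>\<^sup>+x. ennreal (\<phi> (x, y)) \<partial>\<mu> \<partial>\<nu>)"
    unfolding sup by (simp only: fst_conv snd_conv)
  then show ?t2 by (simp only: D_def)
qed

text \<open>
  Fubini's theorem cannot be applied to the kernel, which need not be measurable for the product
  sigma-algebra. It applies to the continuous minorants, and the suprema agree.
\<close>

lemma J_sym:
  assumes \<mu>: "radon \<mu>" "sigma_finite_measure \<mu>" and \<nu>: "radon \<nu>" "sigma_finite_measure \<nu>"
  shows "J \<mu> \<nu> = J \<nu> \<mu>"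
proof -
  interpret pair_sigma_finite \<mu> \<nu>
    using \<mu>(2) \<nu>(2) by (simp add: pair_sigma_finite_def)
  have [simp, measurable_cong]: "sets \<nu> = sets borel" "sets \<mu> = sets borel"
    using \<mu>(1) \<nu>(1) by (simp_all add: radon_sets)
  have "(\<integral>\<^sup>+y. \<integral>\<^sup>+x. ennreal (\<phi> (x, y)) \<partial>\<mu> \<partial>\<nu>) = (\<integral>\<^sup>+x. \<integral>\<^sup>+y. ennreal (\<phi> (x, y)) \<partial>\<nu> \<partial>\<mu>)"
    if "\<phi> \<in> minorants" for \<phi>
  proof (rule Fubini')
    have "\<phi> \<in> borel_measurable (borel \<Otimes>\<^sub>M borel)"
      using that by (intro Cc_product_measurable) auto
    moreover have "sets (\<mu> \<Otimes>\<^sub>M \<nu>) = sets (borel \<Otimes>\<^sub>M borel)"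
      by (rule sets_pair_measure_cong) simp_all
    ultimately have [measurable]: "\<phi> \<in> borel_measurable (\<mu> \<Otimes>\<^sub>M \<nu>)"
      by (simp cong: measurable_cong_sets)
    have "(\<lambda>(x, y). ennreal (\<phi> (x, y))) = (\<lambda>z. ennreal (\<phi> z))" by auto
    then show "(\<lambda>(x, y). ennreal (\<phi> (x, y))) \<in> borel_measurable (\<mu> \<Otimes>\<^sub>M \<nu>)" by simp
  qed
  then have "(\<integral>\<^sup>+y. \<integral>\<^sup>+x. k (x, y) \<partial>\<mu> \<partial>\<nu>) = J \<mu> \<nu>"
    unfolding J_eq_SUP[OF \<mu>(1) \<nu>(1)] by (intro SUP_cong refl)
  moreover have "(\<integral>\<^sup>+y. \<integral>\<^sup>+x. k (x, y) \<partial>\<mu> \<partial>\<nu>) = J \<nu> \<mu>"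
    unfolding J_def U_def by (intro nn_integral_cong k_sym)
  ultimately show ?thesis by simp
qed

text \<open>
  If \<open>\<phi>\<close> is a continuous minorant of \<open>\<kappa>\<close>, then \<open>max (\<phi> + c) 0\<close> is one of the shifted kernel; if \<open>\<phi>\<close> is
  one of the shifted kernel, then \<open>\<phi> - c\<close> is one of \<open>\<kappa>\<close>. Constants integrate to the correction term.
\<close>

lemma energy_eq:
  assumes \<mu>: "radon \<mu>" and \<nu>: "radon \<nu>"
  shows "energy \<kappa> \<mu> \<nu> = enn2ereal (J \<mu> \<nu>) - ereal (c * mass \<mu> * mass \<nu>)"
proof -
  let ?E = "{\<phi>\<in>Cc. \<forall>z. ereal (\<phi> z) \<le> \<kappa> z}"
  let ?I = "\<lambda>\<phi>. \<integral>x. (\<integral>y. \<phi> (x, y) \<partial>\<nu>) \<partial>\<mu>"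
  let ?m = "c * mass \<mu> * mass \<nu>"
  have "compact (UNIV :: ('a \<times> 'a) set)" if "compact (UNIV :: 'a set)"
    using compact_Times[OF that that] by simp
  then have cc: "(\<lambda>z :: 'a \<times> 'a. c) \<in> Cc" using c_alt by (intro Cc_const) auto
  have Ic: "?I (\<lambda>z. c) = ?m"
    using radon_space[OF \<mu>] radon_space[OF \<nu>] by (simp add: ac_simps)
  have z: "(\<lambda>z :: 'a \<times> 'a. 0) \<in> Cc" by (rule Cc_const) simp
  have JD: "enn2ereal (\<integral>\<^sup>+x. \<integral>\<^sup>+y. ennreal (\<phi> (x, y)) \<partial>\<nu> \<partial>\<mu>) = ereal (?I \<phi>)" if "\<phi> \<in> minorants" for \<phi>
    using that by (intro Cc_integral_integrable_nonneg[OF \<mu> \<nu>]) auto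
  have I_le_J: "ereal (?I \<phi>) \<le> enn2ereal (J \<mu> \<nu>)" if "\<phi> \<in> minorants" for \<phi>
    unfolding JD[OF that, symmetric] J_eq_SUP(1)[OF \<mu> \<nu>]
    using that by (auto simp: less_eq_ennreal.rep_eq[symmetric] intro!: SUP_upper)
  have le: "energy \<kappa> \<mu> \<nu> \<le> enn2ereal (J \<mu> \<nu>) - ereal ?m"
    unfolding energy_def
  proof (rule SUP_least)
    fix \<phi> assume "\<phi> \<in> ?E"
    then have \<phi>: "\<phi> \<in> Cc" "\<And>z. ereal (\<phi> z) \<le> \<kappa> z" by auto
    define \<psi> where "\<psi> z = max (\<phi> z + c) 0" for z
    have \<psi>C: "\<psi> \<in> Cc" unfolding \<psi>_def[abs_def] by (intro Cc_max Cc_add \<phi>(1) cc z)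
    have "ennreal (\<psi> z) \<le> k z" for z
    proof -
      have "ereal (\<psi> z) \<le> \<kappa> z + ereal c"
        using \<phi>(2)[of z] shift_nonneg[of z] by (cases "\<kappa> z") (auto simp: \<psi>_def)
      then have "e2ennreal (ereal (\<psi> z)) \<le> k z" unfolding k_def by (rule e2ennreal_mono)
      then show ?thesis by simp
    qed
    then have \<psi>: "\<psi> \<in> minorants" using \<psi>C by (auto simp: \<psi>_def)
    have "?I \<phi> \<le> ?I (\<lambda>z. \<psi> z - c)"
      by (rule Cc_iterated_integral_mono[OF \<mu> \<nu> \<phi>(1) Cc_diff[OF \<psi>C cc]]) (simp add: \<psi>_def)
    also have "\<dots> = ?I \<psi> - ?m"
      using Cc_iterated_integral_diff[OF \<mu> \<nu> \<psi>C cc] Ic by simp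
    finally have "ereal (?I \<phi>) \<le> ereal (?I \<psi>) - ereal ?m" by simp
    also have "\<dots> \<le> enn2ereal (J \<mu> \<nu>) - ereal ?m" by (intro ereal_minus_mono I_le_J[OF \<psi>]) simp
    finally show "ereal (?I \<phi>) \<le> enn2ereal (J \<mu> \<nu>) - ereal ?m" .
  qed
  have "J \<mu> \<nu> \<le> e2ennreal (energy \<kappa> \<mu> \<nu> + ereal ?m)"
    unfolding J_eq_SUP(1)[OF \<mu> \<nu>]
  proof (rule SUP_least)
    fix \<phi> assume \<phi>: "\<phi> \<in> minorants"
    then have \<phi>C: "\<phi> \<in> Cc" and \<phi>k: "\<And>z. ennreal (\<phi> z) \<le> k z" and \<phi>0: "\<And>z. 0 \<le> \<phi> z" by auto
    have "ereal (\<phi> z - c) \<le> \<kappa> z" for z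
    proof -
      have "enn2ereal (ennreal (\<phi> z)) \<le> enn2ereal (k z)" using \<phi>k[of z] by (simp add: less_eq_ennreal.rep_eq)
      then have "ereal (\<phi> z) \<le> \<kappa> z + ereal c" using \<phi>0[of z] by (simp add: enn2ereal_k enn2ereal_ennreal)
      then show ?thesis by (cases "\<kappa> z") auto
    qed
    then have "(\<lambda>z. \<phi> z - c) \<in> ?E" using Cc_diff[OF \<phi>C cc] by simp
    then have "ereal (?I (\<lambda>z. \<phi> z - c)) \<le> energy \<kappa> \<mu> \<nu>" unfolding energy_def by (rule SUP_upper)
    moreover have "?I (\<lambda>z. \<phi> z - c) = ?I \<phi> - ?m"
      using Cc_iterated_integral_diff[OF \<mu> \<nu> \<phi>C cc] Ic by simp
    ultimately have "ereal (?I \<phi>) \<le> energy \<kappa> \<mu> \<nu> + ereal ?m"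
      by (cases "energy \<kappa> \<mu> \<nu>") auto
    then have "e2ennreal (enn2ereal (\<integral>\<^sup>+x. \<integral>\<^sup>+y. ennreal (\<phi> (x, y)) \<partial>\<nu> \<partial>\<mu>)) \<le> e2ennreal (energy \<kappa> \<mu> \<nu> + ereal ?m)"
      unfolding JD[OF \<phi>] by (rule e2ennreal_mono)
    then show "(\<integral>\<^sup>+x. \<integral>\<^sup>+y. ennreal (\<phi> (x, y)) \<partial>\<nu> \<partial>\<mu>) \<le> e2ennreal (energy \<kappa> \<mu> \<nu> + ereal ?m)" by simp
  qed
  moreover have "0 \<le> energy \<kappa> \<mu> \<nu> + ereal ?m"
  proof -
    have "(\<lambda>z :: 'a \<times> 'a. 0 - c) \<in> ?E"
    proof -
      have "ereal (0 - c) \<le> \<kappa> z" for z using shift_nonneg[of z] by (cases "\<kappa> z") auto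
      then show ?thesis using Cc_diff[OF z cc] by simp
    qed
    then have "ereal (?I (\<lambda>z. 0 - c)) \<le> energy \<kappa> \<mu> \<nu>" unfolding energy_def by (rule SUP_upper)
    moreover have "?I (\<lambda>z. 0 - c) = - ?m"
      using Cc_iterated_integral_diff[OF \<mu> \<nu> z cc] Ic by simp
    ultimately have "ereal (- ?m) \<le> energy \<kappa> \<mu> \<nu>" by (simp only:)
    then show ?thesis by (cases "energy \<kappa> \<mu> \<nu>") auto
  qed
  ultimately have "enn2ereal (J \<mu> \<nu>) \<le> energy \<kappa> \<mu> \<nu> + ereal ?m"
    by (metis enn2ereal_e2ennreal less_eq_ennreal.rep_eq)
  with le show ?thesis
    by (cases "energy \<kappa> \<mu> \<nu>"; cases "enn2ereal (J \<mu> \<nu>)") auto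
qed

end

section \<open>Consequences of positive definiteness\<close>

text \<open>
  The relation \<open>\<mu> = \<mu>1 + \<mu>2\<close>, stated for integrals because it will be applied to potentials and energies.
\<close>

definition splits :: "'a::topological_space measure \<Rightarrow> 'a measure \<Rightarrow> 'a measure \<Rightarrow> bool" where
  "splits \<mu> \<mu>1 \<mu>2 \<longleftrightarrow>
     (\<forall>h\<in>borel_measurable borel. (\<integral>\<^sup>+x. h x \<partial>\<mu>) = (\<integral>\<^sup>+x. h x \<partial>\<mu>1) + (\<integral>\<^sup>+x. h x \<partial>\<mu>2))"

lemma splitsD: "splits \<mu> \<mu>1 \<mu>2 \<Longrightarrow> h \<in> borel_measurable borel \<Longrightarrow>
    (\<integral>\<^sup>+x. h x \<partial>\<mu>) = (\<integral>\<^sup>+x. h x \<partial>\<mu>1) + (\<integral>\<^sup>+x. h x \<partial>\<mu>2)"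
  by (simp add: splits_def)

lemma splits_comb_measure:
  assumes "sets \<mu> = sets borel" "sets \<nu> = sets borel"
  shows "splits (comb_measure 1 \<mu> \<nu>) \<mu> \<nu>"
  unfolding splits_def using assms
  by (auto intro!: trans[OF nn_integral_comb_measure] cong: measurable_cong_sets)

lemma splits_density:
  assumes "sets \<tau> = sets borel" "a \<in> borel_measurable borel" "b \<in> borel_measurable borel"
    and "\<And>x. p x = a x + b x"
  shows "splits (density \<tau> p) (density \<tau> a) (density \<tau> b)"
  unfolding splits_def
proof
  fix h :: "'a \<Rightarrow> ennreal" assume h: "h \<in> borel_measurable borel"
  have [measurable]: "h \<in> borel_measurable \<tau>" "a \<in> borel_measurable \<tau>" "b \<in> borel_measurable \<tau>"
    using assms h by (simp_all cong: measurable_cong_sets)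
  have p: "p = (\<lambda>x. a x + b x)" using assms(4) by blast
  show "(\<integral>\<^sup>+x. h x \<partial>density \<tau> p) = (\<integral>\<^sup>+x. h x \<partial>density \<tau> a) + (\<integral>\<^sup>+x. h x \<partial>density \<tau> b)"
    unfolding p by (simp add: nn_integral_density distrib_right nn_integral_add)
qed

lemma emeasure_le_of_splits:
  assumes "sets \<mu> = sets borel" "sets \<tau> = sets borel"
    and "splits \<tau> \<mu> \<nu>" "B \<in> sets borel"
  shows "emeasure \<mu> B \<le> emeasure \<tau> B"
  using splitsD[OF assms(3), of "indicator B"] assms by simp

lemma radon_null_measure: "radon (null_measure borel)"
  by (rule radonI) auto

lemma radon_part:
  fixes \<tau> \<mu> \<nu> :: "'a::t2_space measure"
  assumes \<tau>: "radon \<tau>" "emeasure \<tau> UNIV < \<infinity>" and \<mu>: "sets \<mu> = sets borel" and s: "splits \<tau> \<mu> \<nu>"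
  shows "radon \<mu>" "emeasure \<mu> UNIV < \<infinity>"
proof -
  have le: "emeasure \<mu> B \<le> emeasure \<tau> B" if "B \<in> sets borel" for B
    by (rule emeasure_le_of_splits[OF \<mu> radon_sets[OF \<tau>(1)] s that])
  show "radon \<mu>"
    by (rule radon_dominated[OF \<tau>(1) _ \<tau>(2) \<mu> zero_less_one]) (use le in simp_all)
  show "emeasure \<mu> UNIV < \<infinity>" by (rule le_less_trans[OF le \<tau>(2)]) simp
qed

lemma finite_sum_measure:
  fixes \<rho> :: "nat \<Rightarrow> 'a::t2_space measure"
  assumes "finite F" "\<And>j. j \<in> F \<Longrightarrow> radon (\<rho> j)"
  shows "\<exists>\<sigma>. radon \<sigma> \<and> (\<forall>h\<in>borel_measurable borel. (\<integral>\<^sup>+x. h x \<partial>\<sigma>) = (\<Sum>j\<in>F. \<integral>\<^sup>+x. h x \<partial>\<rho> j))"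
  using assms
proof (induction F)
  case empty
  show ?case by (intro exI[of _ "null_measure borel"]) (simp add: radon_null_measure)
next
  case (insert j F)
  then obtain \<sigma> where \<sigma>: "radon \<sigma>" "\<forall>h\<in>borel_measurable borel. (\<integral>\<^sup>+x. h x \<partial>\<sigma>) = (\<Sum>j\<in>F. \<integral>\<^sup>+x. h x \<partial>\<rho> j)"
    by auto
  have "splits (comb_measure 1 (\<rho> j) \<sigma>) (\<rho> j) \<sigma>"
    using insert(4)[of j] \<sigma>(1) by (intro splits_comb_measure radon_sets) simp_all
  moreover have "radon (comb_measure 1 (\<rho> j) \<sigma>)"
    using insert(4)[of j] \<sigma>(1) by (intro radon_comb_measure) simp_all
  ultimately show ?case using insert(1,2) \<sigma>(2)
    by (intro exI[of _ "comb_measure 1 (\<rho> j) \<sigma>"]) (simp add: splits_def)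
qed

lemma finite_imp_sigma_finite:
  assumes "radon \<mu>" "emeasure \<mu> UNIV < \<infinity>"
  shows "sigma_finite_measure \<mu>"
proof -
  have "finite_measure \<mu>"
    using assms radon_space[OF assms(1)] by (intro finite_measureI) (simp add: less_top[symmetric])
  then show ?thesis by (rule finite_measure.axioms(1))
qed

context shifted_kernel
begin

lemma U_splits: "splits \<nu> \<nu>1 \<nu>2 \<Longrightarrow> U \<nu> x = U \<nu>1 x + U \<nu>2 x"
  unfolding U_def by (rule splitsD) simp_all

lemma J_splits_left: "splits \<mu> \<mu>1 \<mu>2 \<Longrightarrow> radon \<nu> \<Longrightarrow> J \<mu> \<nu> = J \<mu>1 \<nu> + J \<mu>2 \<nu>"
  unfolding J_def by (rule splitsD) (simp_all add: U_measurable)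

lemma J_splits_right:
  assumes "splits \<nu> \<nu>1 \<nu>2" "radon \<mu>" "radon \<nu>1" "radon \<nu>2"
  shows "J \<mu> \<nu> = J \<mu> \<nu>1 + J \<mu> \<nu>2"
proof -
  have [measurable]: "U \<nu>1 \<in> borel_measurable \<mu>" "U \<nu>2 \<in> borel_measurable \<mu>"
    using U_measurable[OF assms(3)] U_measurable[OF assms(4)] radon_sets[OF assms(2)]
    by (simp_all cong: measurable_cong_sets)
  show ?thesis unfolding J_def U_splits[OF assms(1)] by (rule nn_integral_add) measurable
qed

end

locale pd_kernel = shifted_kernel +
  assumes pos_def: "\<And>\<nu> e. \<nu> \<in> signed_radon \<Longrightarrow> signed_energy \<kappa> \<nu> \<nu> = Some e \<Longrightarrow> 0 \<le> e"
begin

text \<open>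
  Here \<open>(\<nu>, \<rho>)\<close> is the Jordan decomposition of \<open>\<nu> - \<rho>\<close>, whose energy is nonnegative. For the shifted
  kernel the energy is larger by \<open>c (\<nu>(X) - \<rho>(X))\<^sup>2\<close>. An infinite mutual energy would make the energy of
  \<open>\<nu> - \<rho>\<close> equal to \<open>-\<infinity>\<close>.
\<close>

lemma mutual_energy_le_singular:
  assumes s: "(\<nu>, \<rho>) \<in> signed_radon"
    and fin: "emeasure \<nu> UNIV < \<infinity>" "emeasure \<rho> UNIV < \<infinity>"
    and J: "J \<nu> \<nu> < \<infinity>" "J \<rho> \<rho> < \<infinity>"
  shows "2 * J \<nu> \<rho> \<le> J \<nu> \<nu> + J \<rho> \<rho>"
proof -
  have r: "radon \<nu>" "radon \<rho>" using s by (auto simp: signed_radon_def)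
  have sym: "J \<rho> \<nu> = J \<nu> \<rho>"
    by (intro J_sym r finite_imp_sigma_finite fin)
  obtain a where a: "0 \<le> a" "J \<nu> \<nu> = ennreal a" using J(1) by (cases "J \<nu> \<nu>") auto
  obtain b where b: "0 \<le> b" "J \<rho> \<rho> = ennreal b" using J(2) by (cases "J \<rho> \<rho>") auto
  let ?m = "mass \<nu>" and ?n = "mass \<rho>"
  have E: "energy \<kappa> \<nu> \<nu> = ereal (a - c * ?m * ?m)" "energy \<kappa> \<rho> \<rho> = ereal (b - c * ?n * ?n)"
    using energy_eq[OF r(1) r(1)] energy_eq[OF r(2) r(2)] a b by (simp_all add: enn2ereal_ennreal)
  show ?thesis
  proof (cases "J \<nu> \<rho>")
    case (real d)
    have E2: "energy \<kappa> \<nu> \<rho> = ereal (d - c * ?m * ?n)" "energy \<kappa> \<rho> \<nu> = ereal (d - c * ?m * ?n)"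
      using energy_eq[OF r] energy_eq[OF r(2) r(1)] sym real by (simp_all add: enn2ereal_ennreal ac_simps)
    have "signed_energy \<kappa> (\<nu>, \<rho>) (\<nu>, \<rho>) =
        Some (ereal ((a - c * ?m * ?m) + (b - c * ?n * ?n) - 2 * (d - c * ?m * ?n)))"
      by (simp add: E E2 ext_add_def)
    from pos_def[OF s this] have "2 * d \<le> a + b - c * (?m - ?n)\<^sup>2"
      by (simp add: power2_eq_square algebra_simps)
    also have "\<dots> \<le> a + b" using c_nonneg by simp
    finally have "ennreal (2 * d) \<le> ennreal (a + b)" by (rule ennreal_leI)
    then show ?thesis using a b real by (simp add: ennreal_mult)
  next
    case top
    have E2: "energy \<kappa> \<nu> \<rho> = \<infinity>" "energy \<kappa> \<rho> \<nu> = \<infinity>"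
      using energy_eq[OF r] energy_eq[OF r(2) r(1)] sym top by simp_all
    have "signed_energy \<kappa> (\<nu>, \<rho>) (\<nu>, \<rho>) = Some (- \<infinity>)"
      by (simp add: E E2 ext_add_def)
    from pos_def[OF s this] show ?thesis by simp
  qed
qed

text \<open>
  Let \<open>p\<close> and \<open>q\<close> be the densities of \<open>\<nu>\<close> and \<open>\<rho>\<close> with respect to \<open>\<nu> + \<rho>\<close>. The measures with densities
  \<open>(p - q)\<^sup>+\<close> and \<open>(q - p)\<^sup>+\<close> are mutually singular, and the common part with density \<open>min p q\<close> adds the
  same amount to both sides of the inequality.
\<close>

lemma mutual_energy_le:
  assumes r: "radon \<nu>" "radon \<rho>"
    and fin: "emeasure \<nu> UNIV < \<infinity>" "emeasure \<rho> UNIV < \<infinity>"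
    and J: "J \<nu> \<nu> < \<infinity>" "J \<rho> \<rho> < \<infinity>"
  shows "2 * J \<nu> \<rho> \<le> J \<nu> \<nu> + J \<rho> \<rho>"
proof -
  define \<tau> where "\<tau> = comb_measure 1 \<nu> \<rho>"
  have sb: "sets \<nu> = sets borel" "sets \<rho> = sets borel" using r by (simp_all add: radon_sets)
  have st [simp, measurable_cong]: "sets \<tau> = sets borel" by (simp add: \<tau>_def sb)
  have spt: "space \<tau> = UNIV" by (simp add: \<tau>_def radon_space[OF r(1)])
  have em: "emeasure \<tau> B = emeasure \<nu> B + emeasure \<rho> B" if "B \<in> sets borel" for B
    using emeasure_comb_measure[of \<rho> \<nu> B 1] sb that by (simp add: \<tau>_def)
  have fint: "emeasure \<tau> UNIV < \<infinity>" using fin by (simp add: em)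
  interpret \<tau>: finite_measure \<tau>
    using fint by (intro finite_measureI) (simp add: spt less_top[symmetric])
  have ac: "absolutely_continuous \<tau> \<nu>" "absolutely_continuous \<tau> \<rho>"
    unfolding absolutely_continuous_def null_sets_def using em sb by auto
  obtain p where p: "p \<in> borel_measurable \<tau>" "density \<tau> p = \<nu>"
    using \<tau>.Radon_Nikodym[OF ac(1)] sb by auto
  obtain q where q: "q \<in> borel_measurable \<tau>" "density \<tau> q = \<rho>"
    using \<tau>.Radon_Nikodym[OF ac(2)] sb by auto
  have [measurable]: "p \<in> borel_measurable borel" "q \<in> borel_measurable borel"
    using p(1) q(1) by simp_all
  \<comment> \<open>Where both densities are infinite, \<open>p x - q x\<close> is infinite in \<^typ>\<open>ennreal\<close>; the case distinction
    gives \<open>0\<close> there.\<close>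
  define a where "a x = (if q x < p x then p x - q x else 0)" for x
  define b where "b x = (if p x < q x then q x - p x else 0)" for x
  define m where "m x = min (p x) (q x)" for x
  have [measurable]: "a \<in> borel_measurable borel" "b \<in> borel_measurable borel" "m \<in> borel_measurable borel"
    unfolding a_def[abs_def] b_def[abs_def] m_def[abs_def] by measurable
  let ?A = "density \<tau> a" and ?B = "density \<tau> b" and ?M = "density \<tau> m"
  have pam: "p x = a x + m x" "q x = b x + m x" for x
    by (auto simp: a_def b_def m_def min_def less_imp_le diff_add_cancel_ennreal)
  have s1: "splits \<nu> ?A ?M" and s2: "splits \<rho> ?B ?M"
    using splits_density[OF st, of a m p] splits_density[OF st, of b m q] pam p(2) q(2) by simp_all
  have s1': "splits \<nu> ?M ?A"
    using s1 by (simp add: splits_def add.commute)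
  have rA: "radon ?A" "emeasure ?A UNIV < \<infinity>"
    by (rule radon_part[OF r(1) fin(1) _ s1]; simp)+
  have rB: "radon ?B" "emeasure ?B UNIV < \<infinity>"
    by (rule radon_part[OF r(2) fin(2) _ s2]; simp)+
  have rM: "radon ?M" "emeasure ?M UNIV < \<infinity>"
    by (rule radon_part[OF r(1) fin(1) _ s1']; simp)+
  note sf = finite_imp_sigma_finite[OF rA] finite_imp_sigma_finite[OF rB] finite_imp_sigma_finite[OF rM]
  have sing: "(?A, ?B) \<in> signed_radon"
    unfolding signed_radon_def
  proof (intro CollectI case_prodI conjI rA rB allI impI)
    fix K :: "'a set" assume "compact K"
    then have [measurable]: "K \<in> sets borel" by (auto dest: compact_imp_closed)
    let ?N = "K \<inter> {x. p x \<le> q x}"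
    have N [measurable]: "?N \<in> sets borel" by measurable
    have "emeasure ?A ?N = (\<integral>\<^sup>+x. a x * indicator ?N x \<partial>\<tau>)"
      by (rule emeasure_density) simp_all
    also have "\<dots> = (\<integral>\<^sup>+x. 0 \<partial>\<tau>)"
      by (intro nn_integral_cong) (auto simp: a_def indicator_def)
    finally have 1: "emeasure ?A ?N = 0" by simp
    have "emeasure ?B (K - ?N) = (\<integral>\<^sup>+x. b x * indicator (K - ?N) x \<partial>\<tau>)"
      by (rule emeasure_density) simp_all
    also have "\<dots> = (\<integral>\<^sup>+x. 0 \<partial>\<tau>)"
      by (intro nn_integral_cong) (auto simp: b_def indicator_def)
    finally have 2: "emeasure ?B (K - ?N) = 0" by simp
    show "\<exists>N\<in>sets borel. N \<subseteq> K \<and> emeasure ?A N = 0 \<and> emeasure ?B (K - N) = 0"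
      using N 1 2 by (intro bexI[of _ ?N]) auto
  qed
  have J\<nu>\<nu>: "J \<nu> \<nu> = J ?A ?A + J ?A ?M + (J ?A ?M + J ?M ?M)"
    using J_splits_left[OF s1 r(1)] J_splits_right[OF s1 rA(1) rA(1) rM(1)] J_splits_right[OF s1 rM(1) rA(1) rM(1)]
      J_sym[OF rM(1) sf(3) rA(1) sf(1)] by simp
  have J\<rho>\<rho>: "J \<rho> \<rho> = J ?B ?B + J ?B ?M + (J ?B ?M + J ?M ?M)"
    using J_splits_left[OF s2 r(2)] J_splits_right[OF s2 rB(1) rB(1) rM(1)] J_splits_right[OF s2 rM(1) rB(1) rM(1)]
      J_sym[OF rM(1) sf(3) rB(1) sf(2)] by simp
  have J\<nu>\<rho>: "J \<nu> \<rho> = J ?A ?B + J ?A ?M + (J ?B ?M + J ?M ?M)"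
    using J_splits_left[OF s1 r(2)] J_splits_right[OF s2 rA(1) rB(1) rM(1)] J_splits_right[OF s2 rM(1) rB(1) rM(1)]
      J_sym[OF rM(1) sf(3) rB(1) sf(2)] by simp
  have "2 * J ?A ?B \<le> J ?A ?A + J ?B ?B"
    using J unfolding J\<nu>\<nu> J\<rho>\<rho> by (intro mutual_energy_le_singular[OF sing rA(2) rB(2)]) auto
  then have "2 * J ?A ?B + 2 * (J ?A ?M + J ?B ?M + J ?M ?M) \<le>
      J ?A ?A + J ?B ?B + 2 * (J ?A ?M + J ?B ?M + J ?M ?M)" by (rule add_right_mono)
  then show ?thesis unfolding J\<nu>\<nu> J\<rho>\<rho> J\<nu>\<rho> by (simp add: mult_2 distrib_left ac_simps)
qed

text \<open>
  The inequality for two measures, applied to \<open>\<nu>\<close> and the sum of the \<open>\<rho> j\<close>.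
\<close>

lemma sum_mutual_energy_le_finite:
  fixes \<rho> :: "nat \<Rightarrow> 'a measure"
  assumes \<nu>: "radon \<nu>" "emeasure \<nu> UNIV < \<infinity>" "J \<nu> \<nu> < \<infinity>"
    and F: "finite F" and \<rho>: "\<And>j. j \<in> F \<Longrightarrow> radon (\<rho> j)" "\<And>j. j \<in> F \<Longrightarrow> emeasure (\<rho> j) UNIV < \<infinity>"
    and B: "(\<Sum>i\<in>F. \<Sum>j\<in>F. J (\<rho> i) (\<rho> j)) \<le> B" "B < \<infinity>"
  shows "2 * (\<Sum>j\<in>F. J \<nu> (\<rho> j)) \<le> J \<nu> \<nu> + B"
proof -
  obtain \<sigma> where \<sigma>: "radon \<sigma>" and int: "\<And>h. h \<in> borel_measurable borel \<Longrightarrow> (\<integral>\<^sup>+x. h x \<partial>\<sigma>) = (\<Sum>j\<in>F. \<integral>\<^sup>+x. h x \<partial>\<rho> j)"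
    using finite_sum_measure[OF F, of \<rho>] \<rho>(1) by blast
  have U: "U \<sigma> x = (\<Sum>j\<in>F. U (\<rho> j) x)" for x
    unfolding U_def by (rule int) simp
  have Jr: "J \<mu> \<sigma> = (\<Sum>j\<in>F. J \<mu> (\<rho> j))" if "radon \<mu>" for \<mu>
  proof -
    have "U (\<rho> j) \<in> borel_measurable \<mu>" if "j \<in> F" for j
      using U_measurable[OF \<rho>(1)[OF that]] radon_sets[OF \<open>radon \<mu>\<close>] by (simp cong: measurable_cong_sets)
    then show ?thesis unfolding J_def U by (rule nn_integral_sum)
  qed
  have "J \<sigma> \<sigma> = (\<Sum>i\<in>F. J (\<rho> i) \<sigma>)"
    unfolding J_def by (rule int[OF U_measurable[OF \<sigma>]])
  also have "\<dots> = (\<Sum>i\<in>F. \<Sum>j\<in>F. J (\<rho> i) (\<rho> j))" by (intro sum.cong refl Jr \<rho>(1))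
  finally have J\<sigma>: "J \<sigma> \<sigma> \<le> B" using B(1) by simp
  have "emeasure \<sigma> UNIV = (\<Sum>j\<in>F. emeasure (\<rho> j) UNIV)"
    using int[of "indicator UNIV"] \<rho>(1) by (simp add: radon_sets[OF \<sigma>] radon_space[OF \<sigma>] radon_sets radon_space cong: sum.cong)
  also have "\<dots> < \<infinity>" using F \<rho>(2) by (simp add: less_top)
  finally have "2 * J \<nu> \<sigma> \<le> J \<nu> \<nu> + J \<sigma> \<sigma>"
    using J\<sigma> B(2) by (intro mutual_energy_le \<nu> \<sigma>) (auto intro: le_less_trans)
  also have "\<dots> \<le> J \<nu> \<nu> + B" using J\<sigma> by (rule add_left_mono)
  finally show ?thesis unfolding Jr[OF \<nu>(1)] .
qed

text \<open>
  Infinite measures are exhausted by their restrictions to sets of finite measure, for which the bound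
  holds uniformly.
\<close>

lemma sum_mutual_energy_le:
  fixes lam :: "nat \<Rightarrow> 'a measure"
  assumes \<nu>: "radon \<nu>" "emeasure \<nu> UNIV < \<infinity>" "J \<nu> \<nu> < \<infinity>"
    and F: "finite F" and lam: "\<And>j. j \<in> F \<Longrightarrow> radon (lam j)" "\<And>j. j \<in> F \<Longrightarrow> sigma_finite_measure (lam j)"
    and B: "(\<Sum>i\<in>F. \<Sum>j\<in>F. J (lam i) (lam j)) \<le> B" "B < \<infinity>"
  shows "2 * (\<Sum>j\<in>F. J \<nu> (lam j)) \<le> J \<nu> \<nu> + B"
proof -
  have "\<exists>A :: nat \<Rightarrow> 'a set. range A \<subseteq> sets borel \<and> (\<Union>i. A i) = UNIV \<and> (\<forall>i. emeasure (lam j) (A i) \<noteq> \<infinity>) \<and> incseq A"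
    if "j \<in> F" for j
    using sigma_finite_measure.sigma_finite_incseq[OF lam(2)[OF that]] radon_sets[OF lam(1)[OF that]]
      radon_space[OF lam(1)[OF that]] by metis
  then obtain A :: "nat \<Rightarrow> nat \<Rightarrow> 'a set" where A: "\<And>j. j \<in> F \<Longrightarrow> range (A j) \<subseteq> sets borel" "\<And>j. j \<in> F \<Longrightarrow> (\<Union>i. A j i) = UNIV"
      "\<And>j i. j \<in> F \<Longrightarrow> emeasure (lam j) (A j i) \<noteq> \<infinity>" "\<And>j. j \<in> F \<Longrightarrow> incseq (A j)"
    by metis
  define \<rho> where "\<rho> n j = density (lam j) (indicator (A j n))" for n j
  have mA: "A j n \<in> sets borel" if "j \<in> F" for j n using A(1)[OF that] by auto
  have em: "emeasure (\<rho> n j) S = emeasure (lam j) (S \<inter> A j n)" if "j \<in> F" "S \<in> sets borel" for n j S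
    unfolding \<rho>_def using mA[OF that(1), of n] that radon_sets[OF lam(1)[OF that(1)]]
    by (subst emeasure_density) (auto simp: indicator_inter_arith[symmetric] Int_commute)
  have fA: "emeasure (lam j) (A j n) < \<infinity>" if "j \<in> F" for j n
    using A(3)[OF that] by (simp add: less_top[symmetric])
  have \<rho>r: "radon (\<rho> n j)" if j: "j \<in> F" for n j
    by (rule radon_dominated[OF lam(1)[OF j] mA[OF j, of n] fA[OF j, of n] _ zero_less_one])
      (use em[OF j] radon_sets[OF lam(1)[OF j]] in \<open>simp_all add: \<rho>_def\<close>)
  have \<rho>f: "emeasure (\<rho> n j) UNIV < \<infinity>" if j: "j \<in> F" for n j
    using em[OF j, of UNIV n] fA[OF j] by simp
  have int: "(\<integral>\<^sup>+x. h x \<partial>\<rho> n j) = (\<integral>\<^sup>+x. indicator (A j n) x * h x \<partial>lam j)"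
    if "j \<in> F" "h \<in> borel_measurable borel" for n j h
    unfolding \<rho>_def using that mA[OF that(1), of n] radon_sets[OF lam(1)[OF that(1)]]
    by (intro nn_integral_density) (simp_all cong: measurable_cong_sets)
  have int_le: "(\<integral>\<^sup>+x. h x \<partial>\<rho> n j) \<le> (\<integral>\<^sup>+x. h x \<partial>lam j)" if "j \<in> F" "h \<in> borel_measurable borel" for n j h
    unfolding int[OF that] by (intro nn_integral_mono) (simp add: indicator_def)
  have J_le: "J (\<rho> n i) (\<rho> n j) \<le> J (lam i) (lam j)" if ij: "i \<in> F" "j \<in> F" for n i j
  proof -
    have "J (\<rho> n i) (\<rho> n j) \<le> J (lam i) (\<rho> n j)"
      unfolding J_def by (rule int_le[OF ij(1) U_measurable[OF \<rho>r[OF ij(2)]]])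
    also have "\<dots> \<le> J (lam i) (lam j)"
      unfolding J_def U_def by (intro nn_integral_mono int_le ij) simp
    finally show ?thesis .
  qed
  have bound: "2 * (\<Sum>j\<in>F. J \<nu> (\<rho> n j)) \<le> J \<nu> \<nu> + B" for n
  proof (rule sum_mutual_energy_le_finite[OF \<nu> F \<rho>r \<rho>f _ B(2)])
    have "(\<Sum>i\<in>F. \<Sum>j\<in>F. J (\<rho> n i) (\<rho> n j)) \<le> (\<Sum>i\<in>F. \<Sum>j\<in>F. J (lam i) (lam j))"
      by (intro sum_mono J_le)
    then show "(\<Sum>i\<in>F. \<Sum>j\<in>F. J (\<rho> n i) (\<rho> n j)) \<le> B" using B(1) by simp
  qed
  \<comment> \<open>The potential of \<open>\<nu>\<close> is integrated over increasing sets; symmetry moves \<open>\<rho> n j\<close> to the outer integral.\<close>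
  have lim: "(\<lambda>n. J \<nu> (\<rho> n j)) \<longlonglongrightarrow> J \<nu> (lam j)" if j: "j \<in> F" for j
  proof -
    have [measurable]: "U \<nu> \<in> borel_measurable (lam j)"
      using U_measurable[OF \<nu>(1)] radon_sets[OF lam(1)[OF j]] by (simp cong: measurable_cong_sets)
    have [measurable]: "A j n \<in> sets (lam j)" for n using mA[OF j] radon_sets[OF lam(1)[OF j]] by simp
    have J\<rho>: "J \<nu> (\<rho> n j) = (\<integral>\<^sup>+x. indicator (A j n) x * U \<nu> x \<partial>lam j)" for n
    proof -
      have "J \<nu> (\<rho> n j) = J (\<rho> n j) \<nu>"
        by (intro J_sym \<nu>(1) \<rho>r j finite_imp_sigma_finite \<nu>(2) \<rho>f)
      then show ?thesis unfolding J_def int[OF j U_measurable[OF \<nu>(1)]] .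
    qed
    have "J \<nu> (lam j) = J (lam j) \<nu>"
      by (intro J_sym \<nu>(1) lam j finite_imp_sigma_finite \<nu>(2))
    then have "J \<nu> (lam j) = (\<integral>\<^sup>+x. U \<nu> x \<partial>lam j)" by (simp add: J_def)
    moreover have "(\<lambda>n. \<integral>\<^sup>+x. indicator (A j n) x * U \<nu> x \<partial>lam j) \<longlonglongrightarrow> (\<integral>\<^sup>+x. U \<nu> x \<partial>lam j)"
    proof (rule nn_integral_LIMSEQ)
      show "incseq (\<lambda>n x. indicator (A j n) x * U \<nu> x)"
        using A(4)[OF j] by (auto simp: incseq_def le_fun_def indicator_def)
      fix x
      obtain N where "x \<in> A j N" using A(2)[OF j] by blast
      then have "x \<in> A j n" if "N \<le> n" for n using A(4)[OF j] that by (auto simp: incseq_def)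
      then have "eventually (\<lambda>n. indicator (A j n) x * U \<nu> x = U \<nu> x) sequentially"
        by (intro eventually_sequentiallyI[of N]) simp
      then show "(\<lambda>n. indicator (A j n) x * U \<nu> x) \<longlonglongrightarrow> U \<nu> x" by (rule tendsto_eventually)
    qed measurable
    ultimately show ?thesis by (simp add: J\<rho>)
  qed
  have "(\<lambda>n. \<Sum>j\<in>F. J \<nu> (\<rho> n j)) \<longlonglongrightarrow> (\<Sum>j\<in>F. J \<nu> (lam j))"
    by (intro tendsto_sum lim)
  then have "(\<lambda>n. 2 * (\<Sum>j\<in>F. J \<nu> (\<rho> n j))) \<longlonglongrightarrow> 2 * (\<Sum>j\<in>F. J \<nu> (lam j))"
    by (intro ennreal_tendsto_cmult) simp_all
  then show ?thesis by (rule LIMSEQ_le_const2) (use bound in auto)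
qed

end

section \<open>Sigma-finiteness, bounded kernels and interchange of sums and integrals\<close>

text \<open>
  The measures in a condenser may be infinite. That the strictly positive weight \<open>g\<^sub>i\<close> is integrable
  makes them sigma-finite, which gives access to inner regularity and to Fubini's theorem.
\<close>

lemma integrable_pos_sigma_finite:
  fixes h :: "'a::topological_space \<Rightarrow> real"
  assumes s: "sets \<mu> = sets borel" and h: "integrable \<mu> h" "AE x in \<mu>. 0 < h x"
  shows "sigma_finite_measure \<mu>"
proof
  have [measurable]: "h \<in> borel_measurable \<mu>" using h(1) by simp
  let ?A = "\<lambda>n::nat. {x\<in>space \<mu>. 1 / real (Suc n) < h x}"
  let ?N = "{x\<in>space \<mu>. \<not> 0 < h x}"
  have "emeasure \<mu> (?A n) \<noteq> \<infinity>" for n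
  proof -
    have "emeasure \<mu> (?A n) = (\<integral>\<^sup>+x. indicator (?A n) x \<partial>\<mu>)" by simp
    also have "\<dots> \<le> (\<integral>\<^sup>+x. ennreal (norm (real (Suc n) * h x)) \<partial>\<mu>)"
    proof (intro nn_integral_mono)
      fix x
      show "indicator (?A n) x \<le> ennreal (norm (real (Suc n) * h x))"
      proof (cases "x \<in> ?A n")
        case True
        then have "1 \<le> real (Suc n) * h x" by (simp add: divide_less_eq mult.commute less_imp_le)
        then have "1 \<le> norm (real (Suc n) * h x)" by simp
        then have "ennreal 1 \<le> ennreal (norm (real (Suc n) * h x))" by (rule ennreal_leI)
        then show ?thesis using True by simp
      qed simp
    qed
    also have "\<dots> < \<infinity>"
      using integrable_mult_right[OF h(1), of "real (Suc n)"] unfolding integrable_iff_bounded by simp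
    finally show ?thesis by simp
  qed
  moreover have "emeasure \<mu> ?N = 0"
    using h(2) by (subst (asm) AE_iff_measurable[OF _ refl]) auto
  moreover have "?N \<union> (\<Union>n. ?A n) = space \<mu>"
  proof -
    have "\<exists>n. 1 / real (Suc n) < h x" if "0 < h x" for x
      using nat_approx_posE[OF that] by metis
    then show ?thesis by auto
  qed
  ultimately show "\<exists>A. countable A \<and> A \<subseteq> sets \<mu> \<and> \<Union> A = space \<mu> \<and> (\<forall>a\<in>A. emeasure \<mu> a \<noteq> \<infinity>)"
    by (intro exI[of _ "insert ?N (range ?A)"]) auto
qed

text \<open>
  A lower semicontinuous function without the value \<open>-\<infinity>\<close> is bounded from below on a compact space,
  because the open sets \<open>{z. -n < \<kappa> z}\<close> form a cover.
\<close>

lemma Phi_bounded_below_shift: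
  fixes \<kappa> :: "'a::t2_space \<times> 'a \<Rightarrow> ereal"
  assumes "\<kappa> \<in> Phi"
  obtains c where "0 \<le> c" "\<And>z. 0 \<le> \<kappa> z + ereal c" "c = 0 \<or> compact (UNIV :: 'a set)"
proof (cases "\<forall>z. 0 \<le> \<kappa> z")
  case True
  then have "0 \<le> \<kappa> z + ereal 0" for z by (simp only: zero_ereal_def[symmetric] add_0_right)
  then show ?thesis by (intro that[of 0]) simp_all
next
  case False
  then have cp: "compact (UNIV :: ('a \<times> 'a) set)" and l: "lsc \<kappa>" and ninf: "\<And>z. \<kappa> z \<noteq> - \<infinity>"
    using assms unfolding Phi_def by blast+
  have "compact (fst ` (UNIV :: ('a \<times> 'a) set))"
    by (intro compact_continuous_image cp continuous_intros)
  then have ca: "compact (UNIV :: 'a set)" by simp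
  have op: "open {z. ereal (- real n) < \<kappa> z}" for n using l by (simp add: lsc_def)
  have cov: "UNIV \<subseteq> (\<Union>n\<in>UNIV. {z. ereal (- real n) < \<kappa> z})"
  proof
    fix z
    obtain n where "ereal (- real n) < \<kappa> z"
    proof (cases "\<kappa> z")
      case (real r)
      obtain n where "- r < real n" using reals_Archimedean2 by blast
      then show ?thesis using real by (intro that[of n]) simp
    next
      case PInf
      then show ?thesis by (intro that[of 0]) simp
    qed (use ninf in blast)
    then show "z \<in> (\<Union>n\<in>UNIV. {z. ereal (- real n) < \<kappa> z})" by blast
  qed
  obtain F where F: "finite F" "UNIV \<subseteq> (\<Union>n\<in>F. {z. ereal (- real n) < \<kappa> z})"
    by (rule compactE_image[OF cp op cov]) (blast intro: that)
  let ?c = "real (Max (insert 0 F))"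
  have "0 \<le> \<kappa> z + ereal ?c" for z
  proof -
    obtain n where n: "n \<in> F" "ereal (- real n) < \<kappa> z" using F(2) by blast
    have "real n \<le> ?c" using n(1) F(1) by (simp add: Max_ge)
    then show ?thesis using n(2) by (cases "\<kappa> z") auto
  qed
  then show ?thesis using ca by (intro that[of ?c]) auto
qed

lemma AE_summable_of_summable_integrals:
  fixes h :: "nat \<Rightarrow> 'b \<Rightarrow> real"
  assumes int: "\<And>j. integrable M (h j)" and sm: "summable (\<lambda>j. \<integral>x. \<bar>h j x\<bar> \<partial>M)"
  shows "AE x in M. summable (\<lambda>j. \<bar>h j x\<bar>)"
proof -
  have abs: "integrable M (\<lambda>x. \<bar>h j x\<bar>)" for j using int by (rule integrable_abs)
  have eq: "(\<integral>\<^sup>+x. ennreal \<bar>h j x\<bar> \<partial>M) = ennreal (\<integral>x. \<bar>h j x\<bar> \<partial>M)" for j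
    by (rule nn_integral_eq_integral[OF abs]) simp
  have m: "(\<lambda>x. ennreal \<bar>h j x\<bar>) \<in> borel_measurable M" for j
    using abs[of j] by simp
  have "(\<integral>\<^sup>+x. (\<Sum>j. ennreal \<bar>h j x\<bar>) \<partial>M) = (\<Sum>j. \<integral>\<^sup>+x. ennreal \<bar>h j x\<bar> \<partial>M)"
    by (rule nn_integral_suminf[OF m])
  also have "\<dots> = ennreal (\<Sum>j. \<integral>x. \<bar>h j x\<bar> \<partial>M)"
    unfolding eq by (rule suminf_ennreal2[OF _ sm]) simp
  finally have fin: "(\<integral>\<^sup>+x. (\<Sum>j. ennreal \<bar>h j x\<bar>) \<partial>M) \<noteq> \<infinity>" by simp
  have "AE x in M. (\<Sum>j. ennreal \<bar>h j x\<bar>) \<noteq> \<infinity>"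
    by (rule nn_integral_noteq_infinite[OF borel_measurable_suminf_order[OF m] fin])
  then show ?thesis
  proof eventually_elim
    case (elim x)
    then show ?case by (intro summable_suminf_not_top) simp_all
  qed
qed

lemma has_sum_integral_swap:
  fixes h :: "nat \<Rightarrow> 'b \<Rightarrow> real"
  assumes int: "\<And>j. j \<in> I \<Longrightarrow> integrable M (h j)"
    and sm: "(\<lambda>j. \<integral>x. \<bar>h j x\<bar> \<partial>M) summable_on I"
  obtains H where "integrable M H" "AE x in M. ((\<lambda>j. h j x) has_sum H x) I"
    "((\<lambda>j. \<integral>x. h j x \<partial>M) has_sum (\<integral>x. H x \<partial>M)) I"
proof -
  define h' where "h' j x = (if j \<in> I then h j x else 0)" for j x
  have int': "integrable M (h' j)" for j
    unfolding h'_def[abs_def] using int[of j] by (cases "j \<in> I") simp_all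
  have neutral: "(\<lambda>j. \<integral>x. \<bar>h' j x\<bar> \<partial>M) summable_on UNIV \<longleftrightarrow> (\<lambda>j. \<integral>x. \<bar>h j x\<bar> \<partial>M) summable_on I"
    by (rule summable_on_cong_neutral) (simp_all add: h'_def)
  have sm': "summable (\<lambda>j. \<integral>x. \<bar>h' j x\<bar> \<partial>M)"
    using sm neutral summable_on_imp_summable by blast
  have sm'': "summable (\<lambda>j. \<integral>x. norm (h' j x) \<partial>M)" using sm' by simp
  have ae: "AE x in M. summable (\<lambda>j. \<bar>h' j x\<bar>)" by (rule AE_summable_of_summable_integrals[OF int' sm'])
  then have ae': "AE x in M. summable (\<lambda>j. norm (h' j x))" by simp
  have restrict: "(u has_sum s) I \<longleftrightarrow> ((\<lambda>j. if j \<in> I then u j else 0) has_sum s) UNIV" for u :: "nat \<Rightarrow> real" and s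
    by (rule has_sum_cong_neutral) simp_all
  show ?thesis
  proof (rule that)
    show "integrable M (\<lambda>x. \<Sum>j. h' j x)"
      by (rule integrable_suminf[OF int' ae' sm''])
    show "AE x in M. ((\<lambda>j. h j x) has_sum (\<Sum>j. h' j x)) I"
      using ae'
    proof eventually_elim
      case (elim x)
      then have "((\<lambda>j. h' j x) has_sum (\<Sum>j. h' j x)) UNIV"
        by (intro norm_summable_imp_has_sum summable_sums summable_norm_cancel[OF elim])
      then show ?case unfolding restrict h'_def .
    qed
    have "(\<lambda>j. \<integral>x. h' j x \<partial>M) sums (\<integral>x. (\<Sum>j. h' j x) \<partial>M)"
      by (rule sums_integral[OF int' ae' sm''])
    moreover have "summable (\<lambda>j. norm (\<integral>x. h' j x \<partial>M))"
      by (rule summable_comparison_test'[OF sm'', of 0]) (simp add: integral_norm_bound)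
    ultimately have "((\<lambda>j. \<integral>x. h' j x \<partial>M) has_sum (\<integral>x. (\<Sum>j. h' j x) \<partial>M)) UNIV"
      by (intro norm_summable_imp_has_sum)
    moreover have "(\<lambda>j. \<integral>x. h' j x \<partial>M) = (\<lambda>j. if j \<in> I then \<integral>x. h j x \<partial>M else 0)"
      by (auto simp: h'_def)
    ultimately show "((\<lambda>j. \<integral>x. h j x \<partial>M) has_sum (\<integral>x. (\<Sum>j. h' j x) \<partial>M)) I"
      unfolding restrict by (simp only:)
  qed
qed

section \<open>Sets of capacity zero and perturbed measures\<close>

definition scaled_restr :: "'a::topological_space measure \<Rightarrow> real \<Rightarrow> 'a set \<Rightarrow> 'a measure" where
  "scaled_restr \<nu> s T = density \<nu> (\<lambda>x. ennreal s * indicator T x)"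

lemma sets_scaled_restr [simp]: "sets (scaled_restr \<nu> s T) = sets \<nu>"
  by (simp add: scaled_restr_def)

context
  fixes \<nu> :: "'a::t2_space measure" and T :: "'a set" and s :: real
  assumes \<nu>: "radon \<nu>" and T: "T \<in> sets borel" "emeasure \<nu> T < \<infinity>" and s: "0 < s"
begin

lemma nn_integral_scaled_restr:
  "h \<in> borel_measurable borel \<Longrightarrow>
     (\<integral>\<^sup>+x. h x \<partial>scaled_restr \<nu> s T) = ennreal s * (\<integral>\<^sup>+x. indicator T x * h x \<partial>\<nu>)"
proof -
  assume h: "h \<in> borel_measurable borel"
  have [measurable]: "T \<in> sets \<nu>" "h \<in> borel_measurable \<nu>"
    using T h radon_sets[OF \<nu>] by (simp_all cong: measurable_cong_sets)
  have "(\<integral>\<^sup>+x. h x \<partial>scaled_restr \<nu> s T) = (\<integral>\<^sup>+x. ennreal s * indicator T x * h x \<partial>\<nu>)"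
    unfolding scaled_restr_def by (rule nn_integral_density) measurable
  also have "\<dots> = (\<integral>\<^sup>+x. ennreal s * (indicator T x * h x) \<partial>\<nu>)" by (simp only: mult.assoc)
  also have "\<dots> = ennreal s * (\<integral>\<^sup>+x. indicator T x * h x \<partial>\<nu>)"
    by (rule nn_integral_cmult) measurable
  finally show ?thesis .
qed

lemma emeasure_scaled_restr:
  assumes B: "B \<in> sets borel"
  shows "emeasure (scaled_restr \<nu> s T) B = ennreal s * emeasure \<nu> (B \<inter> T)"
proof -
  have "emeasure (scaled_restr \<nu> s T) B = (\<integral>\<^sup>+x. indicator B x \<partial>scaled_restr \<nu> s T)"
    using B radon_sets[OF \<nu>] by simp
  also have "\<dots> = ennreal s * (\<integral>\<^sup>+x. indicator T x * indicator B x \<partial>\<nu>)"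
    using B by (intro nn_integral_scaled_restr) simp
  also have "(\<lambda>x. indicator T x * indicator B x :: ennreal) = indicator (B \<inter> T)"
    by (auto simp: indicator_def)
  also have "(\<integral>\<^sup>+x. indicator (B \<inter> T) x \<partial>\<nu>) = emeasure \<nu> (B \<inter> T)"
    using B T radon_sets[OF \<nu>] by simp
  finally show ?thesis .
qed

lemma radon_scaled_restr: "radon (scaled_restr \<nu> s T)"
  by (rule radon_dominated[OF \<nu> T _ s]) (simp_all add: radon_sets[OF \<nu>] emeasure_scaled_restr)

lemma finite_scaled_restr: "emeasure (scaled_restr \<nu> s T) UNIV < \<infinity>"
  using T(2) by (simp add: emeasure_scaled_restr ennreal_mult_less_top)

lemma AE_scaled_restr:
  assumes "AE x in \<nu>. x \<in> T \<longrightarrow> P x"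
  shows "AE x in scaled_restr \<nu> s T. P x"
proof -
  have m: "(\<lambda>x. ennreal s * indicator T x) \<in> borel_measurable \<nu>"
    using T(1) radon_sets[OF \<nu>] by simp
  show ?thesis unfolding scaled_restr_def AE_density[OF m]
    using assms by eventually_elim (auto simp: indicator_def split: if_splits)
qed

lemma nn_integral_scaled_restr_le:
  assumes "h \<in> borel_measurable borel"
  shows "(\<integral>\<^sup>+x. h x \<partial>scaled_restr \<nu> s T) \<le> ennreal s * (\<integral>\<^sup>+x. h x \<partial>\<nu>)"
  unfolding nn_integral_scaled_restr[OF assms]
  by (intro mult_left_mono nn_integral_mono) (simp_all add: indicator_def)

lemma msupport_scaled_restr:
  assumes K: "closed K" "T \<subseteq> K"
  shows "msupport (scaled_restr \<nu> s T) \<subseteq> K"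
proof -
  have "- K \<inter> T = {}" using K(2) by auto
  then have "emeasure (scaled_restr \<nu> s T) (- K) = 0"
    using K(1) by (simp add: emeasure_scaled_restr)
  then show ?thesis using msupport_subset_iff[OF radon_scaled_restr K(1)] by simp
qed

end

lemma integral_scaled_restr:
  fixes h :: "'a::t2_space \<Rightarrow> real"
  assumes \<nu>: "radon \<nu>" and T: "T \<in> sets borel" and s: "0 < s"
    and h: "h \<in> borel_measurable borel" "integrable \<nu> (\<lambda>x. indicator T x * h x)"
  shows "integrable (scaled_restr \<nu> s T) h"
    and "(\<integral>x. h x \<partial>scaled_restr \<nu> s T) = s * (\<integral>x. indicator T x * h x \<partial>\<nu>)"
proof -
  have m: "h \<in> borel_measurable \<nu>" "(\<lambda>x. s * indicator T x) \<in> borel_measurable \<nu>"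
    using h(1) T radon_sets[OF \<nu>] by (simp_all cong: measurable_cong_sets)
  have d: "scaled_restr \<nu> s T = density \<nu> (\<lambda>x. ennreal (s * indicator T x))"
    unfolding scaled_restr_def using s by (simp add: ennreal_mult ennreal_indicator)
  have nn: "AE x in \<nu>. 0 \<le> s * (indicator T x :: real)" using s by simp
  have eq: "(\<lambda>x. (s * indicator T x) *\<^sub>R h x) = (\<lambda>x. s * (indicator T x * h x))" by auto
  show "integrable (scaled_restr \<nu> s T) h"
    unfolding d integrable_density[OF m nn] eq by (rule integrable_mult_right[OF h(2)])
  show "(\<integral>x. h x \<partial>scaled_restr \<nu> s T) = s * (\<integral>x. indicator T x * h x \<partial>\<nu>)"
    unfolding d integral_density[OF m nn] eq by simp
qed

context shifted_kernel
begin

lemma J_scaled_restr_left: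
  assumes "radon \<nu>" "T \<in> sets borel" "emeasure \<nu> T < \<infinity>" "0 < s" "radon \<rho>"
  shows "J (scaled_restr \<nu> s T) \<rho> \<le> ennreal s * J \<nu> \<rho>"
  unfolding J_def by (rule nn_integral_scaled_restr_le[OF assms(1-4) U_measurable[OF assms(5)]])

lemma J_scaled_restr_finite:
  assumes \<nu>: "radon \<nu>" "T \<in> sets borel" "emeasure \<nu> T < \<infinity>" "0 < s" and J: "J \<nu> \<nu> < \<infinity>"
  shows "J (scaled_restr \<nu> s T) (scaled_restr \<nu> s T) < \<infinity>"
proof -
  let ?\<sigma> = "scaled_restr \<nu> s T"
  have [measurable]: "U \<nu> \<in> borel_measurable \<nu>"
    using U_measurable[OF \<nu>(1)] radon_sets[OF \<nu>(1)] by (simp cong: measurable_cong_sets)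
  have "J ?\<sigma> ?\<sigma> \<le> ennreal s * J \<nu> ?\<sigma>"
    by (rule J_scaled_restr_left[OF \<nu> radon_scaled_restr[OF \<nu>]])
  also have "J \<nu> ?\<sigma> \<le> (\<integral>\<^sup>+x. ennreal s * U \<nu> x \<partial>\<nu>)"
    unfolding J_def U_def[of ?\<sigma>] using nn_integral_scaled_restr_le[OF \<nu>]
    by (intro nn_integral_mono) (simp add: U_def)
  also have "\<dots> = ennreal s * J \<nu> \<nu>" unfolding J_def by (rule nn_integral_cmult) measurable
  finally have "J ?\<sigma> ?\<sigma> \<le> ennreal s * (ennreal s * J \<nu> \<nu>)" by (simp add: mult_left_mono)
  also have "\<dots> < \<infinity>" using J by (simp add: ennreal_mult_less_top)
  finally show ?thesis .
qed

lemma energy_finite_iff: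
  assumes "radon \<mu>" "radon \<nu>"
  shows "energy \<kappa> \<mu> \<nu> < \<infinity> \<longleftrightarrow> J \<mu> \<nu> < \<infinity>"
  unfolding energy_eq[OF assms] by (cases "J \<mu> \<nu>") (simp_all add: enn2ereal_ennreal)

lemma energy_gt_minus_infinity:
  assumes "radon \<mu>" "radon \<nu>"
  shows "- \<infinity> < energy \<kappa> \<mu> \<nu>"
  unfolding energy_eq[OF assms] by (cases "J \<mu> \<nu>") (simp_all add: enn2ereal_ennreal)

lemma int_capacity_nonzeroD:
  assumes "int_capacity \<kappa> E \<noteq> 0"
  obtains \<nu> where "radon \<nu>" "J \<nu> \<nu> < \<infinity>" "emeasure \<nu> UNIV = 1" "compact (msupport \<nu>)" "msupport \<nu> \<subseteq> E"
proof -
  let ?S = "{\<nu>\<in>Eplus \<kappa>. emeasure \<nu> UNIV = 1 \<and> compact (msupport \<nu>) \<and> msupport \<nu> \<subseteq> E}"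
  have "?S \<noteq> {}"
  proof
    assume e: "?S = {}"
    show False using assms unfolding int_capacity_def e by (simp add: top_ereal_def)
  qed
  then obtain \<nu> where \<nu>: "\<nu> \<in> ?S" by blast
  then have r: "radon \<nu>" and "energy \<kappa> \<nu> \<nu> < \<infinity>" by (simp_all add: Eplus_def Mplus_def)
  then have "J \<nu> \<nu> < \<infinity>" using energy_finite_iff[OF r r] by blast
  then show ?thesis using \<nu> r by (intro that[of \<nu>]) blast+
qed

text \<open>
  Capacity zero means that the infimum of the energies is infinite. The value \<open>1 / -\<infinity> = 0\<close> must be ruled
  out: the energy of a measure of total mass \<open>1\<close> is at least \<open>-c\<close>.
\<close>

lemma int_capacity_zeroD:
  assumes cap: "int_capacity \<kappa> E = 0"
    and \<nu>: "radon \<nu>" "J \<nu> \<nu> < \<infinity>" "emeasure \<nu> UNIV = 1" "compact (msupport \<nu>)" "msupport \<nu> \<subseteq> E"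
  shows False
proof -
  let ?S = "{\<nu>\<in>Eplus \<kappa>. emeasure \<nu> UNIV = 1 \<and> compact (msupport \<nu>) \<and> msupport \<nu> \<subseteq> E}"
  let ?i = "INF \<nu>\<in>?S. energy \<kappa> \<nu> \<nu>"
  have fin: "energy \<kappa> \<nu> \<nu> < \<infinity>" using energy_finite_iff[OF \<nu>(1,1)] \<nu>(2) by blast
  have "\<nu> \<in> ?S"
    using \<nu> fin energy_gt_minus_infinity[OF \<nu>(1,1)] by (simp add: Eplus_def Mplus_def)
  then have "?i \<le> energy \<kappa> \<nu> \<nu>" by (rule INF_lower)
  then have 1: "?i \<noteq> \<infinity>" using fin by auto
  have "ereal (- c) \<le> energy \<kappa> \<mu> \<mu>" if "\<mu> \<in> ?S" for \<mu>
  proof -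
    have r: "radon \<mu>" and m: "measure \<mu> UNIV = 1" using that by (simp_all add: Eplus_def Mplus_def measure_def)
    have "0 - ereal c \<le> enn2ereal (J \<mu> \<mu>) - ereal c" by (rule ereal_minus_mono) simp_all
    then show ?thesis using energy_eq[OF r r] m by simp
  qed
  then have "ereal (- c) \<le> ?i" by (intro INF_greatest)
  then have 2: "?i \<noteq> - \<infinity>" by auto
  obtain r where "?i = ereal r" using 1 2 by (cases ?i) auto
  then have "int_capacity \<kappa> E \<noteq> 0" unfolding int_capacity_def by (simp add: divide_ereal_def one_ereal_def split: if_splits)
  with cap show False by simp
qed

text \<open>
  If \<open>\<nu>\<close> charged \<open>N\<close>, it would charge a compact subset of \<open>N\<close>; the normalised restriction to that set
  would be a competitor of finite energy in the definition of the capacity.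
\<close>

lemma capacity_zero_null:
  assumes cap: "int_capacity \<kappa> N = 0" and N: "N \<in> sets borel"
    and \<nu>: "radon \<nu>" "sigma_finite_measure \<nu>" "J \<nu> \<nu> < \<infinity>"
  shows "emeasure \<nu> N = 0"
proof (rule ccontr)
  assume pos: "emeasure \<nu> N \<noteq> 0"
  have sb: "sets \<nu> = sets borel" by (rule radon_sets[OF \<nu>(1)])
  obtain A :: "nat \<Rightarrow> 'a set" where A: "range A \<subseteq> sets \<nu>" "(\<Union>i. A i) = space \<nu>" "\<And>i. emeasure \<nu> (A i) \<noteq> \<infinity>"
    by (rule sigma_finite_measure.sigma_finite[OF \<nu>(2)]) (blast intro: that)
  have "N = (\<Union>i. N \<inter> A i)" using A(2) radon_space[OF \<nu>(1)] by blast
  then have "\<exists>i. emeasure \<nu> (N \<inter> A i) \<noteq> 0"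
    using pos emeasure_UN_eq_0[of \<nu> "\<lambda>i. N \<inter> A i"] A(1) N sb by (metis (no_types, lifting) image_subset_iff rangeI sets.Int)
  then obtain i where i: "emeasure \<nu> (N \<inter> A i) \<noteq> 0" ..
  let ?S = "N \<inter> A i"
  have S: "?S \<in> sets borel" using A(1) N sb by auto
  have "emeasure \<nu> ?S \<le> emeasure \<nu> (A i)" using A(1) by (intro emeasure_mono) auto
  then have fS: "emeasure \<nu> ?S < \<infinity>" using A(3)[of i] by (simp add: less_top[symmetric] neq_top_trans)
  \<comment> \<open>An error below the measure of the whole set forces the compact subset to have positive measure.\<close>
  obtain e where e: "0 < e" "emeasure \<nu> ?S = ennreal e"
    using i fS by (cases "emeasure \<nu> ?S") (auto simp: less_le)
  obtain C where C: "compact C" "C \<subseteq> ?S" "emeasure \<nu> (?S - C) < ennreal e"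
    by (rule radon_compact_inner_approx[OF \<nu>(1) S fS e(1)])
  have cl: "closed C" using C(1) by (rule compact_imp_closed)
  have "emeasure \<nu> ?S = emeasure \<nu> C + emeasure \<nu> (?S - C)"
    using C(2) cl S sb by (subst plus_emeasure) (auto simp: Un_absorb1)
  then have "emeasure \<nu> C \<noteq> 0" using e C(3) by auto
  moreover have fC: "emeasure \<nu> C < \<infinity>" by (rule radon_compact_finite[OF \<nu>(1) C(1)])
  ultimately obtain m where m: "0 < m" "emeasure \<nu> C = ennreal m"
    by (cases "emeasure \<nu> C") (auto simp: less_le)
  have mC: "C \<in> sets borel" using cl by simp
  have s: "0 < 1 / m" using m(1) by simp
  note C' = \<nu>(1) mC fC s
  let ?\<sigma> = "scaled_restr \<nu> (1 / m) C"
  have "emeasure ?\<sigma> UNIV = 1"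
    using m by (simp add: emeasure_scaled_restr[OF C'] ennreal_mult[symmetric])
  moreover have sup: "msupport ?\<sigma> \<subseteq> C" by (rule msupport_scaled_restr[OF C' cl order_refl])
  moreover have "compact (msupport ?\<sigma>)"
    using compact_Int_closed[OF C(1) msupport_closed, of ?\<sigma>] sup by (simp add: Int_absorb1)
  ultimately show False
    using int_capacity_zeroD[OF cap radon_scaled_restr[OF C'] J_scaled_restr_finite[OF C' \<nu>(3)]] C(2) by blast
qed

definition E :: "'a measure \<Rightarrow> 'a measure \<Rightarrow> real" where
  "E \<mu> \<nu> = enn2real (J \<mu> \<nu>) - c * mass \<mu> * mass \<nu>"

lemma energy_eq_E: "radon \<mu> \<Longrightarrow> radon \<nu> \<Longrightarrow> J \<mu> \<nu> < \<infinity> \<Longrightarrow> energy \<kappa> \<mu> \<nu> = ereal (E \<mu> \<nu>)"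
  unfolding E_def by (cases "J \<mu> \<nu>") (simp_all add: energy_eq enn2ereal_ennreal)

text \<open>
  The convex combination \<open>(1 - t) \<mu> + t \<sigma>\<close>.
\<close>

definition mix :: "real \<Rightarrow> 'a measure \<Rightarrow> 'a measure \<Rightarrow> 'a measure" where
  "mix t \<mu> \<sigma> = comb_measure (1 - t) \<mu> (comb_measure t \<sigma> (null_measure borel))"

context
  fixes \<mu> \<sigma> :: "'a measure" and t :: real
  assumes \<mu>: "radon \<mu>" and \<sigma>: "radon \<sigma>" and t: "0 < t" "t < 1"
begin

lemma sets_mix: "sets (mix t \<mu> \<sigma>) = sets borel"
  by (simp add: mix_def radon_sets[OF \<mu>])

lemma radon_mix: "radon (mix t \<mu> \<sigma>)"
  unfolding mix_def by (intro radon_comb_measure \<mu> \<sigma> radon_null_measure) (use t in simp_all)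

lemma nn_integral_mix:
  assumes h: "h \<in> borel_measurable borel"
  shows "(\<integral>\<^sup>+x. h x \<partial>mix t \<mu> \<sigma>) = ennreal (1 - t) * (\<integral>\<^sup>+x. h x \<partial>\<mu>) + ennreal t * (\<integral>\<^sup>+x. h x \<partial>\<sigma>)"
proof -
  have "h \<in> borel_measurable \<mu>" "h \<in> borel_measurable \<sigma>"
    using h by (simp_all add: radon_sets[OF \<mu>] radon_sets[OF \<sigma>] cong: measurable_cong_sets)
  then show ?thesis unfolding mix_def
    by (simp add: nn_integral_comb_measure radon_sets[OF \<mu>] radon_sets[OF \<sigma>])
qed

lemma integral_mix:
  fixes h :: "'a \<Rightarrow> real"
  assumes h: "integrable \<mu> h" "integrable \<sigma> h"
  shows "integrable (mix t \<mu> \<sigma>) h"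
    and "(\<integral>x. h x \<partial>mix t \<mu> \<sigma>) = (1 - t) * (\<integral>x. h x \<partial>\<mu>) + t * (\<integral>x. h x \<partial>\<sigma>)"
proof -
  have hb: "h \<in> borel_measurable borel"
    using borel_measurable_integrable[OF h(1)] by (simp add: radon_sets[OF \<mu>] cong: measurable_cong_sets)
  have n: "integrable (null_measure borel) h"
    using hb by (simp add: integrable_iff_bounded)
  have n0: "(\<integral>x. h x \<partial>null_measure borel) = 0"
    by (rule integral_eq_zero_AE, rule AE_I[of _ _ UNIV]) auto
  have s1: "sets (null_measure borel) = sets \<sigma>" by (simp add: radon_sets[OF \<sigma>])
  have s2: "sets (comb_measure t \<sigma> (null_measure borel)) = sets \<mu>" by (simp add: radon_sets[OF \<sigma>] radon_sets[OF \<mu>])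
  have t0: "0 \<le> t" "0 \<le> 1 - t" using t by simp_all
  note c1 = integral_comb_measure[OF s1 t0(1) h(2) n]
  note c2 = integral_comb_measure[OF s2 t0(2) h(1) c1(1)]
  show "integrable (mix t \<mu> \<sigma>) h" unfolding mix_def by (rule c2(1))
  show "(\<integral>x. h x \<partial>mix t \<mu> \<sigma>) = (1 - t) * (\<integral>x. h x \<partial>\<mu>) + t * (\<integral>x. h x \<partial>\<sigma>)"
    unfolding mix_def c2(2) c1(2) n0 by simp
qed

lemma AE_mix:
  assumes "AE x in \<mu>. P x" "AE x in \<sigma>. P x"
  shows "AE x in mix t \<mu> \<sigma>. P x"
proof -
  have s1: "sets (null_measure borel) = sets \<sigma>" by (simp add: radon_sets[OF \<sigma>])
  have s2: "sets (comb_measure t \<sigma> (null_measure borel)) = sets \<mu>" by (simp add: radon_sets[OF \<sigma>] radon_sets[OF \<mu>])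
  have "AE x in null_measure borel. P x"
    by (rule AE_I[of _ _ UNIV]) auto
  then show ?thesis unfolding mix_def
    by (intro AE_comb_measure[OF s2] AE_comb_measure[OF s1] assms)
qed

lemma pintegral_mix:
  assumes u: "pintegral \<mu> u = Some (ereal p)" "pintegral \<sigma> u = Some (ereal q)"
  shows "pintegral (mix t \<mu> \<sigma>) u = Some (ereal ((1 - t) * p + t * q))"
proof -
  have m: "(\<lambda>x. val (u x)) \<in> borel_measurable \<mu>"
    and ae: "AE x in \<mu>. u x = Some (ereal (rval (u x)))" "AE x in \<sigma>. u x = Some (ereal (rval (u x)))"
    and i: "integrable \<mu> (\<lambda>x. rval (u x))" "integrable \<sigma> (\<lambda>x. rval (u x))"
    and pq: "p = (\<integral>x. rval (u x) \<partial>\<mu>)" "q = (\<integral>x. rval (u x) \<partial>\<sigma>)"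
    using u unfolding pintegral_eq_real_iff by blast+
  have m': "(\<lambda>x. val (u x)) \<in> borel_measurable (mix t \<mu> \<sigma>)"
    using m by (simp add: radon_sets[OF \<mu>] sets_mix cong: measurable_cong_sets)
  show ?thesis
    unfolding pintegral_eq_real_iff pq by (intro conjI m' AE_mix ae integral_mix i integral_mix(2)[symmetric])
qed

lemma J_mix_left: "radon \<nu> \<Longrightarrow> J (mix t \<mu> \<sigma>) \<nu> = ennreal (1 - t) * J \<mu> \<nu> + ennreal t * J \<sigma> \<nu>"
  unfolding J_def by (rule nn_integral_mix[OF U_measurable])

lemma J_mix_right:
  assumes \<nu>: "radon \<nu>"
  shows "J \<nu> (mix t \<mu> \<sigma>) = ennreal (1 - t) * J \<nu> \<mu> + ennreal t * J \<nu> \<sigma>"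
proof -
  have [measurable]: "U \<mu> \<in> borel_measurable \<nu>" "U \<sigma> \<in> borel_measurable \<nu>"
    using U_measurable[OF \<mu>] U_measurable[OF \<sigma>] by (simp_all add: radon_sets[OF \<nu>] cong: measurable_cong_sets)
  have "U (mix t \<mu> \<sigma>) = (\<lambda>x. ennreal (1 - t) * U \<mu> x + ennreal t * U \<sigma> x)"
    unfolding U_def by (intro ext nn_integral_mix) simp
  then show ?thesis unfolding J_def by (simp add: nn_integral_add nn_integral_cmult)
qed

lemma c_mass_mix: "c * mass (mix t \<mu> \<sigma>) = (1 - t) * (c * mass \<mu>) + t * (c * mass \<sigma>)"
proof (cases "c = 0")
  case False
  have f: "emeasure \<mu> UNIV \<noteq> top" "emeasure \<sigma> UNIV \<noteq> top"
    using radon_finite[OF \<mu> False] radon_finite[OF \<sigma> False] by simp_all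
  have "emeasure (mix t \<mu> \<sigma>) UNIV = ennreal (1 - t) * emeasure \<mu> UNIV + ennreal t * emeasure \<sigma> UNIV"
    using nn_integral_mix[of "indicator UNIV"] by (simp add: sets_mix radon_sets[OF \<mu>] radon_sets[OF \<sigma>]
        radon_space[OF radon_mix] radon_space[OF \<mu>] radon_space[OF \<sigma>])
  also have "\<dots> = ennreal ((1 - t) * mass \<mu> + t * mass \<sigma>)"
    using t f by (simp add: emeasure_eq_ennreal_measure ennreal_mult ennreal_plus)
  finally have "mass (mix t \<mu> \<sigma>) = (1 - t) * mass \<mu> + t * mass \<sigma>"
    using t by (intro measure_eq_emeasure_eq_ennreal) simp_all
  then have "c * mass (mix t \<mu> \<sigma>) = c * ((1 - t) * mass \<mu> + t * mass \<sigma>)" by (simp only:)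
  then show ?thesis by (simp only: distrib_left mult.left_commute)
qed simp

lemma E_mix_left:
  assumes "radon \<nu>" "J \<mu> \<nu> < \<infinity>" "J \<sigma> \<nu> < \<infinity>"
  shows "J (mix t \<mu> \<sigma>) \<nu> < \<infinity>" "E (mix t \<mu> \<sigma>) \<nu> = (1 - t) * E \<mu> \<nu> + t * E \<sigma> \<nu>"
proof -
  obtain p q where p: "0 \<le> p" "J \<mu> \<nu> = ennreal p" and q: "0 \<le> q" "J \<sigma> \<nu> = ennreal q"
    using assms(2,3) by (cases "J \<mu> \<nu>"; cases "J \<sigma> \<nu>") auto
  have e: "J (mix t \<mu> \<sigma>) \<nu> = ennreal ((1 - t) * p + t * q)"
    using J_mix_left[OF assms(1)] p q t by (simp add: ennreal_mult ennreal_plus)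
  then show "J (mix t \<mu> \<sigma>) \<nu> < \<infinity>" by simp
  have er: "enn2real (J (mix t \<mu> \<sigma>) \<nu>) = (1 - t) * p + t * q"
    unfolding e using p(1) q(1) t by (intro enn2real_ennreal) simp
  have "c * mass (mix t \<mu> \<sigma>) * mass \<nu> = (1 - t) * (c * mass \<mu> * mass \<nu>) + t * (c * mass \<sigma> * mass \<nu>)"
    unfolding c_mass_mix by (simp add: algebra_simps)
  then show "E (mix t \<mu> \<sigma>) \<nu> = (1 - t) * E \<mu> \<nu> + t * E \<sigma> \<nu>"
    unfolding E_def er using p q by (simp add: algebra_simps)
qed

lemma E_mix_right:
  assumes "radon \<nu>" "J \<nu> \<mu> < \<infinity>" "J \<nu> \<sigma> < \<infinity>"
  shows "J \<nu> (mix t \<mu> \<sigma>) < \<infinity>" "E \<nu> (mix t \<mu> \<sigma>) = (1 - t) * E \<nu> \<mu> + t * E \<nu> \<sigma>"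
proof -
  obtain p q where p: "0 \<le> p" "J \<nu> \<mu> = ennreal p" and q: "0 \<le> q" "J \<nu> \<sigma> = ennreal q"
    using assms(2,3) by (cases "J \<nu> \<mu>"; cases "J \<nu> \<sigma>") auto
  have e: "J \<nu> (mix t \<mu> \<sigma>) = ennreal ((1 - t) * p + t * q)"
    using J_mix_right[OF assms(1)] p q t by (simp add: ennreal_mult ennreal_plus)
  then show "J \<nu> (mix t \<mu> \<sigma>) < \<infinity>" by simp
  have er: "enn2real (J \<nu> (mix t \<mu> \<sigma>)) = (1 - t) * p + t * q"
    unfolding e using p(1) q(1) t by (intro enn2real_ennreal) simp
  have "c * mass \<nu> * mass (mix t \<mu> \<sigma>) = mass \<nu> * (c * mass (mix t \<mu> \<sigma>))" by (simp add: ac_simps)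
  also have "\<dots> = (1 - t) * (c * mass \<nu> * mass \<mu>) + t * (c * mass \<nu> * mass \<sigma>)"
    unfolding c_mass_mix by (simp add: algebra_simps)
  finally show "E \<nu> (mix t \<mu> \<sigma>) = (1 - t) * E \<nu> \<mu> + t * E \<nu> \<sigma>"
    unfolding E_def er using p q by (simp add: algebra_simps)
qed

end

end

section \<open>The potential of an equilibrium measure\<close>

lemma isign_square: "isign Ipos i * isign Ipos i = 1" and isign_abs: "\<bar>isign Ipos i\<bar> = 1"
  by (simp_all add: isign_def)

lemma isign_mult_energy_real:
  assumes "ereal (isign P i * isign P j) * v = ereal r"
  shows "v \<noteq> \<infinity>" "v \<noteq> - \<infinity>"
  using assms by (auto simp: isign_def split: if_splits)

locale gauss = pd_kernel \<kappa> c
  for \<kappa> :: "'a::t2_space \<times> 'a \<Rightarrow> ereal" and c :: real +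
  fixes Ipos Ineg :: "nat set" and A :: "nat \<Rightarrow> 'a set" and f :: "nat \<Rightarrow> 'a \<Rightarrow> ereal option"
    and a :: "nat \<Rightarrow> real" and g :: "nat \<Rightarrow> 'a \<Rightarrow> real" and lam :: "nat \<Rightarrow> 'a measure"
  assumes cond: "condenser Ipos Ineg A"
    and ext_field: "external_field \<kappa> (Ipos \<union> Ineg) f"
    and a_pos: "\<And>i. i \<in> Ipos \<union> Ineg \<Longrightarrow> 0 < a i"
    and g_cont: "\<And>i. i \<in> Ipos \<union> Ineg \<Longrightarrow> continuous_on (A i) (g i)"
    and g_pos: "\<And>i x. i \<in> Ipos \<union> Ineg \<Longrightarrow> x \<in> A i \<Longrightarrow> 0 < g i x"
    and equil: "lam \<in> equilibrium_measures \<kappa> Ipos Ineg f A a g"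
begin

abbreviation I :: "nat set" where "I \<equiv> Ipos \<union> Ineg"
abbreviation sg :: "nat \<Rightarrow> real" where "sg \<equiv> isign Ipos"
abbreviation pot :: "nat \<Rightarrow> 'a \<Rightarrow> ereal option" where "pot \<equiv> vpotential \<kappa> Ipos Ineg lam"
abbreviation Wlam :: "nat \<Rightarrow> 'a \<Rightarrow> ereal option" where "Wlam \<equiv> W \<kappa> Ipos Ineg f lam"
abbreviation Winf :: "nat \<Rightarrow> ereal" where "Winf \<equiv> weighted_W_inf \<kappa> Ipos Ineg f A a g lam"

lemma A_closed: "i \<in> I \<Longrightarrow> closed (A i)" and A_nonempty: "i \<in> I \<Longrightarrow> A i \<noteq> {}"
    and A_locally_finite: "compact K \<Longrightarrow> finite {i\<in>I. A i \<inter> K \<noteq> {}}"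
proof -
  note c = cond[unfolded condenser_def, THEN conjunct2]
  show "closed (A i)" if "i \<in> I" using bspec[OF c[THEN conjunct1] that] by (rule conjunct1)
  show "A i \<noteq> {}" if "i \<in> I" using bspec[OF c[THEN conjunct1] that] by (rule conjunct2)
  show "finite {i\<in>I. A i \<inter> K \<noteq> {}}" if "compact K" using c[THEN conjunct2, THEN conjunct1] that by simp
qed

lemma lam_admissible: "lam \<in> admissible \<kappa> Ipos Ineg f A a g"
  using equil unfolding equilibrium_measures_def by simp

lemma lam_Mplus: "i \<in> I \<Longrightarrow> lam i \<in> Mplus (A i)"
  using lam_admissible unfolding admissible_def venergy_finite_def vmeasures_def
  by (elim CollectE conjE) (rule Pi_mem)

lemma lam_radon: "i \<in> I \<Longrightarrow> radon (lam i)"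
  by (drule lam_Mplus) (simp add: Mplus_def)

text \<open>
  The partial function in the constraint \<open>\<langle>g\<^sub>i, \<mu>\<^sup>i\<rangle> = a\<^sub>i\<close>; \<open>gval\<close> extends it by zero.
\<close>

definition gopt :: "nat \<Rightarrow> 'a \<Rightarrow> ereal option" where
  "gopt i x = (if x \<in> A i then Some (ereal (g i x)) else None)"

definition gval :: "nat \<Rightarrow> 'a \<Rightarrow> real" where
  "gval i x = (if x \<in> A i then g i x else 0)"

lemma val_gopt: "val (gopt i x) = ereal (gval i x)"
  by (simp_all add: gopt_def gval_def zero_ereal_def)

lemma gval_measurable: "i \<in> I \<Longrightarrow> gval i \<in> borel_measurable borel"
proof -
  assume i: "i \<in> I"
  have "(\<lambda>x. indicator (A i) x *\<^sub>R g i x) \<in> borel_measurable borel"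
    using A_closed[OF i] g_cont[OF i] by (intro borel_measurable_continuous_on_indicator) auto
  moreover have "(\<lambda>x. indicator (A i) x *\<^sub>R g i x) = gval i"
    by (auto simp: gval_def indicator_def)
  ultimately show ?thesis by simp
qed

lemma lam_gopt: "i \<in> I \<Longrightarrow> pintegral (lam i) (gopt i) = Some (ereal (a i))"
  unfolding gopt_def[abs_def] using lam_admissible[unfolded admissible_def mem_Collect_eq] by (elim conjE) (rule bspec)

lemma gopt_pintegralD:
  assumes i: "i \<in> I" and p: "pintegral \<nu> (gopt i) = Some (ereal r)"
  shows "integrable \<nu> (gval i)" "(\<integral>x. gval i x \<partial>\<nu>) = r" "AE x in \<nu>. x \<in> A i"
proof -
  note * = p[unfolded pintegral_eq_real_iff val_gopt real_of_ereal.simps]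
  show "integrable \<nu> (gval i)" using * by (elim conjE) assumption
  show "(\<integral>x. gval i x \<partial>\<nu>) = r" using * by (elim conjE) (rule sym)
  have ae: "AE x in \<nu>. gopt i x = Some (ereal (gval i x))" using * by (elim conjE)
  show "AE x in \<nu>. x \<in> A i" using ae by eventually_elim (auto simp: gopt_def split: if_splits)
qed

lemma sigma_finite_of_gopt:
  assumes "i \<in> I" "radon \<nu>" "pintegral \<nu> (gopt i) = Some (ereal r)"
  shows "sigma_finite_measure \<nu>"
proof (rule integrable_pos_sigma_finite[OF radon_sets[OF assms(2)] gopt_pintegralD(1)[OF assms(1,3)]])
  show "AE x in \<nu>. 0 < gval i x"
    using gopt_pintegralD(3)[OF assms(1,3)] by eventually_elim (simp add: gval_def g_pos[OF assms(1)])
qed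

lemma lam_sigma_finite: "i \<in> I \<Longrightarrow> sigma_finite_measure (lam i)"
  by (rule sigma_finite_of_gopt[OF _ lam_radon lam_gopt])

definition Q :: real where
  "Q = (\<Sum>\<^sub>\<infinity>(i, j)\<in>I \<times> I. sg i * sg j * E (lam i) (lam j))"

lemma lam_energy:
  shows J_lam_finite: "\<And>i j. i \<in> I \<Longrightarrow> j \<in> I \<Longrightarrow> J (lam i) (lam j) < \<infinity>"
    and Q_has_sum: "((\<lambda>(i, j). sg i * sg j * E (lam i) (lam j)) has_sum Q) (I \<times> I)"
    and venergy_lam: "venergy \<kappa> Ipos Ineg lam lam = Some (ereal Q)"
proof -
  obtain r where r: "venergy \<kappa> Ipos Ineg lam lam = Some (ereal r)"
    using lam_admissible unfolding admissible_def venergy_finite_def is_finite_def by blast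
  then obtain h where h: "\<forall>p\<in>I \<times> I. (\<lambda>(i, j). Some (ereal (sg i * sg j) * energy \<kappa> (lam i) (lam j))) p = Some (ereal (h p))"
      and hs: "(h has_sum r) (I \<times> I)"
    unfolding venergy_def psum_eq_real_iff by blast
  have h1: "ereal (sg i * sg j) * energy \<kappa> (lam i) (lam j) = ereal (h (i, j))" if "i \<in> I" "j \<in> I" for i j
    using h that by fastforce
  show J: "J (lam i) (lam j) < \<infinity>" if ij: "i \<in> I" "j \<in> I" for i j
  proof -
    have "energy \<kappa> (lam i) (lam j) < \<infinity>"
      using isign_mult_energy_real(1)[OF h1[OF ij]] by simp
    then show ?thesis using energy_finite_iff[OF lam_radon[OF ij(1)] lam_radon[OF ij(2)]] by blast
  qed
  have "h p = (\<lambda>(i, j). sg i * sg j * E (lam i) (lam j)) p" if p: "p \<in> I \<times> I" for p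
  proof -
    obtain i j where ij: "p = (i, j)" "i \<in> I" "j \<in> I" using p by blast
    show ?thesis using h1[OF ij(2,3)] energy_eq_E[OF lam_radon[OF ij(2)] lam_radon[OF ij(3)] J[OF ij(2,3)]] ij(1) by simp
  qed
  then have s: "((\<lambda>(i, j). sg i * sg j * E (lam i) (lam j)) has_sum r) (I \<times> I)"
    using hs has_sum_cong[of "I \<times> I" h "\<lambda>(i, j). sg i * sg j * E (lam i) (lam j)" r] by blast
  then have "Q = r" unfolding Q_def by (rule infsumI)
  then show "((\<lambda>(i, j). sg i * sg j * E (lam i) (lam j)) has_sum Q) (I \<times> I)" "venergy \<kappa> Ipos Ineg lam lam = Some (ereal Q)"
    using s r by simp_all
qed

definition F :: "nat \<Rightarrow> real" where
  "F j = rval (pintegral (lam j) (f j))"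

definition Ftot :: real where
  "Ftot = (\<Sum>\<^sub>\<infinity>j\<in>I. F j)"

lemma lam_field:
  shows F_pintegral: "\<And>j. j \<in> I \<Longrightarrow> pintegral (lam j) (f j) = Some (ereal (F j))"
    and F_has_sum: "(F has_sum Ftot) I"
    and field_pairing_lam: "field_pairing I f lam = Some (ereal Ftot)"
proof -
  obtain r where r: "field_pairing I f lam = Some (ereal r)"
    using lam_admissible unfolding admissible_def is_finite_def by blast
  then obtain h where h: "\<forall>j\<in>I. pintegral (lam j) (f j) = Some (ereal (h j))" and hs: "(h has_sum r) I"
    unfolding field_pairing_def psum_eq_real_iff by blast
  have Fh: "F j = h j" if "j \<in> I" for j using h that by (simp add: F_def)
  then show "pintegral (lam j) (f j) = Some (ereal (F j))" if "j \<in> I" for j using h that by simp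
  have s: "(F has_sum r) I" using hs has_sum_cong[of I F h r] Fh by blast
  then have "Ftot = r" unfolding Ftot_def by (rule infsumI)
  then show "(F has_sum Ftot) I" "field_pairing I f lam = Some (ereal Ftot)" using s r by simp_all
qed

lemma c_alt_I: "c = 0 \<or> finite I"
proof (cases "c = 0")
  case False
  then have "finite {i\<in>I. A i \<inter> UNIV \<noteq> {}}"
    using c_alt by (intro A_locally_finite) simp
  moreover have "{i\<in>I. A i \<inter> UNIV \<noteq> {}} = I"
    using A_nonempty by auto
  ultimately show ?thesis by simp
qed simp

lemma c_mass_summable: "(\<lambda>j. c * mass (lam j) * s) summable_on I"
  using c_alt_I by (cases "c = 0") auto

lemma c_mass_summable2: "(\<lambda>(i, j). c * mass (lam i) * mass (lam j)) summable_on I \<times> I"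
  using c_alt_I by (cases "c = 0") (auto simp: case_prod_unfold)

lemma J_lam_summable: "(\<lambda>(i, j). enn2real (J (lam i) (lam j))) summable_on I \<times> I"
proof -
  let ?e = "\<lambda>(i, j). sg i * sg j * E (lam i) (lam j)"
  have "(\<lambda>p. \<bar>?e p\<bar>) summable_on I \<times> I"
    using has_sum_imp_summable[OF Q_has_sum] summable_on_iff_abs_summable_on_real[of ?e] by simp
  then have s: "(\<lambda>p. \<bar>?e p\<bar> + (\<lambda>(i, j). c * mass (lam i) * mass (lam j)) p) summable_on I \<times> I"
    by (rule summable_on_add[OF _ c_mass_summable2])
  show ?thesis
  proof (rule summable_on_comparison_test[OF s])
    fix p assume "p \<in> I \<times> I"
    obtain i j where p: "p = (i, j)" by (cases p)
    show "(\<lambda>(i, j). enn2real (J (lam i) (lam j))) p \<le> \<bar>?e p\<bar> + (\<lambda>(i, j). c * mass (lam i) * mass (lam j)) p"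
      unfolding p by (simp add: abs_mult isign_abs E_def)
  qed (auto simp: case_prod_unfold)
qed

lemma J_lam_finite_sum_le:
  assumes "finite F0" "F0 \<subseteq> I"
  shows "(\<Sum>i\<in>F0. \<Sum>j\<in>F0. J (lam i) (lam j)) \<le> ennreal (\<Sum>\<^sub>\<infinity>(i, j)\<in>I \<times> I. enn2real (J (lam i) (lam j)))"
proof -
  have "(\<Sum>i\<in>F0. \<Sum>j\<in>F0. J (lam i) (lam j)) = (\<Sum>p\<in>F0 \<times> F0. J (lam (fst p)) (lam (snd p)))"
    by (simp add: sum.cartesian_product case_prod_unfold)
  also have "\<dots> = (\<Sum>p\<in>F0 \<times> F0. ennreal (enn2real (J (lam (fst p)) (lam (snd p)))))"
    using J_lam_finite assms(2) by (intro sum.cong refl) (auto simp: subset_iff)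
  also have "\<dots> = ennreal (\<Sum>p\<in>F0 \<times> F0. enn2real (J (lam (fst p)) (lam (snd p))))"
    by (rule sum_ennreal) simp
  also have "\<dots> \<le> ennreal (\<Sum>\<^sub>\<infinity>(i, j)\<in>I \<times> I. enn2real (J (lam i) (lam j)))"
  proof (rule ennreal_leI, unfold case_prod_unfold, rule finite_sum_le_infsum)
    show "(\<lambda>p. enn2real (J (lam (fst p)) (lam (snd p)))) summable_on I \<times> I"
      using J_lam_summable by (simp only: case_prod_unfold)
  qed (use assms in auto)
  finally show ?thesis .
qed

text \<open>
  The measures \<open>\<nu>\<close> that can be integrated against the potential of \<open>lam\<close> term by term.
\<close>

definition lam_finite :: "'a measure \<Rightarrow> bool" where
  "lam_finite \<nu> \<longleftrightarrow> radon \<nu> \<and> (\<forall>j\<in>I. J \<nu> (lam j) < \<infinity>) \<and> (\<lambda>j. enn2real (J \<nu> (lam j))) summable_on I"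

lemma lam_finite_lam:
  assumes i: "i \<in> I" shows "lam_finite (lam i)"
proof -
  have "(\<lambda>(i, j). enn2real (J (lam i) (lam j))) summable_on Pair i ` I"
    using i by (intro summable_on_subset_banach[OF J_lam_summable]) auto
  then have "(\<lambda>j. enn2real (J (lam i) (lam j))) summable_on I"
    by (subst (asm) summable_on_reindex) (auto simp: inj_on_def o_def)
  then show ?thesis unfolding lam_finite_def using lam_radon[OF i] J_lam_finite[OF i] by blast
qed

text \<open>
  The mutual energies of \<open>\<nu>\<close> with finitely many components of \<open>lam\<close> are bounded by half the sum of
  the energy of \<open>\<nu>\<close> and all mutual energies of the components, taken for the shifted kernel. So
  their sum over all components is finite.
\<close>

lemma lam_finite_of_finite_energy:
  assumes \<nu>: "radon \<nu>" "emeasure \<nu> UNIV < \<infinity>" "J \<nu> \<nu> < \<infinity>"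
  shows "lam_finite \<nu>"
proof -
  let ?B = "ennreal (\<Sum>\<^sub>\<infinity>(i, j)\<in>I \<times> I. enn2real (J (lam i) (lam j)))"
  have le: "2 * (\<Sum>j\<in>F0. J \<nu> (lam j)) \<le> J \<nu> \<nu> + ?B" if F0: "finite F0" "F0 \<subseteq> I" for F0
    using F0(2) by (intro sum_mutual_energy_le[OF \<nu> F0(1)] J_lam_finite_sum_le F0 lam_radon lam_sigma_finite) auto
  have "J \<nu> \<nu> + ?B < \<infinity>" using \<nu>(3) by simp
  then obtain b where b: "0 \<le> b" "J \<nu> \<nu> + ?B = ennreal b" by (cases "J \<nu> \<nu> + ?B") auto
  have le1: "(\<Sum>j\<in>F0. J \<nu> (lam j)) \<le> ennreal b" if F0: "finite F0" "F0 \<subseteq> I" for F0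
  proof -
    have "(\<Sum>j\<in>F0. J \<nu> (lam j)) \<le> 2 * (\<Sum>j\<in>F0. J \<nu> (lam j))"
      by (simp add: mult_2)
    then show ?thesis using le[OF F0] b(2) by simp
  qed
  have fin: "J \<nu> (lam j) < \<infinity>" if "j \<in> I" for j
    using le1[of "{j}"] that by (auto intro: le_less_trans)
  have "(\<lambda>j. enn2real (J \<nu> (lam j))) summable_on I"
  proof (rule nonneg_bdd_above_summable_on)
    show "bdd_above (sum (\<lambda>j. enn2real (J \<nu> (lam j))) ` {F. F \<subseteq> I \<and> finite F})"
    proof (rule bdd_aboveI2)
      fix F0 assume "F0 \<in> {F. F \<subseteq> I \<and> finite F}"
      then have F0: "finite F0" "F0 \<subseteq> I" by auto
      have "ennreal (\<Sum>j\<in>F0. enn2real (J \<nu> (lam j))) = (\<Sum>j\<in>F0. ennreal (enn2real (J \<nu> (lam j))))"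
        by (rule sum_ennreal[symmetric]) simp
      also have "\<dots> = (\<Sum>j\<in>F0. J \<nu> (lam j))"
        using fin F0(2) by (intro sum.cong refl) (auto simp: subset_iff)
      also have "\<dots> \<le> ennreal b" by (rule le1[OF F0])
      finally show "(\<Sum>j\<in>F0. enn2real (J \<nu> (lam j))) \<le> b" using b(1) by (simp add: ennreal_le_iff)
    qed
  qed simp
  then show ?thesis unfolding lam_finite_def using \<nu>(1) fin by blast
qed

text \<open>
  The series that defines the potential converges absolutely in the mean with respect to \<open>\<nu>\<close>, hence
  almost everywhere, and may be integrated term by term.
\<close>

lemma lam_finite_potential:
  assumes \<nu>: "lam_finite \<nu>" and i: "i \<in> I"
  obtains H where "integrable \<nu> H" "AE x in \<nu>. pot i x = Some (ereal (H x))"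
    "((\<lambda>j. sg i * sg j * E \<nu> (lam j)) has_sum (\<integral>x. H x \<partial>\<nu>)) I"
proof -
  have r: "radon \<nu>" and Jf: "\<And>j. j \<in> I \<Longrightarrow> J \<nu> (lam j) < \<infinity>"
    and Js: "(\<lambda>j. enn2real (J \<nu> (lam j))) summable_on I" using \<nu> unfolding lam_finite_def by blast+
  define h where "h j x = sg i * sg j * (enn2real (U (lam j) x) - c * mass (lam j))" for j x
  have Um: "U (lam j) \<in> borel_measurable \<nu>" if "j \<in> I" for j
    using U_measurable[OF lam_radon[OF that]] by (simp add: radon_sets[OF r] cong: measurable_cong_sets)
  have Uae: "AE x in \<nu>. U (lam j) x \<noteq> \<infinity>" if "j \<in> I" for j
    using Jf[OF that] by (intro nn_integral_noteq_infinite Um that) (auto simp: J_def)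
  have nnU: "(\<integral>\<^sup>+x. ennreal (enn2real (U (lam j) x)) \<partial>\<nu>) = J \<nu> (lam j)" if "j \<in> I" for j
    unfolding J_def using Uae[OF that] by (intro nn_integral_cong_AE, eventually_elim) (simp add: less_top)
  have intU: "integrable \<nu> (\<lambda>x. enn2real (U (lam j) x))" if "j \<in> I" for j
    using Um[OF that] nnU[OF that] Jf[OF that] by (intro integrableI_nonneg) auto
  have intUv: "(\<integral>x. enn2real (U (lam j) x) \<partial>\<nu>) = enn2real (J \<nu> (lam j))" if "j \<in> I" for j
    using nnU[OF that] Um[OF that] by (subst integral_eq_nn_integral) auto
  have intc: "integrable \<nu> (\<lambda>x. c * s)" for s
  proof (cases "c = 0")
    case False
    then have "finite_measure \<nu>"
      using radon_finite[OF r] radon_space[OF r] by (intro finite_measureI) (simp add: less_top[symmetric])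
    then show ?thesis by (rule finite_measure.integrable_const)
  qed simp
  have intcv: "(\<integral>x. c * s \<partial>\<nu>) = c * mass \<nu> * s" for s
    using radon_space[OF r] by simp
  have inth: "integrable \<nu> (h j)" if "j \<in> I" for j
    unfolding h_def[abs_def] by (intro integrable_mult_right Bochner_Integration.integrable_diff intU intc that)
  have inthv: "(\<integral>x. h j x \<partial>\<nu>) = sg i * sg j * E \<nu> (lam j)" if "j \<in> I" for j
    unfolding h_def using Bochner_Integration.integral_diff[OF intU[OF that] intc] intUv[OF that] intcv
    by (simp add: E_def)
  have hs: "(\<lambda>j. \<integral>x. \<bar>h j x\<bar> \<partial>\<nu>) summable_on I"
  proof (rule summable_on_comparison_test[OF summable_on_add[OF Js c_mass_summable[of "mass \<nu>"]]])
    fix j assume j: "j \<in> I"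
    have "(\<integral>x. \<bar>h j x\<bar> \<partial>\<nu>) \<le> (\<integral>x. enn2real (U (lam j) x) + c * mass (lam j) \<partial>\<nu>)"
    proof (rule integral_mono)
      show "integrable \<nu> (\<lambda>x. \<bar>h j x\<bar>)" by (rule integrable_abs[OF inth[OF j]])
      show "integrable \<nu> (\<lambda>x. enn2real (U (lam j) x) + c * mass (lam j))"
        by (intro Bochner_Integration.integrable_add intU intc j)
      fix x
      have "\<bar>h j x\<bar> = \<bar>enn2real (U (lam j) x) - c * mass (lam j)\<bar>"
        by (simp add: h_def abs_mult isign_abs)
      also have "\<dots> \<le> enn2real (U (lam j) x) + c * mass (lam j)" using c_nonneg by (simp add: abs_le_iff)
      finally show "\<bar>h j x\<bar> \<le> enn2real (U (lam j) x) + c * mass (lam j)" .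
    qed
    also have "\<dots> = enn2real (J \<nu> (lam j)) + c * mass (lam j) * mass \<nu>"
      unfolding Bochner_Integration.integral_add[OF intU[OF j] intc] intUv[OF j] intcv by (simp add: ac_simps)
    finally show "(\<integral>x. \<bar>h j x\<bar> \<partial>\<nu>) \<le> enn2real (J \<nu> (lam j)) + c * mass (lam j) * mass \<nu>" .
  qed simp
  obtain H where H: "integrable \<nu> H" "AE x in \<nu>. ((\<lambda>j. h j x) has_sum H x) I"
      "((\<lambda>j. \<integral>x. h j x \<partial>\<nu>) has_sum (\<integral>x. H x \<partial>\<nu>)) I"
    by (rule has_sum_integral_swap[where h = h and I = I and M = \<nu>])
      (rule inth, assumption, rule hs, rule that, assumption+)
  have "AE x in \<nu>. \<forall>j\<in>I. U (lam j) x \<noteq> \<infinity>"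
    by (rule AE_ball_countable') (use Uae in auto)
  with H(2) have "AE x in \<nu>. pot i x = Some (ereal (H x))"
  proof eventually_elim
    case (elim x)
    show ?case unfolding vpotential_def psum_eq_real_iff
    proof (intro exI[of _ "\<lambda>j. h j x"] conjI ballI elim(1))
      fix j assume j: "j \<in> I"
      then obtain u where u: "0 \<le> u" "U (lam j) x = ennreal u"
        using elim(2) by (cases "U (lam j) x") auto
      show "map_option (\<lambda>v. ereal (sg i * sg j) * v) (potential \<kappa> (lam j) x) = Some (ereal (h j x))"
        unfolding potential_eq[OF lam_radon[OF j]] h_def using u by (simp add: enn2ereal_ennreal)
    qed
  qed
  moreover have "((\<lambda>j. sg i * sg j * E \<nu> (lam j)) has_sum (\<integral>x. H x \<partial>\<nu>)) I"
    using H(3) has_sum_cong[of I "\<lambda>j. \<integral>x. h j x \<partial>\<nu>" "\<lambda>j. sg i * sg j * E \<nu> (lam j)"] inthv by blast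
  ultimately show ?thesis using that H(1) by blast
qed

end

section \<open>The first variation of the Gauss functional\<close>

text \<open>
  For \<open>L < 0\<close> and \<open>t \<le> -L / (\<bar>R\<bar> + 1)\<close> the linear term would dominate.
\<close>

lemma nonneg_of_small_perturbation:
  fixes L R :: real
  assumes "\<And>t. 0 < t \<Longrightarrow> t < 1 \<Longrightarrow> 0 \<le> 2 * t * L + t\<^sup>2 * R"
  shows "0 \<le> L"
proof (rule ccontr)
  assume L: "\<not> 0 \<le> L"
  define t where "t = min (1/2) (- L / (\<bar>R\<bar> + 1))"
  have t: "0 < t" "t < 1" using L by (auto simp: t_def intro!: divide_neg_pos)
  have "t * R \<le> t * \<bar>R\<bar>" using t by (intro mult_left_mono) auto
  also have "\<dots> \<le> (- L / (\<bar>R\<bar> + 1)) * \<bar>R\<bar>" by (intro mult_right_mono) (auto simp: t_def)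
  also have "\<dots> = - L * (\<bar>R\<bar> / (\<bar>R\<bar> + 1))" by simp
  also have "\<dots> \<le> - L * 1" using L by (intro mult_left_mono) simp_all
  finally have "2 * L + t * R < 0" using L by linarith
  then have "t * (2 * L + t * R) < 0" using t by (simp add: mult_pos_neg)
  moreover have "t * (2 * L + t * R) = 2 * t * L + t\<^sup>2 * R" by (simp add: power2_eq_square algebra_simps)
  ultimately show False using assms[OF t] by linarith
qed

context gauss
begin

lemma field_parts:
  assumes i: "i \<in> I"
  obtains f1 f2 where "f1 \<in> Phi" "f2 \<in> Phi" "int_capacity \<kappa> {x. f2 x = \<infinity>} = 0"
    "\<And>x. f i x = ext_add (f1 x) (- f2 x)"
proof -
  have "\<exists>f1\<in>Phi. \<exists>f2\<in>Phi. nearly_everywhere \<kappa> UNIV (\<lambda>x. f2 x \<noteq> \<infinity>) \<and> (\<forall>x. f i x = ext_add (f1 x) (- f2 x))"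
    using ext_field[unfolded external_field_def] i by (rule bspec)
  then obtain f1 f2 where "f1 \<in> Phi" "f2 \<in> Phi" "nearly_everywhere \<kappa> UNIV (\<lambda>x. f2 x \<noteq> \<infinity>)"
      "\<forall>x. f i x = ext_add (f1 x) (- f2 x)" by (elim bexE conjE)
  then show ?thesis by (intro that) (simp_all add: nearly_everywhere_def)
qed

lemma field_pmeas:
  assumes i: "i \<in> I"
  shows "pmeas borel (f i)"
proof -
  obtain f1 f2 where f: "f1 \<in> Phi" "f2 \<in> Phi" "\<And>x. f i x = ext_add (f1 x) (- f2 x)"
    by (rule field_parts[OF i]) (rule that, assumption+)
  have [measurable]: "f1 \<in> borel_measurable borel" "f2 \<in> borel_measurable borel"
    using f(1,2) by (simp_all add: Phi_measurable)
  have fe: "f i = (\<lambda>x. ext_add (f1 x) (- f2 x))" using f(3) by (intro ext)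
  show ?thesis unfolding fe by (rule pmeas_ext_add) measurable
qed

text \<open>
  The sums of the positive and of the negative terms are measurable separately.
\<close>

lemma vpotential_pmeas:
  assumes i: "i \<in> I"
  shows "pmeas borel (pot i)"
proof -
  define w where "w j x = (if j \<in> I then ereal (sg i * sg j) * (enn2ereal (U (lam j) x) - ereal (c * mass (lam j))) else 0)" for j x
  have wm [measurable]: "w j \<in> borel_measurable borel" for j
  proof (cases "j \<in> I")
    case True
    have [measurable]: "U (lam j) \<in> borel_measurable borel" by (rule U_measurable[OF lam_radon[OF True]])
    show ?thesis unfolding w_def[abs_def] using True by simp
  qed (simp add: w_def[abs_def])
  have sum_meas: "(\<lambda>x. enn2ereal (\<integral>\<^sup>+j. e2ennreal (u j x) \<partial>count_space I)) \<in> borel_measurable borel"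
    if [measurable]: "\<And>j. u j \<in> borel_measurable borel" for u :: "nat \<Rightarrow> 'a \<Rightarrow> ereal"
  proof -
    have "(\<integral>\<^sup>+j. e2ennreal (u j x) \<partial>count_space I) = (\<Sum>j. e2ennreal (u j x) * indicator I j)" for x
      unfolding nn_integral_count_space_nat[symmetric] by (rule nn_integral_count_space_indicator) simp
    then show ?thesis by simp
  qed
  have "pot i x =
      ext_add (enn2ereal (\<integral>\<^sup>+j. e2ennreal (w j x) \<partial>count_space I)) (- enn2ereal (\<integral>\<^sup>+j. e2ennreal (- w j x) \<partial>count_space I))" for x
  proof -
    let ?u = "\<lambda>j. map_option (\<lambda>v. ereal (sg i * sg j) * v) (potential \<kappa> (lam j) x)"
    have u: "?u j = Some (w j x)" if "j \<in> I" for j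
      using potential_eq[OF lam_radon[OF that]] that by (simp add: w_def)
    have "(AE j in count_space I. ?u j \<noteq> None)"
      unfolding AE_count_space
    proof
      show "?u j \<noteq> None" if "j \<in> I" for j unfolding u[OF that] by simp
    qed
    moreover have "(\<integral>\<^sup>+j. e2ennreal (case ?u j of Some v \<Rightarrow> v | None \<Rightarrow> 0) \<partial>count_space I) = (\<integral>\<^sup>+j. e2ennreal (w j x) \<partial>count_space I)"
      by (rule nn_integral_cong) (simp only: space_count_space u option.case)
    moreover have "(\<integral>\<^sup>+j. e2ennreal (- (case ?u j of Some v \<Rightarrow> v | None \<Rightarrow> 0)) \<partial>count_space I) = (\<integral>\<^sup>+j. e2ennreal (- w j x) \<partial>count_space I)"
      by (rule nn_integral_cong) (simp only: space_count_space u option.case)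
    ultimately show ?thesis unfolding vpotential_def pintegral_def Let_def by simp
  qed
  then have eq: "pot i = (\<lambda>x. ext_add (enn2ereal (\<integral>\<^sup>+j. e2ennreal (w j x) \<partial>count_space I))
      (- enn2ereal (\<integral>\<^sup>+j. e2ennreal (- w j x) \<partial>count_space I)))" by (intro ext)
  have mN: "(\<lambda>x. - w j x) \<in> borel_measurable borel" for j by measurable
  show ?thesis unfolding eq
    by (intro pmeas_ext_add borel_measurable_uminus_ereal sum_meas wm mN)
qed

lemma W_pmeas: "i \<in> I \<Longrightarrow> pmeas borel (Wlam i)"
  unfolding W_def[abs_def] by (intro pmeas_opt_add vpotential_pmeas field_pmeas)

lemma W_pintegral:
  assumes \<nu>: "lam_finite \<nu>" and i: "i \<in> I" and \<phi>: "pintegral \<nu> (f i) = Some (ereal \<phi>)"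
    and p: "((\<lambda>j. sg i * sg j * E \<nu> (lam j)) has_sum p) I"
  shows "pintegral \<nu> (Wlam i) = Some (ereal (p + \<phi>))"
proof -
  have r: "radon \<nu>" using \<nu> by (simp add: lam_finite_def)
  obtain H where H: "integrable \<nu> H" "AE x in \<nu>. pot i x = Some (ereal (H x))"
    "((\<lambda>j. sg i * sg j * E \<nu> (lam j)) has_sum (\<integral>x. H x \<partial>\<nu>)) I"
    by (rule lam_finite_potential[OF \<nu> i]) (rule that, assumption+)
  have pH: "p = (\<integral>x. H x \<partial>\<nu>)" by (rule has_sum_unique[OF p H(3)])
  note F = \<phi>[unfolded pintegral_eq_real_iff]
  have Fi: "integrable \<nu> (\<lambda>x. rval (f i x))" and Fa: "AE x in \<nu>. f i x = Some (ereal (rval (f i x)))"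
    and Fv: "\<phi> = (\<integral>x. rval (f i x) \<partial>\<nu>)"
    by (rule F[THEN conjunct2, THEN conjunct2, THEN conjunct1] F[THEN conjunct2, THEN conjunct1]
        F[THEN conjunct2, THEN conjunct2, THEN conjunct2])+
  have "pintegral \<nu> (Wlam i) = Some (ereal (\<integral>x. H x + rval (f i x) \<partial>\<nu>))"
  proof (rule pintegral_realI)
    show "(\<lambda>x. val (Wlam i x)) \<in> borel_measurable \<nu>"
      using W_pmeas[OF i, folded pmeas_cong_sets[OF radon_sets[OF r]], unfolded pmeas_def] by (rule conjunct1)
    show "integrable \<nu> (\<lambda>x. H x + rval (f i x))" by (rule Bochner_Integration.integrable_add[OF H(1) Fi])
    have add: "opt_add u v = Some (ereal (h + y))" if "u = Some (ereal h)" "v = Some (ereal y)" for u v h y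
      using that by (simp add: opt_add_def ext_add_def)
    show "AE x in \<nu>. Wlam i x = Some (ereal (H x + rval (f i x)))"
      unfolding W_def using H(2) Fa by eventually_elim (rule add)
  qed
  also have "(\<integral>x. H x + rval (f i x) \<partial>\<nu>) = p + \<phi>"
    unfolding pH Fv by (rule Bochner_Integration.integral_add[OF H(1) Fi])
  finally show ?thesis .
qed

text \<open>
  Only the row and the column of index \<open>i\<close> of the energy matrix change. By symmetry they contribute
  equally, which gives the factor \<open>2 t\<close>; the remaining term is \<open>t\<^sup>2\<close> times the energy of \<open>\<sigma> - lam i\<close>.
\<close>

lemma variation_admissible:
  assumes i: "i \<in> I" and \<sigma>: "lam_finite \<sigma>" "J \<sigma> \<sigma> < \<infinity>" "msupport \<sigma> \<subseteq> A i"
    and ga: "pintegral \<sigma> (gopt i) = Some (ereal (a i))"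
    and \<phi>: "pintegral \<sigma> (f i) = Some (ereal \<phi>)"
    and p: "((\<lambda>j. sg i * sg j * E \<sigma> (lam j)) has_sum p) I"
    and q: "((\<lambda>j. sg i * sg j * E (lam i) (lam j)) has_sum q) I"
    and t: "0 < t" "t < 1"
  defines "lam' \<equiv> lam(i := mix t (lam i) \<sigma>)"
    and "R \<equiv> E \<sigma> \<sigma> - 2 * E \<sigma> (lam i) + E (lam i) (lam i)"
  shows "lam' \<in> admissible \<kappa> Ipos Ineg f A a g"
    and "G \<kappa> Ipos Ineg f lam' =
      Some (ereal (Q + 2 * Ftot + (2 * t * ((p + \<phi>) - (q + F i)) + t\<^sup>2 * R)))"
proof -
  have rs: "radon \<sigma>" and Js: "\<And>j. j \<in> I \<Longrightarrow> J \<sigma> (lam j) < \<infinity>" using \<sigma>(1) unfolding lam_finite_def by blast+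
  have ri: "radon (lam i)" by (rule lam_radon[OF i])
  have sfs: "sigma_finite_measure \<sigma>" by (rule sigma_finite_of_gopt[OF i rs ga])
  have Jsym: "J (lam j) \<sigma> = J \<sigma> (lam j)" if "j \<in> I" for j
    by (rule J_sym[OF lam_radon[OF that] lam_sigma_finite[OF that] rs sfs])
  have Jsym2: "J (lam j) (lam l) = J (lam l) (lam j)" if "j \<in> I" "l \<in> I" for j l
    by (intro J_sym lam_radon lam_sigma_finite that)
  have Esym: "E (lam j) \<sigma> = E \<sigma> (lam j)" if "j \<in> I" for j
    unfolding E_def Jsym[OF that] by simp
  have Esym2: "E (lam j) (lam l) = E (lam l) (lam j)" if "j \<in> I" "l \<in> I" for j l
    unfolding E_def Jsym2[OF that] by simp
  note Jl = J_lam_finite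
  have Js': "J (lam j) \<sigma> < \<infinity>" if "j \<in> I" for j using Js[OF that] Jsym[OF that] by simp
  let ?m = "mix t (lam i) \<sigma>"
  have rm: "radon ?m" by (rule radon_mix[OF ri rs t])
  have rl: "radon (lam' j)" if "j \<in> I" for j
    unfolding lam'_def using rm lam_radon[OF that] by simp
  note Eml = E_mix_left[OF ri rs t] and Emr = E_mix_right[OF ri rs t]
  define D where "D l = E \<sigma> (lam l) - E (lam i) (lam l)" for l
  \<comment> \<open>The entry \<open>(i, i)\<close> contains the mixture twice; expanded, it fits the pattern of the other entries up to
    the quadratic term.\<close>
  have main: "J (lam' j) (lam' l) < \<infinity> \<and> E (lam' j) (lam' l) = E (lam j) (lam l)
      + (t * ((if j = i then D l else 0) + (if l = i then D j else 0)) + t\<^sup>2 * (if j = i \<and> l = i then R else 0))"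
    if jl: "j \<in> I" "l \<in> I" for j l
  proof -
    consider "j \<noteq> i" "l \<noteq> i" | "j = i" "l \<noteq> i" | "j \<noteq> i" "l = i" | "j = i" "l = i" by blast
    then show ?thesis
    proof cases
      case 1
      then show ?thesis using Jl[OF jl] by (simp add: lam'_def)
    next
      case 2
      note e = Eml[OF lam_radon[OF jl(2)] Jl[OF i jl(2)] Js[OF jl(2)]]
      show ?thesis using e 2 by (simp add: lam'_def D_def algebra_simps)
    next
      case 3
      note e = Emr[OF lam_radon[OF jl(1)] Jl[OF jl(1) i] Js'[OF jl(1)]]
      show ?thesis using e 3 Esym[OF jl(1)] Esym2[OF jl(1) i] by (simp add: lam'_def D_def algebra_simps)
    next
      case 4
      note e1 = Emr[OF ri Jl[OF i i] Js'[OF i]] and e2 = Emr[OF rs Js[OF i] \<sigma>(2)]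
      note e = Eml[OF rm e1(1) e2(1)]
      show ?thesis using e(1) 4
        by (simp add: lam'_def e(2) e1(2) e2(2) Esym[OF i] D_def R_def power2_eq_square algebra_simps)
    qed
  qed
  have D_sum: "((\<lambda>l. sg i * sg l * D l) has_sum (p - q)) I"
    using has_sum_add[OF p has_sum_uminusI[OF q]] by (simp add: D_def algebra_simps)
  have in1: "inj_on (Pair i) I" and in2: "inj_on (\<lambda>j. (j, i)) I" by (auto simp: inj_on_def)
  \<comment> \<open>The perturbation of the energy matrix is supported on row \<open>i\<close>, on column \<open>i\<close> and on the diagonal entry.\<close>
  have s1: "((\<lambda>(j, l). sg j * sg l * (if j = i then D l else 0)) has_sum (p - q)) (I \<times> I)"
  proof -
    have "((\<lambda>(j, l). sg j * sg l * (if j = i then D l else 0)) has_sum (p - q)) (Pair i ` I)"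
      unfolding has_sum_reindex[OF in1] using D_sum by (simp add: o_def)
    then show ?thesis
      by (rule has_sum_superset) (use i in \<open>auto simp: image_iff split: if_splits\<close>)
  qed
  have s2: "((\<lambda>(j, l). sg j * sg l * (if l = i then D j else 0)) has_sum (p - q)) (I \<times> I)"
  proof -
    have "((\<lambda>(j, l). sg j * sg l * (if l = i then D j else 0)) has_sum (p - q)) ((\<lambda>j. (j, i)) ` I)"
      unfolding has_sum_reindex[OF in2] using D_sum by (simp add: o_def mult.commute)
    then show ?thesis
      by (rule has_sum_superset) (use i in \<open>auto simp: image_iff split: if_splits\<close>)
  qed
  have s3: "((\<lambda>(j, l). sg j * sg l * (if j = i \<and> l = i then R else 0)) has_sum R) (I \<times> I)"
  proof -
    have "((\<lambda>(j, l). sg j * sg l * (if j = i \<and> l = i then R else 0)) has_sum R) {(i, i)}"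
      using has_sum_finite[of "{(i, i)}" "\<lambda>(j, l). sg j * sg l * (if j = i \<and> l = i then R else 0)"]
      by (simp add: isign_square)
    then show ?thesis
      by (rule has_sum_superset) (use i in \<open>auto simp: image_iff split: if_splits\<close>)
  qed
  have tot: "((\<lambda>(j, l). sg j * sg l * E (lam' j) (lam' l)) has_sum (Q + (t * ((p - q) + (p - q)) + t\<^sup>2 * R))) (I \<times> I)"
  proof -
    have "((\<lambda>x. (\<lambda>(j, l). sg j * sg l * E (lam j) (lam l)) x +
        (t * ((\<lambda>(j, l). sg j * sg l * (if j = i then D l else 0)) x + (\<lambda>(j, l). sg j * sg l * (if l = i then D j else 0)) x)
        + t\<^sup>2 * (\<lambda>(j, l). sg j * sg l * (if j = i \<and> l = i then R else 0)) x))
        has_sum (Q + (t * ((p - q) + (p - q)) + t\<^sup>2 * R))) (I \<times> I)" (is "(?h has_sum ?s) _")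
      by (intro has_sum_add has_sum_cmult_right Q_has_sum s1 s2 s3)
    moreover have "?h x = (\<lambda>(j, l). sg j * sg l * E (lam' j) (lam' l)) x" if xI: "x \<in> I \<times> I" for x
    proof -
      obtain j l where x: "x = (j, l)" "j \<in> I" "l \<in> I" using xI by blast
      show ?thesis unfolding x using main[OF x(2,3)] by (simp add: algebra_simps)
    qed
    ultimately show ?thesis using has_sum_cong[of "I \<times> I" ?h "\<lambda>(j, l). sg j * sg l * E (lam' j) (lam' l)" ?s] by blast
  qed
  have ven: "venergy \<kappa> Ipos Ineg lam' lam' = Some (ereal (Q + (t * ((p - q) + (p - q)) + t\<^sup>2 * R)))"
    unfolding venergy_def psum_eq_real_iff
  proof (intro exI conjI ballI)
    fix x assume "x \<in> I \<times> I"
    then obtain j l where x: "x = (j, l)" "j \<in> I" "l \<in> I" by blast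
    show "(case x of (j, l) \<Rightarrow> Some (ereal (sg j * sg l) * energy \<kappa> (lam' j) (lam' l))) =
        Some (ereal ((\<lambda>(j, l). sg j * sg l * E (lam' j) (lam' l)) x))"
      unfolding x using energy_eq_E[OF rl[OF x(2)] rl[OF x(3)]] main[OF x(2,3)] by simp
  qed (rule tot)
  define F' where "F' j = (if j = i then (1 - t) * F i + t * \<phi> else F j)" for j
  have F': "pintegral (lam' j) (f j) = Some (ereal (F' j))" if "j \<in> I" for j
    using pintegral_mix[OF ri rs t F_pintegral[OF i] \<phi>] F_pintegral[OF that] by (simp add: lam'_def F'_def)
  have F'_sum: "(F' has_sum (Ftot + t * (\<phi> - F i))) I"
  proof -
    have "((\<lambda>j. if j = i then t * (\<phi> - F i) else 0) has_sum (t * (\<phi> - F i))) {i}"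
      using has_sum_finite[of "{i}" "\<lambda>j. if j = i then t * (\<phi> - F i) else 0"] by simp
    then have "((\<lambda>j. if j = i then t * (\<phi> - F i) else 0) has_sum (t * (\<phi> - F i))) I"
      by (rule has_sum_superset) (use i in \<open>auto simp: image_iff split: if_splits\<close>)
    from has_sum_add[OF F_has_sum this] have "((\<lambda>j. F j + (if j = i then t * (\<phi> - F i) else 0)) has_sum (Ftot + t * (\<phi> - F i))) I" .
    moreover have "(\<lambda>j. F j + (if j = i then t * (\<phi> - F i) else 0)) = F'"
      by (auto simp: F'_def algebra_simps)
    ultimately show ?thesis by simp
  qed
  have fp: "field_pairing I f lam' = Some (ereal (Ftot + t * (\<phi> - F i)))"
    unfolding field_pairing_def psum_eq_real_iff using F' F'_sum by blast
  have supp: "lam' j \<in> Mplus (A j)" if j: "j \<in> I" for j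
  proof (cases "j = i")
    case True
    have cl: "closed (A i)" by (rule A_closed[OF i])
    have "emeasure (lam i) (- A i) = 0" "emeasure \<sigma> (- A i) = 0"
      using msupport_subset_iff[OF ri cl] msupport_subset_iff[OF rs cl] \<sigma>(3) lam_Mplus[OF i] by (simp_all add: Mplus_def)
    moreover have "emeasure ?m (- A i) = ennreal (1 - t) * emeasure (lam i) (- A i) + ennreal t * emeasure \<sigma> (- A i)"
      using nn_integral_mix[OF ri rs t, of "indicator (- A i)"] cl
      by (simp add: sets_mix[OF ri rs t] radon_sets[OF ri] radon_sets[OF rs])
    ultimately have "emeasure ?m (- A i) = 0" by simp
    then have "msupport ?m \<subseteq> A i" using msupport_subset_iff[OF rm cl] by simp
    then show ?thesis using True rm by (simp add: lam'_def Mplus_def)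
  next
    case False
    then show ?thesis using lam_Mplus[OF j] by (simp add: lam'_def)
  qed
  have gadm: "pintegral (lam' j) (gopt j) = Some (ereal (a j))" if j: "j \<in> I" for j
  proof (cases "j = i")
    case True
    have "pintegral ?m (gopt i) = Some (ereal ((1 - t) * a i + t * a i))"
      by (rule pintegral_mix[OF ri rs t lam_gopt[OF i] ga])
    then show ?thesis using True by (simp add: lam'_def algebra_simps)
  next
    case False
    then show ?thesis using lam_gopt[OF j] by (simp add: lam'_def)
  qed
  show "lam' \<in> admissible \<kappa> Ipos Ineg f A a g"
    unfolding admissible_def venergy_finite_def vmeasures_def is_finite_def
    using supp gadm[unfolded gopt_def[abs_def]] ven fp by blast
  have "Q + (t * ((p - q) + (p - q)) + t\<^sup>2 * R) + 2 * (Ftot + t * (\<phi> - F i)) =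
      Q + 2 * Ftot + (2 * t * ((p + \<phi>) - (q + F i)) + t\<^sup>2 * R)" by (simp add: algebra_simps)
  then show "G \<kappa> Ipos Ineg f lam' =
      Some (ereal (Q + 2 * Ftot + (2 * t * ((p + \<phi>) - (q + F i)) + t\<^sup>2 * R)))"
    unfolding G_def ven fp by (simp add: opt_add_def ext_add_def)
qed

lemma G_lam: "G \<kappa> Ipos Ineg f lam = Some (ereal (Q + 2 * Ftot))"
  unfolding G_def venergy_lam field_pairing_lam by (simp add: opt_add_def ext_add_def)

lemma variation:
  assumes i: "i \<in> I" and \<sigma>: "lam_finite \<sigma>" "J \<sigma> \<sigma> < \<infinity>" "msupport \<sigma> \<subseteq> A i"
    and ga: "pintegral \<sigma> (gopt i) = Some (ereal (a i))"
    and \<phi>: "pintegral \<sigma> (f i) = Some (ereal \<phi>)"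
    and p: "((\<lambda>j. sg i * sg j * E \<sigma> (lam j)) has_sum p) I"
    and q: "((\<lambda>j. sg i * sg j * E (lam i) (lam j)) has_sum q) I"
  shows "q + F i \<le> p + \<phi>"
proof -
  let ?R = "E \<sigma> \<sigma> - 2 * E \<sigma> (lam i) + E (lam i) (lam i)"
  have "0 \<le> 2 * t * ((p + \<phi>) - (q + F i)) + t\<^sup>2 * ?R" if t: "0 < t" "t < 1" for t
  proof -
    note v = variation_admissible[OF i \<sigma> ga \<phi> p q t]
    have "G_inf \<kappa> Ipos Ineg f A a g \<le> ereal (Q + 2 * Ftot + (2 * t * ((p + \<phi>) - (q + F i)) + t\<^sup>2 * ?R))"
      unfolding G_inf_def using v by (intro Inf_lower) blast
    moreover have "G_inf \<kappa> Ipos Ineg f A a g = ereal (Q + 2 * Ftot)"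
      using equil G_lam unfolding equilibrium_measures_def by simp
    ultimately show ?thesis by simp
  qed
  then have "0 \<le> (p + \<phi>) - (q + F i)" by (rule nonneg_of_small_perturbation)
  then show ?thesis by simp
qed

end

section \<open>The minimum of the weighted potential\<close>

context gauss
begin

lemma lam_row_sum:
  assumes i: "i \<in> I"
  obtains q where "((\<lambda>j. sg i * sg j * E (lam i) (lam j)) has_sum q) I"
    "pintegral (lam i) (Wlam i) = Some (ereal (q + F i))"
proof -
  obtain H where H: "((\<lambda>j. sg i * sg j * E (lam i) (lam j)) has_sum (\<integral>x. H x \<partial>lam i)) I"
    by (rule lam_finite_potential[OF lam_finite_lam[OF i] i]) (rule that)
  show ?thesis
    by (rule that[OF H W_pintegral[OF lam_finite_lam[OF i] i F_pintegral[OF i] H]])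
qed

text \<open>
  The function \<open>a\<^sub>i W\<^sup>i / g\<^sub>i\<close> whose infimum nearly everywhere is sought.
\<close>

definition weightedW :: "nat \<Rightarrow> 'a \<Rightarrow> ereal option" where
  "weightedW i x = map_option (\<lambda>w. ereal (a i) * w / ereal (g i x)) (Wlam i x)"

text \<open>
  The exceptional set is Borel and has capacity zero, so it is null for \<open>lam i\<close>; integrate
  \<open>r g\<^sub>i \<le> a\<^sub>i W\<^sup>i\<close>.
\<close>

lemma ne_upper_bound:
  assumes i: "i \<in> I" and W: "pintegral (lam i) (Wlam i) = Some (ereal \<eta>)"
    and ne: "nearly_everywhere \<kappa> (A i) (\<lambda>x. \<exists>v. weightedW i x = Some v \<and> ereal r \<le> v)"
  shows "r \<le> \<eta>"
proof -
  let ?W = "Wlam i"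
  let ?N = "{x\<in>A i. \<not> (\<exists>v. weightedW i x = Some v \<and> ereal r \<le> v)}"
  have [measurable]: "(\<lambda>x. val (?W x)) \<in> borel_measurable borel"
    using W_pmeas[OF i, unfolded pmeas_def] by (rule conjunct1)
  have None_meas: "{x. ?W x = None} \<in> sets borel"
    using W_pmeas[OF i, unfolded pmeas_def] by simp
  have [measurable]: "gval i \<in> borel_measurable borel" by (rule gval_measurable[OF i])
  have [measurable]: "A i \<in> sets borel" using A_closed[OF i] by simp
  have "?N = A i \<inter> ({x. ?W x = None} \<union> {x\<in>space borel. \<not> ereal r \<le> ereal (a i) * val (?W x) / ereal (gval i x)})"
  proof -
    have eq: "\<not> (\<exists>v. weightedW i x = Some v \<and> ereal r \<le> v) \<longleftrightarrow>
        ?W x = None \<or> \<not> ereal r \<le> ereal (a i) * val (?W x) / ereal (gval i x)" if "x \<in> A i" for x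
      using that by (cases "?W x") (simp_all add: weightedW_def gval_def)
    show ?thesis
    proof (rule set_eqI)
      fix x
      show "x \<in> ?N \<longleftrightarrow> x \<in> A i \<inter> ({x. ?W x = None} \<union> {x\<in>space borel. \<not> ereal r \<le> ereal (a i) * val (?W x) / ereal (gval i x)})"
        by (cases "x \<in> A i") (simp_all only: mem_Collect_eq Int_iff Un_iff space_borel UNIV_I eq simp_thms)
    qed
  qed
  also have "\<dots> \<in> sets borel"
    by (intro sets.Int sets.Un None_meas) measurable
  finally have N: "?N \<in> sets borel" .
  have "int_capacity \<kappa> ?N = 0" using ne unfolding nearly_everywhere_def .
  then have null: "emeasure (lam i) ?N = 0"
    by (rule capacity_zero_null[OF _ N lam_radon[OF i] lam_sigma_finite[OF i] J_lam_finite[OF i i]])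
  have "AE x in lam i. x \<notin> ?N"
    using null N radon_sets[OF lam_radon[OF i]] by (intro AE_not_in) (simp add: null_sets_def)
  moreover note Wp = W[unfolded pintegral_eq_real_iff]
  have Wa: "AE x in lam i. ?W x = Some (ereal (rval (?W x)))" and Wi: "integrable (lam i) (\<lambda>x. rval (?W x))"
    and Wv: "\<eta> = (\<integral>x. rval (?W x) \<partial>lam i)"
    by (rule Wp[THEN conjunct2, THEN conjunct2, THEN conjunct1] Wp[THEN conjunct2, THEN conjunct1]
        Wp[THEN conjunct2, THEN conjunct2, THEN conjunct2])+
  note gd = gopt_pintegralD[OF i lam_gopt[OF i]]
  have ptw: "r * gval i x \<le> a i * rval (?W x)"
    if x: "x \<notin> ?N" "x \<in> A i" and Wx: "?W x = Some (ereal (rval (?W x)))" for x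
  proof -
    obtain v where v: "weightedW i x = Some v" "ereal r \<le> v" using x by blast
    have g: "0 < g i x" by (rule g_pos[OF i x(2)])
    obtain w where w: "?W x = Some (ereal w)" using Wx by blast
    have "v = ereal (a i * w / g i x)" using v(1) w g by (simp add: weightedW_def)
    then have "r \<le> a i * w / g i x" using v(2) by simp
    then have "r * g i x \<le> a i * w" using g by (simp add: le_divide_eq)
    then show ?thesis using w x(2) by (simp add: gval_def)
  qed
  have "(\<integral>x. r * gval i x \<partial>lam i) \<le> (\<integral>x. a i * rval (?W x) \<partial>lam i)"
  proof (rule integral_mono_AE)
    show "AE x in lam i. r * gval i x \<le> a i * rval (?W x)"
      using \<open>AE x in lam i. x \<notin> ?N\<close> gd(3) Wa by eventually_elim (rule ptw)
  qed (intro integrable_mult_right gd(1) Wi)+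
  then have "r * a i \<le> a i * \<eta>" using gd(2) Wv by simp
  then show ?thesis using a_pos[OF i] by simp
qed

text \<open>
  At a point where the inequality \<open>\<eta> \<le> a\<^sub>i W\<^sup>i / g\<^sub>i\<close> fails, an undefined \<open>W\<^sup>i\<close> is excluded by the finiteness of
  the potential and of the subtracted part of the field; and the other part cannot be infinite, since then
  \<open>W\<^sup>i = \<infinity>\<close>.
\<close>

lemma weightedW_below_imp_field_finite:
  assumes i: "i \<in> I" and x: "x \<in> A i" and no: "\<not> (\<exists>v. weightedW i x = Some v \<and> ereal \<eta> \<le> v)"
    and V: "pot i x = Some (ereal h)"
    and fx: "f i x = ext_add u (- v)" and uv: "u \<noteq> - \<infinity>" "v \<noteq> - \<infinity>" "v \<noteq> \<infinity>"
  shows "\<bar>u\<bar> \<noteq> \<infinity>" "f i x = Some (ereal (real_of_ereal u - real_of_ereal v))"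
    "a i * (h + (real_of_ereal u - real_of_ereal v)) < \<eta> * gval i x"
proof -
  have g: "0 < g i x" by (rule g_pos[OF i x])
  have ap: "0 < a i" by (rule a_pos[OF i])
  obtain v' where v': "v = ereal v'" using uv by (cases v) auto
  have u: "u \<noteq> \<infinity>"
  proof
    assume u: "u = \<infinity>"
    have "Wlam i x = Some \<infinity>"
      unfolding W_def V fx u v' by (simp add: opt_add_def ext_add_def)
    then have "weightedW i x = Some \<infinity>" using ap g by (simp add: weightedW_def)
    with no show False by simp
  qed
  then obtain u' where u': "u = ereal u'" using uv by (cases u) auto
  show "\<bar>u\<bar> \<noteq> \<infinity>" using u' by simp
  show fx': "f i x = Some (ereal (real_of_ereal u - real_of_ereal v))"
    unfolding fx u' v' by (simp add: ext_add_def)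
  have "weightedW i x = Some (ereal (a i * (h + (u' - v')) / g i x))"
    unfolding weightedW_def W_def V fx' u' v' using g by (simp add: opt_add_def ext_add_def)
  then have "a i * (h + (u' - v')) / g i x < \<eta>" using no by simp
  then have "a i * (h + (u' - v')) < \<eta> * g i x" using g by (simp add: divide_less_eq)
  then show "a i * (h + (real_of_ereal u - real_of_ereal v)) < \<eta> * gval i x"
    using x by (simp add: gval_def u' v')
qed

text \<open>
  A unit measure \<open>\<nu>\<close> of finite energy on a compact part of the exceptional set is turned into a
  competitor \<open>\<sigma>\<close> that violates \<open>variation\<close>. Points of the exceptional set where \<open>W\<^sup>i\<close> is undefined do
  no harm: \<open>\<nu>\<close>-almost everywhere the potential and \<open>f2\<close> are finite.
\<close>

lemma ne_lower_bound:
  assumes i: "i \<in> I" and q: "((\<lambda>j. sg i * sg j * E (lam i) (lam j)) has_sum q) I"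
  shows "nearly_everywhere \<kappa> (A i) (\<lambda>x. \<exists>v. weightedW i x = Some v \<and> ereal (q + F i) \<le> v)"
proof (rule ccontr)
  let ?\<eta> = "q + F i"
  let ?bad = "{x\<in>A i. \<not> (\<exists>v. weightedW i x = Some v \<and> ereal ?\<eta> \<le> v)}"
  assume "\<not> nearly_everywhere \<kappa> (A i) (\<lambda>x. \<exists>v. weightedW i x = Some v \<and> ereal ?\<eta> \<le> v)"
  then have "int_capacity \<kappa> ?bad \<noteq> 0" unfolding nearly_everywhere_def .
  then obtain \<nu> where r: "radon \<nu>" and J\<nu>: "J \<nu> \<nu> < \<infinity>" and one: "emeasure \<nu> UNIV = 1"
      and cK: "compact (msupport \<nu>)" and Kbad: "msupport \<nu> \<subseteq> ?bad"
    by (rule int_capacity_nonzeroD) (rule that)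
  let ?K = "msupport \<nu>"
  have sb [simp, measurable_cong]: "sets \<nu> = sets borel" by (rule radon_sets[OF r])
  have fin: "emeasure \<nu> UNIV < \<infinity>" using one by simp
  have sf: "sigma_finite_measure \<nu>" by (rule finite_imp_sigma_finite[OF r fin])
  interpret \<nu>: finite_measure \<nu>
    using one radon_space[OF r] by (intro finite_measureI) simp
  have Kcl: "closed ?K" by (rule msupport_closed)
  then have [measurable]: "?K \<in> sets borel" by simp
  have KA: "?K \<subseteq> A i" using Kbad by blast
  obtain f1 f2 where f12: "f1 \<in> Phi" "f2 \<in> Phi" and cap2: "int_capacity \<kappa> {x. f2 x = \<infinity>} = 0"
      and fi: "\<And>x. f i x = ext_add (f1 x) (- f2 x)"
    by (rule field_parts[OF i]) (rule that)
  have [measurable]: "f1 \<in> borel_measurable borel" "f2 \<in> borel_measurable borel"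
    using f12 by (simp_all add: Phi_measurable)
  define y where "y x = real_of_ereal (f1 x) - real_of_ereal (f2 x)" for x
  have [measurable]: "y \<in> borel_measurable borel" unfolding y_def[abs_def] by measurable
  have lam_finite\<nu>: "lam_finite \<nu>" by (rule lam_finite_of_finite_energy[OF r fin J\<nu>])
  obtain H where H: "AE x in \<nu>. pot i x = Some (ereal (H x))"
    by (rule lam_finite_potential[OF lam_finite\<nu> i]) (rule that)
  have aeK: "AE x in \<nu>. x \<in> ?K"
    using radon_null_Compl_msupport[OF r] by (intro AE_I[of _ _ "- ?K"]) auto
  have N2: "{x. f2 x = \<infinity>} \<in> sets borel" by measurable
  have "emeasure \<nu> {x. f2 x = \<infinity>} = 0"
    by (rule capacity_zero_null[OF cap2 N2 r sf J\<nu>])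
  then have ae2: "AE x in \<nu>. f2 x \<noteq> \<infinity>"
    by (intro AE_I[of _ _ "{x. f2 x = \<infinity>}"]) (use N2 in auto)
  let ?V = "\<lambda>x. rval (pot i x)"
  have ae: "AE x in \<nu>. x \<in> ?K \<and> \<bar>f1 x\<bar> \<noteq> \<infinity> \<and> \<bar>f2 x\<bar> \<noteq> \<infinity> \<and> f i x = Some (ereal (y x))
      \<and> a i * (?V x + y x) < ?\<eta> * gval i x"
    using H aeK ae2
  proof eventually_elim
    case (elim x)
    have xA: "x \<in> A i" and no: "\<not> (\<exists>v. weightedW i x = Some v \<and> ereal ?\<eta> \<le> v)" using elim(2) Kbad by blast+
    note * = weightedW_below_imp_field_finite[OF i xA no elim(1) fi Phi_not_minf[OF f12(1)] Phi_not_minf[OF f12(2)] elim(3)]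
    have "\<bar>f2 x\<bar> \<noteq> \<infinity>" using elim(3) Phi_not_minf[OF f12(2), of x] by (cases "f2 x") auto
    then show ?case using * elim(1,2) by (simp add: y_def)
  qed
  \<comment> \<open>On \<open>T n\<close> both parts of the field are bounded; these sets exhaust the support of \<open>\<nu>\<close> up to a null set.\<close>
  define T where "T n = {x\<in>?K. \<bar>f1 x\<bar> \<le> ereal (real n) \<and> \<bar>f2 x\<bar> \<le> ereal (real n)}" for n :: nat
  have Tm [measurable]: "T n \<in> sets borel" for n
  proof -
    have "T n = ?K \<inter> {x. \<bar>f1 x\<bar> \<le> ereal (real n) \<and> \<bar>f2 x\<bar> \<le> ereal (real n)}" by (auto simp: T_def)
    then show ?thesis by simp
  qed
  have "\<exists>n. emeasure \<nu> (T n) \<noteq> 0"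
  proof (rule ccontr)
    assume "\<nexists>n. emeasure \<nu> (T n) \<noteq> 0"
    then have "AE x in \<nu>. x \<notin> T n" for n
      by (intro AE_not_in) (simp add: null_sets_def)
    then have "AE x in \<nu>. \<forall>n. x \<notin> T n" by (simp add: AE_all_countable)
    with ae have "AE x in \<nu>. False"
    proof eventually_elim
      case (elim x)
      obtain u v where uv: "f1 x = ereal u" "f2 x = ereal v"
        using elim(1) by (cases "f1 x"; cases "f2 x") auto
      obtain n where "max \<bar>u\<bar> \<bar>v\<bar> \<le> real n" using real_arch_simple by blast
      then have "x \<in> T n" using elim(1) uv by (simp add: T_def)
      with elim(2) show ?case by blast
    qed
    then have "emeasure \<nu> {x\<in>space \<nu>. \<not> False} = 0" by (rule AE_E2)
    then have "emeasure \<nu> (space \<nu>) = 0" by simp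
    then show False using one radon_space[OF r] by simp
  qed
  then obtain n where n: "emeasure \<nu> (T n) \<noteq> 0" ..
  let ?T = "T n"
  have TK: "?T \<subseteq> ?K" by (auto simp: T_def)
  have finT: "emeasure \<nu> ?T < \<infinity>"
    using emeasure_mono[of ?T UNIV \<nu>] fin by (simp add: le_less_trans)
  have bounded_int: "integrable \<nu> (\<lambda>x. indicator ?T x * h x)"
    if [measurable]: "h \<in> borel_measurable borel" and b: "\<And>x. x \<in> ?T \<Longrightarrow> \<bar>h x\<bar> \<le> B" for h :: "'a \<Rightarrow> real" and B :: real
  proof (rule \<nu>.integrable_const_bound[of _ "max B 0"])
    show "AE x in \<nu>. norm (indicator ?T x * h x) \<le> max B 0"
      using b by (intro AE_I2) (auto simp: indicator_def le_max_iff_disj)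
  qed measurable
  have gm: "gval i \<in> borel_measurable borel" by (rule gval_measurable[OF i])
  have "compact (g i ` ?K)"
    by (rule compact_continuous_image[OF continuous_on_subset[OF g_cont[OF i] KA] cK])
  then obtain B where B: "\<forall>v\<in>g i ` ?K. norm v \<le> B"
    using compact_imp_bounded bounded_iff by metis
  have gB: "\<bar>gval i x\<bar> \<le> B" if "x \<in> ?T" for x
    using that TK KA B by (auto simp: gval_def subset_iff)
  have gint: "integrable \<nu> (\<lambda>x. indicator ?T x * gval i x)" by (rule bounded_int[OF gm gB])
  have yB: "\<bar>y x\<bar> \<le> 2 * real n" if xT: "x \<in> ?T" for x
  proof -
    obtain u v where "f1 x = ereal u" "f2 x = ereal v" "\<bar>u\<bar> \<le> real n" "\<bar>v\<bar> \<le> real n"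
      using xT by (cases "f1 x"; cases "f2 x") (auto simp: T_def)
    then show ?thesis by (simp add: y_def)
  qed
  have yint: "integrable \<nu> (\<lambda>x. indicator ?T x * y x)" by (rule bounded_int[OF _ yB]) measurable
  let ?g0 = "\<integral>x. indicator ?T x * gval i x \<partial>\<nu>"
  have g0: "0 < ?g0"
  proof -
    have "?g0 \<noteq> 0"
    proof
      assume "?g0 = 0"
      then have "AE x in \<nu>. indicator ?T x * gval i x = 0"
        using gint by (subst (asm) integral_nonneg_eq_0_iff_AE)
          (auto intro!: AE_I2 simp: gval_def indicator_def less_imp_le g_pos[OF i])
      moreover have off: "x \<notin> ?T" if "indicator ?T x * gval i x = 0" for x
      proof
        assume "x \<in> ?T"
        then have "x \<in> A i" using TK KA by blast
        then show False using that \<open>x \<in> ?T\<close> g_pos[OF i, of x] by (simp add: gval_def)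
      qed
      ultimately have "AE x in \<nu>. x \<notin> ?T" by (elim eventually_mono)
      then have "emeasure \<nu> ?T = 0" by (subst (asm) AE_iff_measurable[of ?T]) (auto simp: radon_space[OF r])
      with n show False by simp
    qed
    moreover have "0 \<le> ?g0"
      by (rule integral_nonneg_AE) (auto intro!: AE_I2 simp: gval_def indicator_def less_imp_le g_pos[OF i])
    ultimately show ?thesis by simp
  qed
  \<comment> \<open>The factor for which \<open>\<sigma>\<close> satisfies the constraint \<open>\<langle>g\<^sub>i, \<sigma>\<rangle> = a\<^sub>i\<close>.\<close>
  define s where "s = a i / ?g0"
  have s: "0 < s" using g0 a_pos[OF i] by (simp add: s_def)
  note sr = r Tm finT s
  define \<sigma> where "\<sigma> = scaled_restr \<nu> s ?T"
  have rs: "radon \<sigma>" unfolding \<sigma>_def by (rule radon_scaled_restr[OF sr])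
  have fs: "emeasure \<sigma> UNIV < \<infinity>" unfolding \<sigma>_def by (rule finite_scaled_restr[OF sr])
  have Js: "J \<sigma> \<sigma> < \<infinity>" unfolding \<sigma>_def by (rule J_scaled_restr_finite[OF sr J\<nu>])
  have lam_finite\<sigma>: "lam_finite \<sigma>" by (rule lam_finite_of_finite_energy[OF rs fs Js])
  have sup\<sigma>: "msupport \<sigma> \<subseteq> A i"
    using msupport_scaled_restr[OF sr Kcl TK] KA unfolding \<sigma>_def by blast
  have ae\<sigma>: "AE x in \<sigma>. x \<in> ?K \<and> f i x = Some (ereal (y x)) \<and> a i * (?V x + y x) < ?\<eta> * gval i x"
    unfolding \<sigma>_def by (rule AE_scaled_restr[OF sr]) (use ae in eventually_elim, blast)
  have gi: "integrable \<sigma> (gval i)" and gv: "(\<integral>x. gval i x \<partial>\<sigma>) = a i"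
    using integral_scaled_restr[OF r Tm s gm gint] g0 unfolding \<sigma>_def by (simp_all add: s_def)
  have yi: "integrable \<sigma> y"
    unfolding \<sigma>_def by (rule integral_scaled_restr(1)[OF r Tm s _ yint]) measurable
  have ss: "sets \<sigma> = sets borel" by (rule radon_sets[OF rs])
  have ga: "pintegral \<sigma> (gopt i) = Some (ereal (a i))"
    unfolding gv[symmetric]
  proof (rule pintegral_realI[OF _ gi])
    show "(\<lambda>x. val (gopt i x)) \<in> borel_measurable \<sigma>"
      unfolding val_gopt using gm ss by (simp cong: measurable_cong_sets)
    show "AE x in \<sigma>. gopt i x = Some (ereal (gval i x))"
      using ae\<sigma> by eventually_elim (use KA in \<open>auto simp: gopt_def gval_def\<close>)
  qed
  have fp: "pintegral \<sigma> (f i) = Some (ereal (\<integral>x. y x \<partial>\<sigma>))"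
  proof (rule pintegral_realI[OF _ yi])
    show "(\<lambda>x. val (f i x)) \<in> borel_measurable \<sigma>"
      using field_pmeas[OF i, folded pmeas_cong_sets[OF ss], unfolded pmeas_def] by (rule conjunct1)
    show "AE x in \<sigma>. f i x = Some (ereal (y x))" using ae\<sigma> by eventually_elim blast
  qed
  obtain H' where H': "integrable \<sigma> H'" "AE x in \<sigma>. pot i x = Some (ereal (H' x))"
    "((\<lambda>j. sg i * sg j * E \<sigma> (lam j)) has_sum (\<integral>x. H' x \<partial>\<sigma>)) I"
    by (rule lam_finite_potential[OF lam_finite\<sigma> i]) (rule that)
  have le: "?\<eta> \<le> (\<integral>x. H' x \<partial>\<sigma>) + (\<integral>x. y x \<partial>\<sigma>)"
    by (rule variation[OF i lam_finite\<sigma> Js sup\<sigma> ga fp H'(3) q])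
  interpret \<sigma>: finite_measure \<sigma>
    using fs radon_space[OF rs] by (intro finite_measureI) (simp add: less_top[symmetric])
  have ne0: "emeasure \<sigma> (space \<sigma>) \<noteq> 0"
    using n s radon_space[OF rs] emeasure_scaled_restr[OF sr, of UNIV] unfolding \<sigma>_def by simp
  have "(\<integral>x. a i * (H' x + y x) \<partial>\<sigma>) < (\<integral>x. ?\<eta> * gval i x \<partial>\<sigma>)"
  proof (rule \<sigma>.integral_less_AE_space[OF _ _ _ ne0])
    show "integrable \<sigma> (\<lambda>x. a i * (H' x + y x))"
      by (intro integrable_mult_right Bochner_Integration.integrable_add H'(1) yi)
    show "integrable \<sigma> (\<lambda>x. ?\<eta> * gval i x)" by (intro integrable_mult_right gi)
    show "AE x in \<sigma>. a i * (H' x + y x) < ?\<eta> * gval i x"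
      using ae\<sigma> H'(2) by eventually_elim simp
  qed
  also have "(\<integral>x. a i * (H' x + y x) \<partial>\<sigma>) = a i * ((\<integral>x. H' x \<partial>\<sigma>) + (\<integral>x. y x \<partial>\<sigma>))"
    using Bochner_Integration.integral_add[OF H'(1) yi] by simp
  also have "(\<integral>x. ?\<eta> * gval i x \<partial>\<sigma>) = a i * ?\<eta>" using gv by (simp add: mult.commute)
  finally have "(\<integral>x. H' x \<partial>\<sigma>) + (\<integral>x. y x \<partial>\<sigma>) < ?\<eta>" using a_pos[OF i] by simp
  with le show False by simp
qed

lemma weighted_W_inf_eq:
  assumes i: "i \<in> I" and q: "((\<lambda>j. sg i * sg j * E (lam i) (lam j)) has_sum q) I"
    and W: "pintegral (lam i) (Wlam i) = Some (ereal (q + F i))"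
  shows "Winf i = ereal (q + F i)"
proof -
  let ?S = "{ereal r | r::real. nearly_everywhere \<kappa> (A i) (\<lambda>x. \<exists>v. weightedW i x = Some v \<and> ereal r \<le> v)}"
  have "Sup ?S = ereal (q + F i)"
  proof (rule antisym)
    show "Sup ?S \<le> ereal (q + F i)"
    proof (rule Sup_least)
      fix z assume "z \<in> ?S"
      then obtain r where "z = ereal r" "nearly_everywhere \<kappa> (A i) (\<lambda>x. \<exists>v. weightedW i x = Some v \<and> ereal r \<le> v)" by blast
      then show "z \<le> ereal (q + F i)" using ne_upper_bound[OF i W] by simp
    qed
    show "ereal (q + F i) \<le> Sup ?S"
      by (rule Sup_upper) (use ne_lower_bound[OF i q] in blast)
  qed
  then show ?thesis unfolding weighted_W_inf_def ne_Inf_def weightedW_def .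
qed

lemma equilibrium_identities:
  shows "\<And>i. i \<in> I \<Longrightarrow> pintegral (lam i) (Wlam i) = Some (Winf i)"
    and "G \<kappa> Ipos Ineg f lam =
           opt_add (psum I (\<lambda>i. Some (Winf i))) (field_pairing I f lam)"
proof -
  have "\<forall>i\<in>I. \<exists>q. ((\<lambda>j. sg i * sg j * E (lam i) (lam j)) has_sum q) I
      \<and> pintegral (lam i) (Wlam i) = Some (ereal (q + F i))"
  proof
    fix i assume i: "i \<in> I"
    obtain q where "((\<lambda>j. sg i * sg j * E (lam i) (lam j)) has_sum q) I"
        "pintegral (lam i) (Wlam i) = Some (ereal (q + F i))"
      by (rule lam_row_sum[OF i]) (rule that)
    then show "\<exists>q. ((\<lambda>j. sg i * sg j * E (lam i) (lam j)) has_sum q) I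
      \<and> pintegral (lam i) (Wlam i) = Some (ereal (q + F i))" by blast
  qed
  then obtain q where q: "\<forall>i\<in>I. ((\<lambda>j. sg i * sg j * E (lam i) (lam j)) has_sum q i) I
      \<and> pintegral (lam i) (Wlam i) = Some (ereal (q i + F i))"
    by (rule bchoice[THEN exE])
  have q1: "((\<lambda>j. sg i * sg j * E (lam i) (lam j)) has_sum q i) I"
    and q2: "pintegral (lam i) (Wlam i) = Some (ereal (q i + F i))" if "i \<in> I" for i
    using bspec[OF q that] by blast+
  have inf: "Winf i = ereal (q i + F i)" if "i \<in> I" for i
    by (rule weighted_W_inf_eq[OF that q1[OF that] q2[OF that]])
  show "pintegral (lam i) (Wlam i) = Some (Winf i)" if "i \<in> I" for i
    unfolding inf[OF that] by (rule q2[OF that])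
  have "(q has_sum Q) I"
    by (rule has_sum_SigmaD[OF Q_has_sum]) (use q1 in simp)
  then have "((\<lambda>i. q i + F i) has_sum (Q + Ftot)) I" by (rule has_sum_add[OF _ F_has_sum])
  then have "psum I (\<lambda>i. Some (Winf i)) = Some (ereal (Q + Ftot))"
    unfolding psum_eq_real_iff by (intro exI[of _ "\<lambda>i. q i + F i"] conjI ballI) (simp_all only: inf)
  then show "G \<kappa> Ipos Ineg f lam =
           opt_add (psum I (\<lambda>i. Some (Winf i))) (field_pairing I f lam)"
    unfolding G_lam field_pairing_lam by (simp add: opt_add_def ext_add_def)
qed

end

theorem corollary7p3:
  fixes \<kappa> :: "'a::t2_space \<times> 'a \<Rightarrow> ereal"
    and Ipos Ineg :: "nat set"
    and A :: "nat \<Rightarrow> 'a set"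
    and f :: "nat \<Rightarrow> 'a \<Rightarrow> ereal option"
    and a :: "nat \<Rightarrow> real"
    and g :: "nat \<Rightarrow> 'a \<Rightarrow> real"
    and lam :: "nat \<Rightarrow> 'a measure"
  assumes "locally_compact_space (euclidean :: 'a topology)"
    and "positive_definite_kernel \<kappa>"
    and "condenser Ipos Ineg A"
    and "external_field \<kappa> (Ipos \<union> Ineg) f"
    and "\<forall>i\<in>Ipos \<union> Ineg. 0 < a i"
    and "\<forall>i\<in>Ipos \<union> Ineg. continuous_on (A i) (g i) \<and> (\<forall>x\<in>A i. 0 < g i x)"
    and "lam \<in> equilibrium_measures \<kappa> Ipos Ineg f A a g"
  shows "(\<forall>i\<in>Ipos \<union> Ineg.
            pintegral (lam i) (W \<kappa> Ipos Ineg f lam i) = Some (weighted_W_inf \<kappa> Ipos Ineg f A a g lam i))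
       \<and> G \<kappa> Ipos Ineg f lam =
           opt_add (psum (Ipos \<union> Ineg) (\<lambda>i. Some (weighted_W_inf \<kappa> Ipos Ineg f A a g lam i)))
                   (field_pairing (Ipos \<union> Ineg) f lam)"
proof -
  note pd = assms(2)[unfolded positive_definite_kernel_def]
  have Phi: "\<kappa> \<in> Phi" by (rule pd[THEN conjunct1])
  obtain c where c: "0 \<le> c" "\<And>z. 0 \<le> \<kappa> z + ereal c" "c = 0 \<or> compact (UNIV :: 'a set)"
    by (rule Phi_bounded_below_shift[OF Phi]) (rule that)
  interpret gauss \<kappa> c Ipos Ineg A f a g lam
  proof
    show "lsc \<kappa>" using Phi by (simp add: Phi_def)
    show "\<kappa> (x, y) = \<kappa> (y, x)" for x y by (rule pd[THEN conjunct2, THEN conjunct1, rule_format])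
    show "0 \<le> e" if "\<nu> \<in> signed_radon" "signed_energy \<kappa> \<nu> \<nu> = Some e" for \<nu> e
      using pd[THEN conjunct2, THEN conjunct2] that by blast
    show "0 < a i" if "i \<in> Ipos \<union> Ineg" for i using assms(5) that by (rule bspec)
    show "continuous_on (A i) (g i)" if "i \<in> Ipos \<union> Ineg" for i
      using bspec[OF assms(6) that] by (rule conjunct1)
    show "0 < g i x" if "i \<in> Ipos \<union> Ineg" "x \<in> A i" for i x
      using bspec[OF bspec[OF assms(6) that(1), THEN conjunct2] that(2)] .
  qed (rule assms c)+
  show ?thesis by (intro conjI ballI equilibrium_identities)
qed

end
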